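(* Let $n\ge 1$, let $B_n$ be the hyperoctahedral group of signed permutations of $\{\pm1,\dots,\pm n\}$ and let $c=(1,2,\dots,n,-1,-2,\dots,-n)$. There is a bijection $\varphi_B:\alpha\mapsto \mathbf{w}$, $\mathbf{w}: e=\omega_0<\omega_1<\cdots<\omega_n=c$, between the set $\mathrm{PF}^B_n$ of parking functions of type $B$ of size $n$ and the set of maximal chains in $\mathrm{NC}(B_n,c)$ such that for each $i\in\{1,\dots,n\}$ the $i$th car of $\alpha$ is reluctant if and only if $(\omega_{i-1},\omega_i)$ is a bad edge.
   Context: Parking functions of type $B$: a parking function of type $B$ of size $n$ is any $n$-tuple $\alpha=(a_1,\dots,a_n)$ with $a_i\in\{1,\dots,n\}$. The $n$ parking spaces $1,\dots,n$ are arranged in a circle (space $1$ follows space $n$). Cars $C_1,\dots,C_n$ arrive in order; $C_i$ parks at its preferred space $a_i$ if it is free and otherwise moves on around the circle to the next available space. If $C_i$ parks at $p_i$, then $C_i$ is lucky if $p_i=a_i$ and reluctant if $p_i\neq a_i$. Noncrossing partition lattice: $B_n$ is the group of bijections $\omega$ of $\{\pm1,\dots,\pm n\}$ with $\omega(-i)=-\omega(i)$. Its simple generators $S$ are $(1,-1)$ and $(i,i+1)(-i,-(i+1))$ for $1\le i\le n-1$; its set $T$ of reflections consists of $(i,-i)$ for $1\le i\le n$ and $(i,j)(-i,-j)$, $(i,-j)(-i,j)$ for $1\le i<j\le n$. The product $\sigma\tau$ means: first apply $\tau$, then $\sigma$. Let $\ell_S(\omega)$ (resp. $\ell_T(\omega)$)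 be the minimal number of factors in an expression of $\omega$ as a product of elements of $S$ (resp. $T$). The absolute order is: $\omega<\omega'$ iff $\omega\ne\omega'$ and $\ell_T(\omega')=\ell_T(\omega)+\ell_T(\omega^{-1}\omega')$. Then $\mathrm{NC}(B_n,c)=\{\omega\in B_n:e\le\omega\le c\}$ with the absolute order. The (strong) Bruhat order $\le_B$ is the partial order generated by $\omega<_B\omega t$ for $t\in T$ with $\ell_S(\omega)<\ell_S(\omega t)$. An edge is a pair $(\mu,\nu)$ of elements of $\mathrm{NC}(B_n,c)$ such that $\nu$ covers $\mu$ in the absolute order; it is good if $\mu<_B\nu$ and bad if $\mu>_B\nu$. *)

theory Defs
  imports Main "HOL-Combinatorics.Combinatorics"
begin

definition parking_functions_B :: "nat \<Rightarrow> nat list set" where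
  "parking_functions_B n = {\<alpha>. length \<alpha> = n \<and> set \<alpha> \<subseteq> {1..n}}"

definition circ_shift :: "nat \<Rightarrow> nat \<Rightarrow> nat \<Rightarrow> nat" where
  "circ_shift n a k = (a - 1 + k) mod n + 1"

definition next_free :: "nat \<Rightarrow> nat set \<Rightarrow> nat \<Rightarrow> nat" where
  "next_free n Occ a = circ_shift n a (LEAST k. circ_shift n a k \<notin> Occ)"

text \<open>The list of spaces taken by the cars, starting from the set of occupied spaces \<open>Occ\<close>.\<close>

fun park :: "nat \<Rightarrow> nat set \<Rightarrow> nat list \<Rightarrow> nat list" where
  "park n Occ [] = []"
| "park n Occ (a # \<alpha>) = (let p = next_free n Occ a in p # park n (insert p Occ) \<alpha>)"

text \<open>Cars are numbered from 1, list positions from 0.\<close>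

definition reluctant :: "nat \<Rightarrow> nat list \<Rightarrow> nat \<Rightarrow> bool" where
  "reluctant n \<alpha> i \<longleftrightarrow> park n {} \<alpha> ! (i - 1) \<noteq> \<alpha> ! (i - 1)"

text \<open>
  Elements of the hyperoctahedral group are functions on all of \<open>int\<close> that are the
  identity outside \<open>{\<plusminus>1, \<dots>, \<plusminus>n}\<close>, so the group operations are \<open>\<circ>\<close>, \<open>id\<close> and \<open>inv\<close>.
\<close>

definition hyperoctahedral :: "nat \<Rightarrow> (int \<Rightarrow> int) set" where
  "hyperoctahedral n =
     {\<omega>. \<omega> permutes ({- int n..int n} - {0}) \<and> (\<forall>i. \<omega> (- i) = - \<omega> i)}"

definition simple_gens :: "nat \<Rightarrow> (int \<Rightarrow> int) set" where
  "simple_gens n = {transpose 1 (- 1)} \<union>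
     {transpose i (i + 1) \<circ> transpose (- i) (- (i + 1)) | i. 1 \<le> i \<and> i \<le> int n - 1}"

definition reflections :: "nat \<Rightarrow> (int \<Rightarrow> int) set" where
  "reflections n =
     {transpose i (- i) | i. 1 \<le> i \<and> i \<le> int n} \<union>
     {transpose i j \<circ> transpose (- i) (- j) | i j. 1 \<le> i \<and> i < j \<and> j \<le> int n} \<union>
     {transpose i (- j) \<circ> transpose (- i) j | i j. 1 \<le> i \<and> i < j \<and> j \<le> int n}"

definition word_length :: "(int \<Rightarrow> int) set \<Rightarrow> (int \<Rightarrow> int) \<Rightarrow> nat" where
  "word_length X \<omega> = (LEAST k. \<exists>xs. length xs = k \<and> set xs \<subseteq> X \<and> foldr (\<circ>) xs id = \<omega>)"

abbreviation length_S :: "nat \<Rightarrow> (int \<Rightarrow> int) \<Rightarrow> nat" where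
  "length_S n \<equiv> word_length (simple_gens n)"

abbreviation length_T :: "nat \<Rightarrow> (int \<Rightarrow> int) \<Rightarrow> nat" where
  "length_T n \<equiv> word_length (reflections n)"

definition abs_less :: "nat \<Rightarrow> (int \<Rightarrow> int) \<Rightarrow> (int \<Rightarrow> int) \<Rightarrow> bool" where
  "abs_less n \<omega> \<omega>' \<longleftrightarrow>
     \<omega> \<noteq> \<omega>' \<and> length_T n \<omega>' = length_T n \<omega> + length_T n (inv \<omega> \<circ> \<omega>')"

abbreviation abs_le :: "nat \<Rightarrow> (int \<Rightarrow> int) \<Rightarrow> (int \<Rightarrow> int) \<Rightarrow> bool" where
  "abs_le n \<omega> \<omega>' \<equiv> abs_less n \<omega> \<omega>' \<or> \<omega> = \<omega>'"

definition NC_B :: "nat \<Rightarrow> (int \<Rightarrow> int) \<Rightarrow> (int \<Rightarrow> int) set" where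
  "NC_B n c = {\<omega> \<in> hyperoctahedral n. abs_le n id \<omega> \<and> abs_le n \<omega> c}"

definition coxeter_elt :: "nat \<Rightarrow> int \<Rightarrow> int" where
  "coxeter_elt n = cycle_of_list ([1..int n] @ map uminus [1..int n])"

text \<open>
  A maximal chain of the finite poset \<open>NC_B n c\<close>, maximal with respect to inclusion,
  is represented by the increasing list of its elements.
\<close>

definition maximal_chains :: "nat \<Rightarrow> (int \<Rightarrow> int) \<Rightarrow> (int \<Rightarrow> int) list set" where
  "maximal_chains n c =
     {ws. sorted_wrt (abs_less n) ws \<and> pred_on.maxchain (NC_B n c) (abs_less n) (set ws)}"

definition bruhat_step :: "nat \<Rightarrow> (int \<Rightarrow> int) \<Rightarrow> (int \<Rightarrow> int) \<Rightarrow> bool" where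
  "bruhat_step n \<omega> \<omega>' \<longleftrightarrow> \<omega> \<in> hyperoctahedral n \<and>
     (\<exists>t \<in> reflections n. \<omega>' = \<omega> \<circ> t \<and> length_S n \<omega> < length_S n (\<omega> \<circ> t))"

definition bruhat_less :: "nat \<Rightarrow> (int \<Rightarrow> int) \<Rightarrow> (int \<Rightarrow> int) \<Rightarrow> bool" where
  "bruhat_less n \<omega> \<omega>' \<longleftrightarrow> (bruhat_step n)\<^sup>*\<^sup>* \<omega> \<omega>' \<and> \<omega> \<noteq> \<omega>'"

definition abs_covers :: "nat \<Rightarrow> (int \<Rightarrow> int) \<Rightarrow> (int \<Rightarrow> int) \<Rightarrow> bool" where
  "abs_covers n \<nu> \<mu> \<longleftrightarrow> abs_less n \<mu> \<nu> \<and>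
     (\<nexists>\<rho>. \<rho> \<in> hyperoctahedral n \<and> abs_less n \<mu> \<rho> \<and> abs_less n \<rho> \<nu>)"

definition edges :: "nat \<Rightarrow> (int \<Rightarrow> int) \<Rightarrow> ((int \<Rightarrow> int) \<times> (int \<Rightarrow> int)) set" where
  "edges n c = {(\<mu>, \<nu>). \<mu> \<in> NC_B n c \<and> \<nu> \<in> NC_B n c \<and> abs_covers n \<nu> \<mu>}"

definition bad_edges :: "nat \<Rightarrow> (int \<Rightarrow> int) \<Rightarrow> ((int \<Rightarrow> int) \<times> (int \<Rightarrow> int)) set" where
  "bad_edges n c = {(\<mu>, \<nu>) \<in> edges n c. bruhat_less n \<nu> \<mu>}"

end

theory Submission
  imports Defs "HOL-Library.Sublist" "HOL-Library.Numeral_Type"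
begin

text \<open>
  It suffices to show that for every set of positions the parking functions whose reluctant cars
  are at these positions are as many as the maximal chains whose bad edges are there; the
  bijection is then glued from arbitrary bijections of the fibres (\<open>fibrewise_bijection\<close>).

  For parking functions the count is a product, because a car that meets \<open>q\<close> occupied spaces is
  reluctant for \<open>q\<close> preferences and lucky for the other \<open>n - q\<close>, whatever happened before
  (\<open>card_reluctance\<close>).

  Maximal chains are the chains of partial products of the factorizations of the Coxeter element
  into \<open>n\<close> reflections, and they are counted downwards from the Coxeter element.  A noncrossing
  element consists of at most one cycle that is its own negative and of pairs of opposite cycles.  A step
  down splits a cycle: it cuts an arc off the self-opposite cycle, or divides an opposite pair.
  By the exchange property, the edge from \<open>\<omega> \<circ> t\<close> up to \<open>\<omega>\<close>, where \<open>t\<close> exchanges \<open>x < y\<close>, is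
  good iff \<open>\<omega> x > \<omega> y\<close>.  Since the cycles respect the cyclic order \<open>1, \<dots>, n, -1, \<dots>, -n\<close>, they
  are unimodal, and differences of entries at a fixed distance along a unimodal cycle have just
  one change of sign of each kind.  Hence among the splittings of a cycle with a given length of
  the arc, in an opposite pair an arc that avoids the maximum, exactly one is good
  (\<open>neg_reflection_bad_iff\<close>, \<open>card_good_pos_reflections\<close>), and the number of chains with a
  prescribed pattern depends on the cycle type only (\<open>card_lower_chains\<close>).

  For a general cycle type this number is not a product.  But let \<open>H k R\<close>, the constant
  \<open>total_split_count\<close>, be its sum over all types
  \<open>(b, m\<^sub>1, \<dots>, m\<^sub>k)\<close> with a self-opposite cycle on \<open>b \<ge> 0\<close> points up to sign and an ordered list of
  \<open>k\<close> opposite pairs, where the pattern \<open>R\<close> of remaining steps fixes the size.  A type with \<open>k + 1\<close>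
  pairs comes from types with \<open>k\<close> pairs by \<open>k + 1\<close> splittings, one for each two consecutive
  entries that can be merged.  This gives \<open>H k (r # R) = (k + 1) * H (k + 1) R\<close> for a good step \<open>r\<close>, and
  with the numbers of bad splittings as weights \<open>H k (r # R) = length R * H (k + 1) R\<close> for a bad one
  (\<open>total_split_count_Cons\<close>).  At \<open>k = 0\<close> this is the product found for parking functions.

  That only splittings can occur, and that the Coxeter element is not a product of fewer than
  \<open>n\<close> reflections, is a matter of ranks.  It is obtained by counting odd functions modulo three.
\<close>

section \<open>Signed permutations and their reflections\<close>

definition signed_points :: "nat \<Rightarrow> int set" where
  "signed_points n = {- int n..int n} - {0}"

text \<open>
  The reflection that exchanges \<open>a\<close> with \<open>b\<close> and \<open>-a\<close> with \<open>-b\<close>, including the case \<open>b = -a\<close>.  The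
  first clause makes it an involution for all arguments.
\<close>
definition signed_swap :: "int \<Rightarrow> int \<Rightarrow> int \<Rightarrow> int" where
  "signed_swap a b x =
     (if a = 0 \<or> b = 0 then x
      else if x = a then b else if x = b then a else if x = - a then - b else if x = - b then - a else x)"

lemma signed_points_uminus [simp]: "- x \<in> signed_points n \<longleftrightarrow> x \<in> signed_points n"
  by (auto simp: signed_points_def)

lemma signed_points_nonzero: "x \<in> signed_points n \<Longrightarrow> x \<noteq> 0"
  by (simp add: signed_points_def)

lemma zero_notin_signed_points [simp]: "0 \<notin> signed_points n"
  by (simp add: signed_points_def)

lemma finite_signed_points [simp]: "finite (signed_points n)"
  by (simp add: signed_points_def)

lemma hyperoctahedral_iff:
  "\<omega> \<in> hyperoctahedral n \<longleftrightarrow> \<omega> permutes signed_points n \<and> (\<forall>i. \<omega> (- i) = - \<omega> i)"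
  by (simp add: hyperoctahedral_def signed_points_def)

lemma hyperoctahedral_odd: "\<omega> \<in> hyperoctahedral n \<Longrightarrow> \<omega> (- i) = - \<omega> i"
  by (simp add: hyperoctahedral_iff)

lemma hyperoctahedral_inj: "\<omega> \<in> hyperoctahedral n \<Longrightarrow> \<omega> x = \<omega> y \<longleftrightarrow> x = y"
  unfolding hyperoctahedral_iff by (metis permutes_inj injD)

lemma hyperoctahedral_in: "\<omega> \<in> hyperoctahedral n \<Longrightarrow> \<omega> x \<in> signed_points n \<longleftrightarrow> x \<in> signed_points n"
  unfolding hyperoctahedral_iff by (metis permutes_in_image)

lemma id_hyperoctahedral [simp]: "id \<in> hyperoctahedral n"
  by (simp add: hyperoctahedral_iff permutes_id)

lemma comp_hyperoctahedral:
  "\<omega> \<in> hyperoctahedral n \<Longrightarrow> \<omega>' \<in> hyperoctahedral n \<Longrightarrow> \<omega> \<circ> \<omega>' \<in> hyperoctahedral n"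
  by (auto simp: hyperoctahedral_iff permutes_compose)

lemma inv_hyperoctahedral:
  assumes "\<omega> \<in> hyperoctahedral n" shows "inv \<omega> \<in> hyperoctahedral n"
proof -
  have p: "\<omega> permutes signed_points n" using assms by (simp add: hyperoctahedral_iff)
  have "inv \<omega> (- i) = - inv \<omega> i" for i
  proof -
    have "\<omega> (- inv \<omega> i) = - i"
      using assms p by (simp add: hyperoctahedral_odd permutes_inverses(1))
    then show ?thesis using p by (metis permutes_inverses(2))
  qed
  then show ?thesis using p by (simp add: hyperoctahedral_iff permutes_inv)
qed

lemma inv_comp_hyperoctahedral:
  assumes "\<omega> \<in> hyperoctahedral n" shows "inv \<omega> \<circ> \<omega> = id" "\<omega> \<circ> inv \<omega> = id"
  using assms permutes_inv_o unfolding hyperoctahedral_iff by blast+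

lemma signed_swap_commute: "signed_swap a b = signed_swap b a"
  by (auto simp: signed_swap_def fun_eq_iff)

lemma signed_swap_uminus: "signed_swap (- a) (- b) = signed_swap a b"
  by (auto simp: signed_swap_def fun_eq_iff)

lemma signed_swap_swap [simp]: "signed_swap a b (signed_swap a b x) = x"
  by (auto simp: signed_swap_def)

lemma signed_swap_comp_swap [simp]: "signed_swap a b \<circ> signed_swap a b = id"
  by (simp add: fun_eq_iff)

lemma comp_swap_comp_swap [simp]: "\<omega> \<circ> signed_swap a b \<circ> signed_swap a b = \<omega>"
  by (simp add: fun_eq_iff)

lemma signed_swap_left [simp]: "a \<noteq> 0 \<Longrightarrow> b \<noteq> 0 \<Longrightarrow> signed_swap a b a = b" by (simp add: signed_swap_def)

lemma signed_swap_right [simp]: "a \<noteq> 0 \<Longrightarrow> b \<noteq> 0 \<Longrightarrow> signed_swap a b b = a" by (simp add: signed_swap_def)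

lemma signed_swap_other: "\<bar>x\<bar> \<noteq> \<bar>a\<bar> \<Longrightarrow> \<bar>x\<bar> \<noteq> \<bar>b\<bar> \<Longrightarrow> signed_swap a b x = x"
  by (auto simp: signed_swap_def)

lemma signed_swap_odd: "signed_swap a b (- x) = - signed_swap a b x"
  by (auto simp: signed_swap_def)

lemma signed_swap_hyperoctahedral:
  assumes "a \<in> signed_points n" "b \<in> signed_points n"
  shows "signed_swap a b \<in> hyperoctahedral n"
proof -
  have "signed_swap a b x = x" if "x \<notin> signed_points n" for x
    using that assms by (auto simp: signed_swap_def)
  moreover have "\<exists>!x. signed_swap a b x = y" for y
    by (rule ex1I[of _ "signed_swap a b y"]) auto
  ultimately have "signed_swap a b permutes signed_points n"
    by (simp add: permutes_def)
  then show ?thesis by (simp add: hyperoctahedral_iff signed_swap_odd)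
qed

lemma signed_swap_conjugate:
  assumes "\<omega> \<in> hyperoctahedral n"
  shows "\<omega> \<circ> signed_swap a b = signed_swap (\<omega> a) (\<omega> b) \<circ> \<omega>"
proof
  fix x
  have "\<omega> 0 = 0" using hyperoctahedral_odd[OF assms, of 0] by simp
  then have "\<omega> a = 0 \<longleftrightarrow> a = 0" "\<omega> b = 0 \<longleftrightarrow> b = 0"
    by (metis assms hyperoctahedral_inj)+
  moreover have "\<omega> x = - \<omega> a \<longleftrightarrow> x = - a" "\<omega> x = - \<omega> b \<longleftrightarrow> x = - b"
    by (metis assms hyperoctahedral_odd hyperoctahedral_inj)+
  ultimately show "(\<omega> \<circ> signed_swap a b) x = (signed_swap (\<omega> a) (\<omega> b) \<circ> \<omega>) x"
    using assms by (auto simp: signed_swap_def hyperoctahedral_odd hyperoctahedral_inj)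
qed

lemma signed_swap_eq_iff:
  assumes "a \<noteq> b" "a \<noteq> 0" "b \<noteq> 0" "a' \<noteq> 0" "b' \<noteq> 0"
  shows "signed_swap a b = signed_swap a' b' \<longleftrightarrow>
    {a', b'} = {a, b} \<or> {a', b'} = {- a, - b}"
proof
  assume eq: "signed_swap a b = signed_swap a' b'"
  have "signed_swap a b a = b" "signed_swap a' b' a' = b'" using assms by simp_all
  with eq have "signed_swap a' b' a = b" "signed_swap a b a' = b'" by simp_all
  then show "{a', b'} = {a, b} \<or> {a', b'} = {- a, - b}"
    using assms by (auto simp: signed_swap_def split: if_splits)
next
  assume "{a', b'} = {a, b} \<or> {a', b'} = {- a, - b}"
  then show "signed_swap a b = signed_swap a' b'"
    by (metis doubleton_eq_iff signed_swap_commute signed_swap_uminus)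
qed

lemma transposes_eq_signed_swap:
  fixes i j :: int
  shows "transpose i (- i) = signed_swap (- i) i"
    and "1 \<le> i \<Longrightarrow> i < j \<Longrightarrow> transpose i j \<circ> transpose (- i) (- j) = signed_swap i j"
    and "1 \<le> i \<Longrightarrow> i < j \<Longrightarrow> transpose i (- j) \<circ> transpose (- i) j = signed_swap (- i) j"
  by (auto simp: signed_swap_def fun_eq_iff transpose_def)

lemma reflections_eq_ordered:
  "reflections n = {signed_swap a b | a b. a \<in> signed_points n \<and> b \<in> signed_points n \<and> a < b}"
proof -
  note 1 = transposes_eq_signed_swap(1) and 2 = transposes_eq_signed_swap(2)
  have 3: "transpose i (- j) \<circ> transpose (- i) j = signed_swap (- j) i" if "1 \<le> i" "i < j" for i j :: int
    using transposes_eq_signed_swap(3)[OF that] by (metis signed_swap_commute signed_swap_uminus minus_minus)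
  show ?thesis (is "_ = ?R")
  proof (intro equalityI subsetI)
    fix t assume "t \<in> reflections n"
    then consider i where "t = signed_swap (- i) i" "1 \<le> i" "i \<le> int n"
      | i j where "t = signed_swap i j" "1 \<le> i" "i < j" "j \<le> int n"
      | i j where "t = signed_swap (- j) i" "1 \<le> i" "i < j" "j \<le> int n"
      unfolding reflections_def using 1 2 3 by auto
    then show "t \<in> ?R"
    proof cases
      case 1 then show ?thesis by (intro CollectI exI[of _ "- i"] exI[of _ i]) (auto simp: signed_points_def)
    next
      case 2 then show ?thesis by (intro CollectI exI[of _ i] exI[of _ j]) (auto simp: signed_points_def)
    next
      case 3 then show ?thesis by (intro CollectI exI[of _ "- j"] exI[of _ i]) (auto simp: signed_points_def)
    qed
  next
    fix t assume "t \<in> ?R"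
    then obtain a b where t: "t = signed_swap a b" and ab: "a \<in> signed_points n" "b \<in> signed_points n" "a < b"
      by blast
    have mem1: "signed_swap (- i) i \<in> reflections n" if "1 \<le> i" "i \<le> int n" for i
      using that 1[of i] unfolding reflections_def by auto
    have mem2: "signed_swap i j \<in> reflections n" if "1 \<le> i" "i < j" "j \<le> int n" for i j
      using that 2[of i j] unfolding reflections_def by auto
    have mem3: "signed_swap (- j) i \<in> reflections n" if "1 \<le> i" "i < j" "j \<le> int n" for i j
      using 3[OF that(1,2)] that unfolding reflections_def by (intro UnI2 CollectI exI[of _ i] exI[of _ j]) simp
    have "signed_swap (- b) (- a) = t" using t by (metis signed_swap_uminus signed_swap_commute)
    consider "0 < a" | "b < 0" | "a < 0" "0 < b" "a = - b" | "a < 0" "0 < b" "b < - a"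
      | "a < 0" "0 < b" "- a < b"
      using ab by (auto simp: signed_points_def) (use linorder_less_linear in fastforce)
    then show "t \<in> reflections n"
    proof cases
      case 1 then show ?thesis using mem2[of a b] ab t by (simp add: signed_points_def)
    next
      case 2 then show ?thesis
        using mem2[of "- b" "- a"] ab \<open>signed_swap (- b) (- a) = t\<close> by (simp add: signed_points_def)
    next
      case 3 then show ?thesis using mem1[of b] ab t by (simp add: signed_points_def)
    next
      case 4 then show ?thesis using mem3[of b "- a"] ab t by (simp add: signed_points_def)
    next
      case 5 then show ?thesis
        using mem3[of "- a" b] ab \<open>signed_swap (- b) (- a) = t\<close> by (simp add: signed_points_def)
    qed
  qed
qed

lemma reflections_eq:
  "reflections n = {signed_swap a b | a b. a \<in> signed_points n \<and> b \<in> signed_points n \<and> a \<noteq> b}"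
  unfolding reflections_eq_ordered by (auto simp: neq_iff) (metis signed_swap_commute)

lemma reflection_hyperoctahedral: "t \<in> reflections n \<Longrightarrow> t \<in> hyperoctahedral n"
  by (auto simp: reflections_eq intro: signed_swap_hyperoctahedral)

lemma reflection_involution: "t \<in> reflections n \<Longrightarrow> t \<circ> t = id"
  by (auto simp: reflections_eq)

lemma id_notin_reflections: "id \<notin> reflections n"
  by (auto simp: reflections_eq fun_eq_iff) (metis signed_swap_left signed_points_nonzero)

lemma finite_reflections [simp]: "finite (reflections n)"
proof -
  have "reflections n \<subseteq> (\<lambda>(a, b). signed_swap a b) ` (signed_points n \<times> signed_points n)"
    by (auto simp: reflections_eq)
  then show ?thesis by (rule finite_subset) simp
qed

lemma simple_gens_eq:
  "1 \<le> n \<Longrightarrow> simple_gens n = {signed_swap (- 1) 1} \<union> {signed_swap i (i + 1) | i. 1 \<le> i \<and> i \<le> int n - 1}"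
proof -
  have "transpose 1 (- 1) = signed_swap (- 1) 1"
    by (auto simp: signed_swap_def fun_eq_iff transpose_def)
  moreover have "transpose i (i + 1) \<circ> transpose (- i) (- (i + 1)) = signed_swap i (i + 1)" if "1 \<le> i" for i :: int
    using that by (auto simp: signed_swap_def fun_eq_iff transpose_def)
  ultimately show ?thesis unfolding simple_gens_def by (auto; metis)
qed

lemma simple_gens_reflections: "1 \<le> n \<Longrightarrow> simple_gens n \<subseteq> reflections n"
proof
  fix s assume "1 \<le> n" "s \<in> simple_gens n"
  then consider "s = signed_swap (- 1) 1" | i where "s = signed_swap i (i + 1)" "1 \<le> i" "i \<le> int n - 1"
    by (auto simp: simple_gens_eq)
  then show "s \<in> reflections n"
  proof cases
    case 1
    then show ?thesis unfolding reflections_eq_ordered using \<open>1 \<le> n\<close>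
      by (intro CollectI exI[of _ "- 1"] exI[of _ 1]) (auto simp: signed_points_def)
  next
    case 2
    then show ?thesis unfolding reflections_eq_ordered
      by (intro CollectI exI[of _ i] exI[of _ "i + 1"]) (auto simp: signed_points_def)
  qed
qed

section \<open>Word length\<close>

definition word_product :: "(int \<Rightarrow> int) list \<Rightarrow> int \<Rightarrow> int" where
  "word_product ts = foldr (\<circ>) ts id"

lemma word_product_Nil [simp]: "word_product [] = id"
  by (simp add: word_product_def)

lemma word_product_Cons [simp]: "word_product (t # ts) = t \<circ> word_product ts"
  by (simp add: word_product_def)

lemma word_product_append [simp]: "word_product (xs @ ys) = word_product xs \<circ> word_product ys"
  by (induction xs) (auto simp: o_assoc)

lemma word_length_le: "set xs \<subseteq> X \<Longrightarrow> word_length X (word_product xs) \<le> length xs"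
  unfolding word_length_def word_product_def by (rule Least_le) blast

lemma word_length_attained:
  assumes "set xs \<subseteq> X" "word_product xs = \<omega>"
  shows "\<exists>ys. length ys = word_length X \<omega> \<and> set ys \<subseteq> X \<and> word_product ys = \<omega>"
  unfolding word_length_def word_product_def[symmetric]
  by (rule LeastI[of _ "length xs"]) (use assms in blast)

lemma word_product_hyperoctahedral:
  "set ts \<subseteq> reflections n \<Longrightarrow> word_product ts \<in> hyperoctahedral n"
proof (induction ts)
  case (Cons t ts)
  then have "t \<circ> word_product ts \<in> hyperoctahedral n"
    by (intro comp_hyperoctahedral) (simp_all add: reflection_hyperoctahedral)
  then show ?case by (simp only: word_product_Cons)
qed simp

text \<open>
  Multiplying by the reflection that exchanges a moved point with its image fixes one more pair
  of points.
\<close>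

lemma reflections_generate:
  assumes "\<omega> \<in> hyperoctahedral n"
  shows "\<exists>ts. set ts \<subseteq> reflections n \<and> length ts \<le> n \<and> word_product ts = \<omega>"
proof -
  define M where "M \<omega> = {i \<in> {1..int n}. \<omega> i \<noteq> i}" for \<omega> :: "int \<Rightarrow> int"
  have "\<exists>ts. set ts \<subseteq> reflections n \<and> length ts \<le> card (M \<omega>) \<and> word_product ts = \<omega>"
    using assms
  proof (induction "card (M \<omega>)" arbitrary: \<omega> rule: less_induct)
    case less
    show ?case
    proof (cases "M \<omega> = {}")
      case True
      have "\<omega> x = x" for x
      proof (cases "x \<in> signed_points n")
        case inside: True
        then have "\<omega> \<bar>x\<bar> = \<bar>x\<bar>"
          using True by (auto simp: M_def signed_points_def)
        then show ?thesis using hyperoctahedral_odd[OF less.prems, of x] by (auto simp: abs_if split: if_splits)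
      next
        case False
        then show ?thesis using less.prems by (auto simp: hyperoctahedral_iff permutes_def)
      qed
      then show ?thesis by (intro exI[of _ "[]"]) auto
    next
      case False
      then obtain x where x: "x \<in> {1..int n}" "\<omega> x \<noteq> x" by (auto simp: M_def)
      have xs: "x \<in> signed_points n" "\<omega> x \<in> signed_points n"
        using x hyperoctahedral_in[OF less.prems, of x] by (auto simp: signed_points_def)
      define t where "t = signed_swap x (\<omega> x)"
      have t: "t \<in> reflections n" using xs x by (auto simp: t_def reflections_eq; metis)
      have h: "t \<circ> \<omega> \<in> hyperoctahedral n"
        using t less.prems by (simp add: comp_hyperoctahedral reflection_hyperoctahedral)
      have "M (t \<circ> \<omega>) \<subseteq> M \<omega> - {x}"
      proof
        fix y assume y: "y \<in> M (t \<circ> \<omega>)"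
        have "y \<noteq> x" using y xs by (auto simp: M_def t_def dest: signed_points_nonzero)
        moreover have "\<omega> y \<noteq> y"
        proof
          assume fy: "\<omega> y = y"
          have "y \<noteq> \<omega> x" "y \<noteq> - \<omega> x" "y \<noteq> - x"
            using fy x hyperoctahedral_inj[OF less.prems] hyperoctahedral_odd[OF less.prems]
            by (metis minus_equation_iff)+
          then have "t y = y" using \<open>y \<noteq> x\<close> by (auto simp: t_def signed_swap_def)
          then show False using y fy by (simp add: M_def)
        qed
        ultimately show "y \<in> M \<omega> - {x}" using y by (auto simp: M_def)
      qed
      moreover have "x \<in> M \<omega>" using x by (auto simp: M_def)
      moreover have "finite (M \<omega>)"
        unfolding M_def by (rule finite_subset[of _ "{1..int n}"]) auto
      ultimately have lt: "card (M (t \<circ> \<omega>)) < card (M \<omega>)"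
        using psubset_card_mono[of "M \<omega>" "M (t \<circ> \<omega>)"] by blast
      from less.hyps[OF lt h] obtain ts where ts: "set ts \<subseteq> reflections n"
        "length ts \<le> card (M (t \<circ> \<omega>))" "word_product ts = t \<circ> \<omega>" by blast
      have "word_product (t # ts) = \<omega>"
        using ts(3) reflection_involution[OF t] by (simp add: o_assoc)
      then show ?thesis using ts t lt by (intro exI[of _ "t # ts"]) auto
    qed
  qed
  moreover have "card (M \<omega>) \<le> n"
    using card_mono[of "{1..int n}" "M \<omega>"] unfolding M_def by fastforce
  ultimately show ?thesis by (metis le_trans)
qed

definition generated :: "(int \<Rightarrow> int) set \<Rightarrow> (int \<Rightarrow> int) set" where
  "generated X = {word_product xs | xs. set xs \<subseteq> X}"

lemma generated_comp: "f \<in> generated X \<Longrightarrow> g \<in> generated X \<Longrightarrow> f \<circ> g \<in> generated X"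
  unfolding generated_def using word_product_append
  by (smt (verit) mem_Collect_eq set_append Un_least)

lemma generated_base: "f \<in> X \<Longrightarrow> f \<in> generated X"
  unfolding generated_def by (auto intro!: exI[of _ "[f]"])

text \<open>
  Conjugation by simple generators moves the points of a reflection until they are neighbours.
\<close>
lemma simple_gens_generate_reflections:
  assumes "1 \<le> n" shows "reflections n \<subseteq> generated (simple_gens n)"
proof -
  let ?G = "generated (simple_gens n)"
  have step: "signed_swap i (i + 1) \<in> ?G" if "1 \<le> i" "i \<le> int n - 1" for i
    using assms that by (intro generated_base) (auto simp: simple_gens_eq)
  have conj: "signed_swap (\<sigma> a) (\<sigma> b) \<in> ?G" if "\<sigma> = signed_swap i j" "i \<in> signed_points n" "j \<in> signed_points n"
    "\<sigma> \<in> ?G" "signed_swap a b \<in> ?G" for \<sigma> i j a b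
  proof -
    have "\<sigma> \<circ> signed_swap a b = signed_swap (\<sigma> a) (\<sigma> b) \<circ> \<sigma>"
      using that by (intro signed_swap_conjugate[of _ n] ) (simp add: signed_swap_hyperoctahedral)
    then have "\<sigma> \<circ> signed_swap a b \<circ> \<sigma> = signed_swap (\<sigma> a) (\<sigma> b)" using that by (simp add: fun_eq_iff)
    then show ?thesis using that by (metis generated_comp)
  qed
  have pos: "signed_swap x (x + 1 + int k) \<in> ?G" if "1 \<le> x" "x + 1 + int k \<le> int n" for x k
    using that
  proof (induction k)
    case 0 then show ?case using step[of x] by simp
  next
    case (Suc k)
    let ?y = "x + 1 + int k"
    have "signed_swap x ?y \<in> ?G" "signed_swap ?y (?y + 1) \<in> ?G"
      using Suc step[of ?y] by auto
    moreover have "?y \<in> signed_points n" "?y + 1 \<in> signed_points n"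
      using Suc.prems by (auto simp: signed_points_def)
    ultimately have "signed_swap (signed_swap ?y (?y + 1) x) (signed_swap ?y (?y + 1) ?y) \<in> ?G"
      using conj[OF refl] by blast
    moreover have "signed_swap ?y (?y + 1) x = x" using Suc.prems by (auto simp: signed_swap_def)
    moreover have "?y + 1 = x + 1 + int (Suc k)" by simp
    moreover have "?y \<noteq> 0" "?y + 1 \<noteq> 0" using Suc.prems by linarith+
    ultimately show ?case by (metis signed_swap_left)
  qed
  have sgn: "signed_swap (- 1 - int k) (1 + int k) \<in> ?G" if "1 + int k \<le> int n" for k
    using that
  proof (induction k)
    case 0 then show ?case using assms by (intro generated_base) (auto simp: simple_gens_eq)
  next
    case (Suc k)
    let ?y = "1 + int k"
    have "- 1 - int k = - ?y" by simp
    then have "signed_swap (- ?y) ?y \<in> ?G" "signed_swap ?y (?y + 1) \<in> ?G"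
      using Suc step[of ?y] by auto
    moreover have "?y \<in> signed_points n" "?y + 1 \<in> signed_points n"
      using Suc.prems by (auto simp: signed_points_def)
    ultimately have "signed_swap (signed_swap ?y (?y + 1) (- ?y)) (signed_swap ?y (?y + 1) ?y) \<in> ?G"
      using conj[OF refl] by blast
    moreover have "?y + 1 = 1 + int (Suc k)" "- (?y + 1) = - 1 - int (Suc k)" by simp_all
    moreover have "?y \<noteq> 0" "?y + 1 \<noteq> 0" by linarith+
    ultimately show ?case by (metis signed_swap_left signed_swap_odd)
  qed
  have pos': "signed_swap i j \<in> ?G" if "1 \<le> i" "i < j" "j \<le> int n" for i j
    using pos[of i "nat (j - i - 1)"] that by simp
  have sgn': "signed_swap (- i) i \<in> ?G" if "1 \<le> i" "i \<le> int n" for i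
    using sgn[of "nat (i - 1)"] that by simp
  have mixed: "signed_swap (- i) j \<in> ?G" if "1 \<le> i" "i < j" "j \<le> int n" for i j
  proof -
    have "- i \<in> signed_points n" "i \<in> signed_points n" using that by (auto simp: signed_points_def)
    moreover have "signed_swap i j \<in> ?G" "signed_swap (- i) i \<in> ?G"
      using that pos'[of i j] sgn'[of i] by auto
    ultimately have "signed_swap (signed_swap (- i) i i) (signed_swap (- i) i j) \<in> ?G"
      using conj[OF refl] by blast
    moreover have "signed_swap (- i) i j = j" using that by (auto simp: signed_swap_def)
    moreover have "signed_swap (- i) i i = - i" using that by simp
    ultimately show ?thesis by metis
  qed
  show ?thesis
  proof
    fix t assume "t \<in> reflections n"
    then consider i where "t = signed_swap (- i) i" "1 \<le> i" "i \<le> int n"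
      | i j where "t = signed_swap i j" "1 \<le> i" "i < j" "j \<le> int n"
      | i j where "t = signed_swap (- i) j" "1 \<le> i" "i < j" "j \<le> int n"
      using \<open>t \<in> reflections n\<close> transposes_eq_signed_swap unfolding reflections_def by auto
    then show "t \<in> ?G" using pos' sgn' mixed by cases auto
  qed
qed

lemma simple_gens_generate:
  assumes "1 \<le> n" "\<omega> \<in> hyperoctahedral n"
  shows "\<omega> \<in> generated (simple_gens n)"
proof -
  have "word_product ts \<in> generated (simple_gens n)" if "set ts \<subseteq> reflections n" for ts
    using that
  proof (induction ts)
    case Nil
    then show ?case unfolding generated_def by (auto intro!: exI[of _ "[]"])
  next
    case (Cons t ts)
    then have "t \<circ> word_product ts \<in> generated (simple_gens n)"
      using simple_gens_generate_reflections[OF assms(1)] by (intro generated_comp) auto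
    then show ?case by (simp only: word_product_Cons)
  qed
  then show ?thesis using reflections_generate[OF assms(2)] by metis
qed

section \<open>Reflections and the Bruhat order\<close>

text \<open>
  The integers that a simple generator exchanges are neighbours among the nonzero integers, so
  no other pair of points changes its relative order.
\<close>

lemma simple_gen_reverses_unique:
  assumes "1 \<le> n" "s \<in> simple_gens n" "x \<noteq> 0" "y \<noteq> 0" "x < y" "s y < s x"
  shows "s = signed_swap x y"
proof -
  consider "s = signed_swap (- 1) 1" | i where "s = signed_swap i (i + 1)" "1 \<le> i"
    using assms by (auto simp: simple_gens_eq)
  then show ?thesis
  proof cases
    case 1
    then have "x = - 1 \<and> y = 1" using assms by (auto simp: signed_swap_def split: if_splits)
    then show ?thesis using 1 by simp
  next
    case 2
    have "i \<noteq> 0" "i + 1 \<noteq> 0" using 2 by auto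
    moreover have "signed_swap i (i + 1) y < signed_swap i (i + 1) x" using assms(6) 2(1) by simp
    ultimately have "(x = i \<and> y = i + 1) \<or> (x = - (i + 1) \<and> y = - i)"
      using assms(5) 2(2) unfolding signed_swap_def by (simp only: if_False simp_thms) (smt (verit))
    then show ?thesis using 2(1) by (metis signed_swap_commute signed_swap_uminus)
  qed
qed

text \<open>
  The exchange property: while the letters of the word act on \<open>x < y\<close> one after the other, one of
  them is the first to reverse the order.  That letter is the conjugate of the reflection in \<open>x\<close>
  and \<open>y\<close>, so multiplying by this reflection deletes it.
\<close>

lemma exchange:
  assumes "1 \<le> n" "set ss \<subseteq> simple_gens n" "x \<in> signed_points n" "y \<in> signed_points n" "x < y"
    and "word_product ss y < word_product ss x"
  shows "\<exists>ss'. set ss' \<subseteq> simple_gens n \<and> length ss' < length ss \<and>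
           word_product ss' = word_product ss \<circ> signed_swap x y"
  using assms(2,6)
proof (induction ss)
  case Nil
  then show ?case using assms(5) by simp
next
  case (Cons s ss)
  let ?u = "word_product ss"
  have u: "?u \<in> hyperoctahedral n"
    using Cons.prems simple_gens_reflections[OF assms(1)] word_product_hyperoctahedral
    by (meson list.set_intros(2) subset_iff)
  show ?case
  proof (cases "?u y < ?u x")
    case True
    then obtain ss' where "set ss' \<subseteq> simple_gens n" "length ss' < length ss"
      "word_product ss' = ?u \<circ> signed_swap x y"
      using Cons.IH Cons.prems(1) by (metis list.set_intros(2) subset_iff)
    then show ?thesis using Cons.prems(1)
      by (intro exI[of _ "s # ss'"]) (simp add: o_assoc[symmetric])
  next
    case False
    then have lt: "?u x < ?u y" using hyperoctahedral_inj[OF u, of x y] assms(5) by force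
    have "?u x \<noteq> 0" "?u y \<noteq> 0"
      using hyperoctahedral_in[OF u] assms(3,4) by (metis zero_notin_signed_points)+
    then have "s = signed_swap (?u x) (?u y)"
      using simple_gen_reverses_unique[OF assms(1) _ _ _ lt] Cons.prems by simp
    then have "s \<circ> ?u \<circ> signed_swap x y = ?u"
      using signed_swap_conjugate[OF u, of x y] by (simp add: fun_eq_iff)
    then have "word_product ss = word_product (s # ss) \<circ> signed_swap x y"
      by (simp only: word_product_Cons)
    moreover have "set ss \<subseteq> simple_gens n" "length ss < length (s # ss)"
      using Cons.prems(1) by auto
    ultimately show ?thesis by blast
  qed
qed

lemma length_S_swap_less:
  assumes "1 \<le> n" "\<omega> \<in> hyperoctahedral n" "x \<in> signed_points n" "y \<in> signed_points n"
    and "x < y" "\<omega> y < \<omega> x"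
  shows "length_S n (\<omega> \<circ> signed_swap x y) < length_S n \<omega>"
proof -
  obtain ss where "set ss \<subseteq> simple_gens n" "word_product ss = \<omega>"
    using simple_gens_generate[OF assms(1,2)] unfolding generated_def by auto
  then obtain ss where ss: "length ss = length_S n \<omega>" "set ss \<subseteq> simple_gens n" "word_product ss = \<omega>"
    using word_length_attained by blast
  then obtain ss' where "set ss' \<subseteq> simple_gens n" "length ss' < length ss"
    "word_product ss' = \<omega> \<circ> signed_swap x y" using exchange[of n ss x y] assms by auto
  then show ?thesis using word_length_le[of ss' "simple_gens n"] ss by simp
qed

lemma length_S_swap_iff:
  assumes "1 \<le> n" "\<omega> \<in> hyperoctahedral n" "x \<in> signed_points n" "y \<in> signed_points n" "x < y"
  shows "length_S n \<omega> < length_S n (\<omega> \<circ> signed_swap x y) \<longleftrightarrow> \<omega> x < \<omega> y"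
proof -
  have "\<omega> \<circ> signed_swap x y \<in> hyperoctahedral n"
    using assms by (simp add: comp_hyperoctahedral signed_swap_hyperoctahedral)
  from length_S_swap_less[OF assms(1) this assms(3-5)]
  have "\<omega> x < \<omega> y \<Longrightarrow> length_S n \<omega> < length_S n (\<omega> \<circ> signed_swap x y)"
    using assms(3,4) by (simp add: signed_points_nonzero)
  moreover have "\<omega> x \<noteq> \<omega> y" using hyperoctahedral_inj[OF assms(2), of x y] assms(5) by simp
  ultimately show ?thesis using length_S_swap_less[OF assms] by force
qed

lemma bruhat_less_length:
  assumes "bruhat_less n \<omega> \<omega>'" shows "length_S n \<omega> < length_S n \<omega>'"
proof -
  have "length_S n \<omega> < length_S n \<omega>' \<or> \<omega> = \<omega>'" if "(bruhat_step n)\<^sup>*\<^sup>* \<omega> \<omega>'"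
    using that by (induction) (auto simp: bruhat_step_def)
  then show ?thesis using assms by (auto simp: bruhat_less_def)
qed

lemma bruhat_less_swap_iff:
  assumes "1 \<le> n" "\<omega> \<in> hyperoctahedral n" "x \<in> signed_points n" "y \<in> signed_points n" "x < y"
  shows "bruhat_less n \<omega> (\<omega> \<circ> signed_swap x y) \<longleftrightarrow> \<omega> x < \<omega> y"
proof
  assume "bruhat_less n \<omega> (\<omega> \<circ> signed_swap x y)"
  then show "\<omega> x < \<omega> y" using bruhat_less_length length_S_swap_iff[OF assms] by blast
next
  assume "\<omega> x < \<omega> y"
  then have *: "length_S n \<omega> < length_S n (\<omega> \<circ> signed_swap x y)" using length_S_swap_iff[OF assms] by blast
  have "signed_swap x y \<in> reflections n" using assms by (auto simp: reflections_eq_ordered)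
  then have "bruhat_step n \<omega> (\<omega> \<circ> signed_swap x y)" using * assms unfolding bruhat_step_def by blast
  moreover have "\<omega> \<noteq> \<omega> \<circ> signed_swap x y" using * by auto
  ultimately show "bruhat_less n \<omega> (\<omega> \<circ> signed_swap x y)" unfolding bruhat_less_def by auto
qed

section \<open>Counting fixed functions modulo three\<close>

text \<open>
  Odd functions modulo three stand in for linear functionals: as two is invertible, they vanish
  on a cycle that is its own negative when they are constant along it, and as there are finitely
  many of them, dimensions can be read off from cardinalities.
\<close>
definition odd_functions :: "nat \<Rightarrow> (int \<Rightarrow> 3) set" where
  "odd_functions n = {g. (\<forall>i. g (- i) = - g i) \<and> (\<forall>i. i \<notin> signed_points n \<longrightarrow> g i = 0)}"

definition fixed_functions :: "nat \<Rightarrow> (int \<Rightarrow> int) set \<Rightarrow> (int \<Rightarrow> 3) set" where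
  "fixed_functions n X = {g \<in> odd_functions n. \<forall>f\<in>X. \<forall>i. g (f i) = g i}"

lemma double_eq_0_mod_3: "x + x = (0::3) \<Longrightarrow> x = 0"
proof -
  assume "x + x = 0"
  moreover have "x + x + (x + x) = x * (1 + 1 + (1 + 1))"
    by (simp only: distrib_left mult_1_right)
  moreover have "(1 + 1 + (1 + 1) :: 3) = 1" by simp
  ultimately show "x = 0" by (metis add_0_left mult_1_right)
qed

lemma finite_odd_functions: "finite (odd_functions n)"
proof -
  have "odd_functions n \<subseteq>
    {g. \<forall>i. (i \<in> signed_points n \<longrightarrow> g i \<in> UNIV) \<and> (i \<notin> signed_points n \<longrightarrow> g i = 0)}"
    by (auto simp: odd_functions_def)
  then show ?thesis
    by (rule finite_subset) (intro finite_set_of_finite_funs, auto)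
qed

lemma finite_fixed_functions: "finite (fixed_functions n X)"
  unfolding fixed_functions_def using finite_odd_functions by simp

lemma card_odd_functions: "3 ^ n \<le> card (odd_functions n)"
proof -
  define ext where "ext h i =
    (if i \<in> {1..int n} then h i else if - i \<in> {1..int n} then - h (- i) else (0::3))" for h i
  let ?P = "PiE {1..int n} (\<lambda>_. UNIV :: 3 set)"
  have "inj_on ext ?P"
  proof (rule inj_onI)
    fix h h' assume h: "h \<in> ?P" "h' \<in> ?P" "ext h = ext h'"
    show "h = h'"
    proof (rule PiE_ext[OF h(1,2)])
      fix i assume "i \<in> {1..int n}"
      then show "h i = h' i" using fun_cong[OF h(3), of i] by (simp add: ext_def)
    qed
  qed
  moreover have "ext ` ?P \<subseteq> odd_functions n"
    by (auto simp: ext_def odd_functions_def signed_points_def)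
  ultimately have "card ?P \<le> card (odd_functions n)"
    by (rule card_inj_on_le) (rule finite_odd_functions)
  then show ?thesis by (simp add: card_PiE)
qed

text \<open>
  The fibres of \<open>g \<mapsto> g a - g b\<close> are empty or translates of the kernel, and there are at most
  three of them.
\<close>

lemma card_le_three_times_kernel:
  fixes V :: "(int \<Rightarrow> 3) set"
  assumes "finite V" "\<And>g h. g \<in> V \<Longrightarrow> h \<in> V \<Longrightarrow> (\<lambda>i. g i - h i) \<in> V"
  shows "card V \<le> 3 * card {g \<in> V. g a = g b}"
proof -
  let ?K = "{g \<in> V. g a = g b}"
  have fib: "card {g \<in> V. g a - g b = v} \<le> card ?K" for v
  proof (cases "{g \<in> V. g a - g b = v} = {}")
    case False
    then obtain h where h: "h \<in> V" "h a - h b = v" by auto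
    have inj: "inj_on (\<lambda>g i. g i - h i) {g \<in> V. g a - g b = v}"
      by (rule inj_onI) (simp add: fun_eq_iff)
    have "(\<lambda>g i. g i - h i) ` {g \<in> V. g a - g b = v} \<subseteq> ?K"
      using h assms(2) by (auto simp: algebra_simps)
    then show ?thesis by (rule card_inj_on_le[OF inj]) (use assms(1) in simp)
  qed (simp only: card.empty)
  have "V = (\<Union>v\<in>UNIV. {g \<in> V. g a - g b = v})" by auto
  then have "card V \<le> (\<Sum>v\<in>(UNIV :: 3 set). card {g \<in> V. g a - g b = v})"
    using card_UN_le[of "UNIV :: 3 set" "\<lambda>v. {g \<in> V. g a - g b = v}"] by simp
  also have "\<dots> \<le> (\<Sum>v\<in>(UNIV :: 3 set). card ?K)" by (rule sum_mono) (rule fib)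
  finally show ?thesis by simp
qed

lemma fixed_functions_swap:
  assumes "g \<in> odd_functions n"
  shows "(\<forall>i. g (signed_swap a b i) = g i) \<longleftrightarrow> g a = g b \<or> a = 0 \<or> b = 0"
  using assms by (auto simp: signed_swap_def odd_functions_def)

text \<open>Each reflection imposes one linear condition.\<close>
lemma card_fixed_functions_ge:
  assumes "set ts \<subseteq> reflections n"
  shows "3 ^ n \<le> card (fixed_functions n (set ts)) * 3 ^ length ts"
  using assms
proof (induction ts)
  case Nil
  then show ?case using card_odd_functions by (simp add: fixed_functions_def)
next
  case (Cons t ts)
  obtain a b where t: "t = signed_swap a b" "a \<in> signed_points n" "b \<in> signed_points n"
    using Cons.prems by (auto simp: reflections_eq)
  then have nz: "a \<noteq> 0" "b \<noteq> 0" by (auto dest: signed_points_nonzero)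
  let ?V = "fixed_functions n (set ts)"
  have "fixed_functions n (set (t # ts)) = {g \<in> ?V. g a = g b}"
  proof -
    have "(\<forall>i. g (t i) = g i) \<longleftrightarrow> g a = g b" if "g \<in> odd_functions n" for g
      using fixed_functions_swap[OF that] nz t(1) by simp
    then show ?thesis unfolding fixed_functions_def by auto
  qed
  moreover have "card ?V \<le> 3 * card {g \<in> ?V. g a = g b}"
    by (rule card_le_three_times_kernel)
      (auto simp: finite_fixed_functions, auto simp: fixed_functions_def odd_functions_def)
  ultimately have "card ?V * 3 ^ length ts \<le> card (fixed_functions n (set (t # ts))) * 3 ^ length (t # ts)"
    by simp
  moreover have "3 ^ n \<le> card ?V * 3 ^ length ts" using Cons by simp
  ultimately show ?case by (rule le_trans[rotated])
qed

lemma fixed_functions_word_product: "fixed_functions n (set ts) \<subseteq> fixed_functions n {word_product ts}"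
proof (induction ts)
  case Nil
  then show ?case by (simp add: fixed_functions_def)
next
  case (Cons t ts)
  show ?case
  proof
    fix g assume g: "g \<in> fixed_functions n (set (t # ts))"
    then have "g \<in> fixed_functions n {word_product ts}"
      using Cons by (auto simp: fixed_functions_def)
    moreover have "g (t i) = g i" for i using g by (simp add: fixed_functions_def)
    ultimately show "g \<in> fixed_functions n {word_product (t # ts)}"
      by (simp add: fixed_functions_def)
  qed
qed

section \<open>Cycle structure of noncrossing signed permutations\<close>

text \<open>
  A cycle is given by the list of its points in the order in which the permutation runs through
  them.  For a cycle that contains the negatives of its points, the first half is listed.
\<close>
definition path :: "(int \<Rightarrow> int) \<Rightarrow> int list \<Rightarrow> bool" where
  "path f w = successively (\<lambda>x y. f x = y) w"

lemma path_simps [simp]: "path f []" "path f [x]"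
  by (simp_all add: path_def)

lemma path_Cons: "path f (x # w) \<longleftrightarrow> w = [] \<or> f x = hd w \<and> path f w"
  by (auto simp: path_def successively_Cons)

lemma path_append: "path f (v @ w) \<longleftrightarrow> path f v \<and> path f w \<and> (v = [] \<or> w = [] \<or> f (last v) = hd w)"
  by (auto simp: path_def successively_append_iff)

lemma path_cong: "(\<And>x. x \<in> set w \<Longrightarrow> f x = g x) \<Longrightarrow> path f w = path g w"
  by (induction w) (auto simp: path_Cons)

lemma path_uminus:
  assumes "\<And>x. f (- x) = - f x" shows "path f (map uminus w) = path f w"
  by (induction w) (auto simp: path_Cons assms hd_map)

lemma path_const: "path f w \<Longrightarrow> (\<And>i. g (f i) = g i) \<Longrightarrow> x \<in> set w \<Longrightarrow> g x = g (hd w)"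
proof (induction w)
  case (Cons y w)
  then show ?case by (auto simp: path_Cons) (metis)
qed simp

definition is_cycle :: "(int \<Rightarrow> int) \<Rightarrow> int list \<Rightarrow> bool" where
  "is_cycle f w \<longleftrightarrow> w \<noteq> [] \<and> path f w \<and> f (last w) = hd w"

definition is_neg_cycle :: "(int \<Rightarrow> int) \<Rightarrow> int list \<Rightarrow> bool" where
  "is_neg_cycle f w \<longleftrightarrow> w = [] \<or> path f w \<and> f (last w) = - hd w"

lemma is_cycle_cong: "(\<And>x. x \<in> set w \<Longrightarrow> f x = g x) \<Longrightarrow> is_cycle f w = is_cycle g w"
  unfolding is_cycle_def using path_cong[of w f g] by auto

lemma is_neg_cycle_cong: "(\<And>x. x \<in> set w \<Longrightarrow> f x = g x) \<Longrightarrow> is_neg_cycle f w = is_neg_cycle g w"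
  unfolding is_neg_cycle_def using path_cong[of w f g] by auto

lemma is_cycle_rotate: "is_cycle f (v @ w) \<Longrightarrow> is_cycle f (w @ v)"
  by (cases "v = []"; cases "w = []") (auto simp: is_cycle_def path_append)

lemma is_cycle_closed:
  assumes "is_cycle f w" "x \<in> set w" shows "f x \<in> set w"
proof -
  obtain u v where w: "w = u @ x # v" using assms(2) by (auto simp: in_set_conv_decomp)
  show ?thesis
  proof (cases "v = []")
    case True
    then have "f x = hd w" using assms(1) w by (simp add: is_cycle_def)
    then show ?thesis using w by (metis hd_in_set append_is_Nil_conv list.distinct(1))
  next
    case False
    then have "f x = hd v" using assms(1) w by (auto simp: is_cycle_def path_append path_Cons)
    then show ?thesis using w False by auto
  qed
qed

text \<open>
  The cycles of a noncrossing element run through their points in the cyclic order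
  \<open>1, \<dots>, n, -1, \<dots>, -n\<close>.  A cycle that is disjoint from its negative, read from its maximum on,
  therefore first descends through negative points and then ascends through positive ones.
\<close>

definition valley :: "int list \<Rightarrow> bool" where
  "valley u \<longleftrightarrow> (\<forall>x y z. subseq [x, y, z] u \<longrightarrow> y < x \<or> y < z)"

definition peak_first :: "int list \<Rightarrow> bool" where
  "peak_first w \<longleftrightarrow> w \<noteq> [] \<and> (\<forall>y\<in>set (tl w). y < hd w) \<and> valley (tl w)"

lemma valley_subseq: "valley u \<Longrightarrow> subseq v u \<Longrightarrow> valley v"
  unfolding valley_def by (meson subseq_order.trans)

lemma sorted_wrt_subseq_pair: "sorted_wrt R u \<Longrightarrow> subseq [x, y] u \<Longrightarrow> R x y"
proof (induction u)
  case (Cons a u)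
  then show ?case
    by (cases "x = a") (auto simp: subseq_singleton_left)
qed simp

lemma valley_append:
  assumes "sorted_wrt (>) u" "sorted_wrt (<) v"
  shows "valley (u @ v)"
  unfolding valley_def
proof (intro allI impI)
  fix x y z assume "subseq [x, y, z] (u @ v)"
  then obtain p q where pq: "[x, y, z] = p @ q" "subseq p u" "subseq q v"
    by (auto simp: subseq_append_iff)
  have "subseq [x, y] u \<or> subseq [y, z] v"
  proof (cases p)
    case Nil
    then have "subseq [x, y, z] v" using pq by simp
    then show ?thesis by (metis subseq_Cons')
  next
    case (Cons a p')
    then show ?thesis
    proof (cases p')
      case Nil
      then show ?thesis using pq Cons by auto
    next
      case (Cons b p'')
      then have "subseq [x, y] p" using pq \<open>p = a # p'\<close> by auto
      then show ?thesis using pq(2) by (meson subseq_order.trans)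
    qed
  qed
  then show "y < x \<or> y < z" using sorted_wrt_subseq_pair assms by metis
qed

lemma valley_sorted: "sorted_wrt (<) v \<Longrightarrow> valley v" "sorted_wrt (>) v \<Longrightarrow> valley v"
  using valley_append[of "[]" v] valley_append[of v "[]"] by auto

text \<open>
  An arc of a valley has its maximum at one of its two ends, so a cycle made of this arc starts at
  its maximum after moving at most one point.
\<close>

definition peak_rotation :: "int list \<Rightarrow> int \<Rightarrow> int list" where
  "peak_rotation q b = (if \<forall>x\<in>set q. x < b then b # q else q @ [b])"

lemma peak_first_peak_rotation:
  assumes "valley (q @ [b])" "distinct (q @ [b])"
  shows "peak_first (peak_rotation q b)"
proof (cases "\<forall>x\<in>set q. x < b")
  case True
  then show ?thesis using valley_subseq[OF assms(1), of q]
    by (simp add: peak_rotation_def peak_first_def subseq_rev_drop_many)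
next
  case False
  then obtain x where x: "x \<in> set q" "b < x"
    using assms(2) by (auto simp: not_less order.order_iff_strict)
  then obtain p q' where q: "q = p # q'" by (cases q) auto
  have mid: "y < p \<or> y < b" if "y \<in> set q'" for y
  proof -
    have "subseq [p, y, b] (q @ [b])"
      using that q by (auto intro!: list_emb_append_mono[of _ "[y]" _ "[b]", simplified] simp: subseq_singleton_left)
    then show ?thesis using assms(1) by (auto simp: valley_def)
  qed
  have "b < p" using x q mid[of x] by auto
  then have "\<forall>y\<in>set (q' @ [b]). y < p" using mid by fastforce
  moreover have "valley (q' @ [b])" by (rule valley_subseq[OF assms(1)]) (auto simp: q intro: list_emb_Cons)
  ultimately show ?thesis using False q by (simp add: peak_rotation_def peak_first_def)
qed

lemma mset_peak_rotation [simp]: "mset (peak_rotation q b) = add_mset b (mset q)"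
  by (simp add: peak_rotation_def)

lemma length_peak_rotation [simp]: "length (peak_rotation q b) = Suc (length q)"
  by (simp add: peak_rotation_def)

lemma is_cycle_peak_rotation: "is_cycle f (b # q) \<Longrightarrow> is_cycle f (peak_rotation q b)"
  using is_cycle_rotate[of f "[b]" q] by (simp add: peak_rotation_def)

text \<open>
  The list \<open>bs\<close> is the first half of the cycle that is its own negative, empty if there is none, and
  \<open>As\<close> lists one cycle from each opposite pair, fixed points included.  The order of \<open>As\<close> carries no
  information about \<open>\<omega>\<close>; it is there for the merging of consecutive entries in the summation over
  cycle types.
\<close>
definition cycle_form :: "nat \<Rightarrow> (int \<Rightarrow> int) \<Rightarrow> int list \<Rightarrow> int list list \<Rightarrow> bool" where
  "cycle_form n \<omega> bs As \<longleftrightarrow> \<omega> \<in> hyperoctahedral n \<and>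
     mset (map abs (bs @ concat As)) = mset [1..int n] \<and>
     is_neg_cycle \<omega> bs \<and> sorted_wrt (<) bs \<and> (\<forall>b\<in>set bs. 0 < b) \<and>
     (\<forall>w\<in>set As. is_cycle \<omega> w \<and> peak_first w)"

lemma cycle_form_hyperoctahedral: "cycle_form n \<omega> bs As \<Longrightarrow> \<omega> \<in> hyperoctahedral n"
  by (simp add: cycle_form_def)

lemma cycle_form_distinct:
  "cycle_form n \<omega> bs As \<Longrightarrow> distinct (map abs (bs @ concat As))"
  unfolding cycle_form_def by (metis mset_eq_imp_distinct_iff distinct_upto)

lemma cycle_form_points:
  assumes "cycle_form n \<omega> bs As"
  shows "abs ` (set bs \<union> set (concat As)) = {1..int n}"
proof -
  have "set (map abs (bs @ concat As)) = set [1..int n]"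
    using assms unfolding cycle_form_def by (metis mset_eq_setD)
  then show ?thesis by (simp add: image_Un)
qed

lemma signed_points_abs: "x \<in> signed_points n \<longleftrightarrow> \<bar>x\<bar> \<in> {1..int n}"
  by (auto simp: signed_points_def)

lemma cycle_form_neg_word:
  assumes "cycle_form n \<omega> bs As" "x \<in> set bs"
  shows "x \<in> signed_points n" "0 < x"
proof -
  show "x \<in> signed_points n" using cycle_form_points[OF assms(1)] assms(2) unfolding signed_points_abs by blast
  show "0 < x" using assms by (simp add: cycle_form_def)
qed

lemma cycle_form_word:
  assumes "cycle_form n \<omega> bs As" "w \<in> set As" "x \<in> set w"
  shows "x \<in> signed_points n"
  using cycle_form_points[OF assms(1)] assms(2,3) unfolding signed_points_abs by fastforce

lemma path_split: "path f (p @ a # s) \<longleftrightarrow> path f p \<and> path f s \<and>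
    (p \<noteq> [] \<longrightarrow> f (last p) = a) \<and> (s \<noteq> [] \<longrightarrow> f a = hd s)"
  by (auto simp: path_append path_Cons)

lemma path_split2: "path f (p @ a # q @ b # s) \<longleftrightarrow> path f p \<and> path f q \<and> path f s \<and>
    (p \<noteq> [] \<longrightarrow> f (last p) = a) \<and> f a = hd (q @ [b]) \<and> (q \<noteq> [] \<longrightarrow> f (last q) = b) \<and>
    (s \<noteq> [] \<longrightarrow> f b = hd s)"
  by (auto simp: path_append path_Cons hd_append)

lemma signed_swap_outside:
  assumes "distinct (map abs (u @ a # v @ b # w))" "x \<in> set u \<union> set v \<union> set w"
  shows "signed_swap a b x = x"
proof -
  have "\<bar>a\<bar> \<notin> abs ` (set u \<union> set v \<union> set w)" "\<bar>b\<bar> \<notin> abs ` (set u \<union> set v \<union> set w)"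
    using assms(1) by auto
  then show ?thesis using assms(2) by (metis imageI signed_swap_other)
qed

text \<open>
  The arc \<open>q, b\<close> and its negative are cut off the cycle through \<open>bs\<close>, and what remains is again a
  cycle of this kind.
\<close>
lemma cycle_form_neg_swap:
  assumes f: "cycle_form n \<omega> (p @ a # q @ b # s) As"
  shows "cycle_form n (\<omega> \<circ> signed_swap a b) (p @ a # s) (peak_rotation q b # As)"
proof -
  let ?f = "\<omega> \<circ> signed_swap a b"
  have pts: "a \<in> signed_points n" "b \<in> signed_points n" "a > 0" "b > 0"
    using cycle_form_neg_word[OF f] by auto
  have dist: "distinct (map abs (p @ a # q @ b # s @ concat As))"
    using cycle_form_distinct[OF f] by simp
  have other: "?f x = \<omega> x" if "x \<in> set p \<union> set q \<union> set s \<union> set (concat As)" for x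
    using signed_swap_outside[of p a q b "s @ concat As" x] that dist by simp
  have ab: "?f a = \<omega> b" "?f b = \<omega> a" using pts by simp_all
  have cyc: "is_neg_cycle \<omega> (p @ a # q @ b # s)" and srt: "sorted_wrt (<) (p @ a # q @ b # s)"
    using f by (auto simp: cycle_form_def)
  have paths: "path ?f p = path \<omega> p" "path ?f q = path \<omega> q" "path ?f s = path \<omega> s"
    using other by (auto intro!: path_cong)
  have lasts: "p \<noteq> [] \<Longrightarrow> ?f (last p) = \<omega> (last p)" "q \<noteq> [] \<Longrightarrow> ?f (last q) = \<omega> (last q)"
    "s \<noteq> [] \<Longrightarrow> ?f (last s) = \<omega> (last s)" using other by auto
  define g where "g = ?f"
  define h where "h = hd (p @ [a])"
  have hd: "hd (p @ a # u) = h" for u by (cases p) (auto simp: h_def)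
  note links = cyc ab paths lasts
  note links = links[folded g_def, unfolded is_neg_cycle_def path_split2 hd]
  have "is_neg_cycle g (p @ a # s)"
    using links unfolding is_neg_cycle_def path_split hd by (cases "s = []") auto
  then have "is_neg_cycle ?f (p @ a # s)" by (simp only: g_def)
  moreover have "is_cycle g (b # q)"
    using links unfolding is_cycle_def path_Cons by (cases "q = []") auto
  then have "is_cycle ?f (b # q)" by (simp only: g_def)
  then have "is_cycle ?f (peak_rotation q b)" by (rule is_cycle_peak_rotation)
  moreover have "valley (q @ [b])"
    using srt by (intro valley_sorted) (auto simp: sorted_wrt_append)
  then have "peak_first (peak_rotation q b)"
    using dist by (intro peak_first_peak_rotation) (auto simp: distinct_map)
  moreover have "is_cycle ?f w = is_cycle \<omega> w" if "w \<in> set As" for w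
    using that other by (intro is_cycle_cong) auto
  moreover have "?f \<in> hyperoctahedral n"
    using cycle_form_hyperoctahedral[OF f] pts
    by (simp add: comp_hyperoctahedral signed_swap_hyperoctahedral)
  moreover have "sorted_wrt (<) (p @ a # s)" using srt by (auto simp: sorted_wrt_append)
  ultimately show ?thesis using f unfolding cycle_form_def
    by (auto simp: add_mset_commute union_assoc union_commute union_lcomm)
qed

text \<open>
  The arc that runs through \<open>s\<close> and then through the negatives of \<open>p\<close>, rotated so that it starts at
  its maximum: the last point of \<open>s\<close>, or the first negative if \<open>s\<close> is empty.
\<close>
definition wrapped_arc :: "int list \<Rightarrow> int list \<Rightarrow> int list" where
  "wrapped_arc s p = (if s = [] then map uminus p else last s # map uminus p @ butlast s)"

lemma mset_wrapped_arc: "mset (map abs (wrapped_arc s p)) = mset (map abs (s @ p))"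
proof (cases "s = []")
  case False
  then obtain s' y where "s = s' @ [y]" by (metis rev_exhaust)
  then show ?thesis by (simp add: wrapped_arc_def o_def)
qed (simp add: wrapped_arc_def o_def)

lemma length_wrapped_arc [simp]: "length (wrapped_arc s p) = length s + length p"
  by (cases s rule: rev_cases) (auto simp: wrapped_arc_def)

lemma peak_first_wrapped_arc:
  assumes "sorted_wrt (<) p" "sorted_wrt (<) s" "\<forall>x\<in>set p \<union> set s. 0 < x" "p \<noteq> []"
  shows "peak_first (wrapped_arc s p)"
proof (cases s rule: rev_cases)
  case Nil
  obtain x p' where p: "p = x # p'" using assms(4) by (cases p) auto
  have "sorted_wrt (>) (map uminus p')"
    using assms(1) p by (simp add: sorted_wrt_map)
  then show ?thesis using Nil p assms(1)
    by (auto simp: wrapped_arc_def peak_first_def intro: valley_sorted)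
next
  case (snoc s' y)
  have "sorted_wrt (>) (map uminus p)" using assms(1) by (simp add: sorted_wrt_map)
  moreover have "sorted_wrt (<) s'" using assms(2) snoc by (simp add: sorted_wrt_append)
  ultimately have "valley (map uminus p @ s')" by (rule valley_append)
  moreover have "\<forall>z\<in>set (map uminus p @ s'). z < y"
  proof
    fix z assume "z \<in> set (map uminus p @ s')"
    then consider x where "x \<in> set p" "z = - x" | "z \<in> set s'" by auto
    then show "z < y"
    proof cases
      case 1
      then have "0 < x" "0 < y" using assms(3) snoc by auto
      then show ?thesis using 1 by simp
    next
      case 2
      then show ?thesis using assms(2) snoc by (simp add: sorted_wrt_append)
    qed
  qed
  ultimately show ?thesis using snoc by (simp add: wrapped_arc_def peak_first_def)
qed

lemma is_cycle_wrapped_arc: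
  assumes "is_cycle f (s @ map uminus p)" shows "is_cycle f (wrapped_arc s p)"
proof (cases s rule: rev_cases)
  case Nil
  then show ?thesis using assms by (simp add: wrapped_arc_def)
next
  case (snoc s' y)
  then show ?thesis using assms is_cycle_rotate[of f s' "y # map uminus p"]
    by (simp add: wrapped_arc_def)
qed

text \<open>
  Exchanging points of opposite sign cuts off an arc that runs through the end of \<open>bs\<close> into the
  negatives.  If the points are opposite to each other, the arc is half of the cycle, and the
  cycle falls apart into an opposite pair.
\<close>
lemma cycle_form_neg_swap_opposite:
  assumes f: "cycle_form n \<omega> (p @ b # q @ a # s) As"
  shows "cycle_form n (\<omega> \<circ> signed_swap (- b) a) (q @ [a]) (wrapped_arc s (p @ [b]) # As)"
proof -
  let ?f = "\<omega> \<circ> signed_swap (- b) a"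
  have pts: "a \<in> signed_points n" "- b \<in> signed_points n" "a > 0" "b > 0"
    using cycle_form_neg_word[OF f] by auto
  have odd: "\<omega> (- x) = - \<omega> x" for x
    using hyperoctahedral_odd[OF cycle_form_hyperoctahedral[OF f]] .
  then have odd': "?f (- x) = - ?f x" for x by (simp add: signed_swap_odd)
  have dist: "distinct (map abs (p @ b # q @ a # s @ concat As))"
    using cycle_form_distinct[OF f] by simp
  have other: "?f x = \<omega> x" if "x \<in> set p \<union> set q \<union> set s \<union> set (concat As)" for x
    using signed_swap_outside[of p "- b" q a "s @ concat As" x] that dist by simp
  have ab: "?f a = - \<omega> b" "?f b = - \<omega> a"
    using pts odd'[of "- b"] by (simp_all add: odd)
  have cyc: "is_neg_cycle \<omega> (p @ b # q @ a # s)" and srt: "sorted_wrt (<) (p @ b # q @ a # s)"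
    using f by (auto simp: cycle_form_def)
  have paths: "path ?f p = path \<omega> p" "path ?f q = path \<omega> q" "path ?f s = path \<omega> s"
    using other by (auto intro!: path_cong)
  have lasts: "p \<noteq> [] \<Longrightarrow> ?f (last p) = \<omega> (last p)" "q \<noteq> [] \<Longrightarrow> ?f (last q) = \<omega> (last q)"
    "s \<noteq> [] \<Longrightarrow> ?f (last s) = \<omega> (last s)" using other by auto
  define g where "g = ?f"
  define h where "h = hd (p @ [b])"
  have hd: "hd (p @ b # u) = h" for u by (cases p) (auto simp: h_def)
  have uminus: "path g (map uminus (p @ [b])) = path g (p @ [b])"
    by (rule path_uminus) (simp only: g_def odd')
  have ends: "hd (map uminus (p @ [b])) = - h" "last (map uminus (p @ [b])) = - b"
    by (simp add: hd_map h_def del: map_append) simp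
  note links = cyc ab paths lasts odd'[of b]
  note links = links[folded g_def, unfolded is_neg_cycle_def path_split2 hd]
  have "is_neg_cycle g (q @ [a])"
    using links unfolding is_neg_cycle_def path_split by auto
  then have "is_neg_cycle ?f (q @ [a])" by (simp only: g_def)
  moreover have "is_cycle g (s @ map uminus (p @ [b]))"
    using links unfolding is_cycle_def path_append[of g s] uminus path_split hd
    by (cases "s = []") (auto simp: ends simp del: map_append)
  then have "is_cycle ?f (s @ map uminus (p @ [b]))" by (simp only: g_def)
  then have "is_cycle ?f (wrapped_arc s (p @ [b]))" by (rule is_cycle_wrapped_arc)
  moreover have "peak_first (wrapped_arc s (p @ [b]))"
    using srt f by (intro peak_first_wrapped_arc) (auto simp: sorted_wrt_append cycle_form_def)
  moreover have "is_cycle ?f w = is_cycle \<omega> w" if "w \<in> set As" for w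
    using that other by (intro is_cycle_cong) auto
  moreover have "?f \<in> hyperoctahedral n"
    using cycle_form_hyperoctahedral[OF f] pts
    by (simp add: comp_hyperoctahedral signed_swap_hyperoctahedral)
  moreover have "sorted_wrt (<) (q @ [a])" using srt by (auto simp: sorted_wrt_append)
  ultimately show ?thesis using f mset_wrapped_arc[of s "p @ [b]"] unfolding cycle_form_def
    by (auto simp: add_mset_commute union_assoc union_commute union_lcomm)
qed

lemma cycle_form_neg_swap_self:
  assumes f: "cycle_form n \<omega> (p @ b # s) As"
  shows "cycle_form n (\<omega> \<circ> signed_swap (- b) b) [] (wrapped_arc s (p @ [b]) # As)"
proof -
  let ?f = "\<omega> \<circ> signed_swap (- b) b"
  have pts: "b \<in> signed_points n" "b > 0"
    using cycle_form_neg_word[OF f] by auto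
  have odd: "\<omega> (- x) = - \<omega> x" for x
    using hyperoctahedral_odd[OF cycle_form_hyperoctahedral[OF f]] .
  then have odd': "?f (- x) = - ?f x" for x by (simp add: signed_swap_odd)
  have dist: "distinct (map abs (p @ b # s @ concat As))"
    using cycle_form_distinct[OF f] by simp
  have other: "?f x = \<omega> x" if "x \<in> set p \<union> set s \<union> set (concat As)" for x
  proof -
    have "\<bar>b\<bar> \<notin> abs ` (set p \<union> set s \<union> set (concat As))" using dist by auto
    then have "\<bar>x\<bar> \<noteq> \<bar>b\<bar>" using that by (metis imageI)
    then show ?thesis by (simp add: signed_swap_other)
  qed
  have ab: "?f b = - \<omega> b"
    using pts by (simp add: odd)
  have cyc: "is_neg_cycle \<omega> (p @ b # s)" and srt: "sorted_wrt (<) (p @ b # s)"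
    using f by (auto simp: cycle_form_def)
  have paths: "path ?f p = path \<omega> p" "path ?f s = path \<omega> s"
    using other by (auto intro!: path_cong)
  have lasts: "p \<noteq> [] \<Longrightarrow> ?f (last p) = \<omega> (last p)"
    "s \<noteq> [] \<Longrightarrow> ?f (last s) = \<omega> (last s)" using other by auto
  define g where "g = ?f"
  define h where "h = hd (p @ [b])"
  have hd: "hd (p @ b # u) = h" for u by (cases p) (auto simp: h_def)
  have uminus: "path g (map uminus (p @ [b])) = path g (p @ [b])"
    by (rule path_uminus) (simp only: g_def odd')
  have ends: "hd (map uminus (p @ [b])) = - h" "last (map uminus (p @ [b])) = - b"
    by (simp add: hd_map h_def del: map_append) simp
  note links = cyc ab paths lasts odd'[of b]
  note links = links[folded g_def, unfolded is_neg_cycle_def path_split hd]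
  have "is_cycle g (s @ map uminus (p @ [b]))"
    using links unfolding is_cycle_def path_append[of g s] uminus path_split hd
    by (cases "s = []") (auto simp: ends simp del: map_append)
  then have "is_cycle ?f (s @ map uminus (p @ [b]))" by (simp only: g_def)
  then have "is_cycle ?f (wrapped_arc s (p @ [b]))" by (rule is_cycle_wrapped_arc)
  moreover have "peak_first (wrapped_arc s (p @ [b]))"
    using srt f by (intro peak_first_wrapped_arc) (auto simp: sorted_wrt_append cycle_form_def)
  moreover have "is_cycle ?f w = is_cycle \<omega> w" if "w \<in> set As" for w
    using that other by (intro is_cycle_cong) auto
  moreover have "?f \<in> hyperoctahedral n"
    using cycle_form_hyperoctahedral[OF f] pts
    by (simp add: comp_hyperoctahedral signed_swap_hyperoctahedral)
  ultimately show ?thesis using f mset_wrapped_arc[of s "p @ [b]"] unfolding cycle_form_def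
    by (auto simp: is_neg_cycle_def add_mset_commute union_assoc union_commute union_lcomm)
qed

lemma cycle_form_pos_swap:
  assumes f: "cycle_form n \<omega> bs (A1 @ (p @ a # q @ b # s) # A2)"
  shows "cycle_form n (\<omega> \<circ> signed_swap a b) bs (A1 @ [peak_rotation q b, p @ a # s] @ A2)"
proof -
  let ?f = "\<omega> \<circ> signed_swap a b" and ?w = "p @ a # q @ b # s"
  have pts: "a \<in> signed_points n" "b \<in> signed_points n" "a \<noteq> 0" "b \<noteq> 0"
    using cycle_form_word[OF f, of ?w] by (auto dest: signed_points_nonzero)
  have dist: "distinct (map abs (bs @ concat A1 @ p @ a # q @ b # s @ concat A2))"
    using cycle_form_distinct[OF f] by simp
  have other: "?f x = \<omega> x"
    if "x \<in> set bs \<union> set p \<union> set q \<union> set s \<union> set (concat A1) \<union> set (concat A2)" for x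
  proof -
    have "signed_swap a b x = x"
      using that dist by (intro signed_swap_outside[of "bs @ concat A1 @ p" a q b "s @ concat A2" x]) auto
    then show ?thesis by simp
  qed
  have ab: "?f a = \<omega> b" "?f b = \<omega> a" using pts by simp_all
  have cyc: "is_cycle \<omega> ?w" and pk: "peak_first ?w"
    using f by (auto simp: cycle_form_def)
  have paths: "path ?f p = path \<omega> p" "path ?f q = path \<omega> q" "path ?f s = path \<omega> s"
    using other by (auto intro!: path_cong)
  have lasts: "p \<noteq> [] \<Longrightarrow> ?f (last p) = \<omega> (last p)" "q \<noteq> [] \<Longrightarrow> ?f (last q) = \<omega> (last q)"
    "s \<noteq> [] \<Longrightarrow> ?f (last s) = \<omega> (last s)" using other by auto
  define g where "g = ?f"
  define h where "h = hd (p @ [a])"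
  have hd: "hd (p @ a # u) = h" for u by (cases p) (auto simp: h_def)
  note links = cyc ab paths lasts
  note links = links[folded g_def, unfolded is_cycle_def path_split2 hd]
  have "is_cycle g (p @ a # s)"
    using links unfolding is_cycle_def path_split hd by (cases "s = []") auto
  then have "is_cycle ?f (p @ a # s)" by (simp only: g_def)
  moreover have "is_cycle g (b # q)"
    using links unfolding is_cycle_def path_Cons by (cases "q = []") auto
  then have "is_cycle ?f (b # q)" by (simp only: g_def)
  then have "is_cycle ?f (peak_rotation q b)" by (rule is_cycle_peak_rotation)
  moreover have v: "valley (tl ?w)" using pk by (simp add: peak_first_def)
  have "subseq (q @ [b]) (q @ b # s)" by auto
  then have "subseq (q @ [b]) (tl ?w)"
    by (cases p) (auto intro: list_emb_append2 list_emb_Cons)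
  then have "valley (q @ [b])" using v valley_subseq by blast
  then have "peak_first (peak_rotation q b)"
    using dist by (intro peak_first_peak_rotation) (auto simp: distinct_map)
  moreover have "subseq s (q @ b # s)" by (auto intro: list_emb_append2 list_emb_Cons)
  then have "subseq (tl (p @ a # s)) (tl ?w)"
    by (cases p) (auto intro: list_emb_append_mono)
  then have "valley (tl (p @ a # s))" using v valley_subseq by blast
  then have "peak_first (p @ a # s)" using pk by (cases p) (auto simp: peak_first_def)
  moreover have "is_cycle ?f w = is_cycle \<omega> w" if "w \<in> set A1 \<union> set A2" for w
    using that other by (intro is_cycle_cong) auto
  moreover have "is_neg_cycle ?f bs = is_neg_cycle \<omega> bs"
    using other by (intro is_neg_cycle_cong) auto
  moreover have "?f \<in> hyperoctahedral n"
    using cycle_form_hyperoctahedral[OF f] pts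
    by (simp add: comp_hyperoctahedral signed_swap_hyperoctahedral)
  ultimately show ?thesis using f unfolding cycle_form_def
    by (auto simp: add_mset_commute union_assoc union_commute union_lcomm)
qed

section \<open>Reflections below a noncrossing element\<close>

text \<open>
  A fixed function is constant on every cycle and vanishes on a cycle that is its own negative.
\<close>
lemma card_fixed_functions_le:
  assumes f: "cycle_form n \<omega> bs As"
  shows "card (fixed_functions n {\<omega>}) \<le> 3 ^ length As"
proof -
  let ?e = "\<lambda>g. map (\<lambda>w. g (hd w)) As" and ?V = "fixed_functions n {\<omega>}"
  have const: "g x = g (hd w)" if "g \<in> ?V" "w \<in> set As" "x \<in> set w" for g w x
    using that f path_const[of \<omega> w g x] by (auto simp: fixed_functions_def cycle_form_def is_cycle_def)
  have zero: "g x = 0" if g: "g \<in> ?V" and x: "x \<in> set bs" for g x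
  proof -
    have inv: "g (\<omega> i) = g i" "g (- i) = - g i" for i
      using g by (auto simp: fixed_functions_def odd_functions_def)
    have bs: "bs \<noteq> []" "path \<omega> bs" "\<omega> (last bs) = - hd bs"
      using f x by (auto simp: cycle_form_def is_neg_cycle_def)
    have "g (last bs) = g (hd bs)" using path_const[of \<omega> bs g "last bs"] bs(1,2) inv(1) by simp
    moreover have "g (last bs) = - g (hd bs)" using inv[of "last bs"] inv(2) bs(3) by metis
    ultimately have "g (hd bs) = 0" using double_eq_0_mod_3[of "g (hd bs)"] by simp
    then show ?thesis using path_const[of \<omega> bs g x] bs(2) inv(1) x by simp
  qed
  have "inj_on ?e ?V"
  proof (rule inj_onI)
    fix g h assume gh: "g \<in> ?V" "h \<in> ?V" "?e g = ?e h"
    have pos: "g i = h i" if "i \<in> {1..int n}" for i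
    proof -
      have "i \<in> abs ` (set bs \<union> set (concat As))"
        using that cycle_form_points[OF f] by simp
      then obtain x where x: "x \<in> set bs \<union> set (concat As)" "i = \<bar>x\<bar>" by blast
      have "g x = h x"
      proof (cases "x \<in> set bs")
        case False
        then obtain w where w: "w \<in> set As" "x \<in> set w" using x by auto
        then have "g (hd w) = h (hd w)" using gh(3) by simp
        then show ?thesis using const[OF gh(1) w] const[OF gh(2) w] by simp
      qed (simp add: zero[OF gh(1)] zero[OF gh(2)])
      moreover have "g (- x) = - g x" "h (- x) = - h x"
        using gh by (auto simp: fixed_functions_def odd_functions_def)
      ultimately show ?thesis using x(2) by (simp add: abs_if)
    qed
    show "g = h"
    proof
      fix i
      show "g i = h i"
      proof (cases "i \<in> signed_points n")
        case True
        then have "g \<bar>i\<bar> = h \<bar>i\<bar>" by (intro pos) (simp add: signed_points_abs)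
        moreover have "g (- i) = - g i" "h (- i) = - h i"
          using gh by (auto simp: fixed_functions_def odd_functions_def)
        ultimately show ?thesis by (auto simp: abs_if split: if_splits)
      next
        case False
        then show ?thesis using gh by (auto simp: fixed_functions_def odd_functions_def)
      qed
    qed
  qed
  moreover have "?e ` ?V \<subseteq> {xs. set xs \<subseteq> UNIV \<and> length xs = length As}" by auto
  ultimately have "card ?V \<le> card {xs. set xs \<subseteq> (UNIV :: 3 set) \<and> length xs = length As}"
    by (rule card_inj_on_le) (rule finite_lists_length_eq, simp)
  then show ?thesis using card_lists_length_eq[of "UNIV :: 3 set"] by simp
qed

lemma cycle_form_word_product_length:
  assumes "cycle_form n \<omega> bs As" "set ts \<subseteq> reflections n" "word_product ts = \<omega>"
  shows "n \<le> length ts + length As"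
proof -
  have "3 ^ n \<le> card (fixed_functions n (set ts)) * 3 ^ length ts"
    using card_fixed_functions_ge[OF assms(2)] .
  also have "card (fixed_functions n (set ts)) \<le> card (fixed_functions n {\<omega>})"
    using fixed_functions_word_product[of n ts] assms(3) finite_fixed_functions by (auto intro: card_mono)
  also have "\<dots> \<le> 3 ^ length As" using card_fixed_functions_le[OF assms(1)] .
  finally have "(3::nat) ^ n \<le> 3 ^ (length ts + length As)" by (simp add: power_add mult.commute)
  then show ?thesis by simp
qed

text \<open>
  In a shortest factorization the common fixed functions of the factors are as numerous as the
  fixed functions of the product, so every factor fixes the indicator function of a cycle minus
  that of its negative.
\<close>

lemma reflection_preserves_cycles:
  assumes f: "cycle_form n \<omega> bs As" and ts: "set ts \<subseteq> reflections n" "word_product ts = \<omega>"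
    and len: "length ts + length As \<le> n" and t: "signed_swap a b \<in> set ts"
    and ab: "a \<in> signed_points n" "b \<in> signed_points n" and w: "w \<in> set As"
  shows "a \<in> set w \<longleftrightarrow> b \<in> set w" "- a \<in> set w \<longleftrightarrow> - b \<in> set w"
proof -
  let ?V = "fixed_functions n {\<omega>}" and ?W = "fixed_functions n (set ts)"
  have sub: "?W \<subseteq> ?V" using fixed_functions_word_product[of n ts] ts(2) by simp
  have "3 ^ (n - length ts) * 3 ^ length ts \<le> card ?W * 3 ^ length ts"
    using card_fixed_functions_ge[OF ts(1)] len by (simp add: power_add[symmetric])
  then have "3 ^ (n - length ts) \<le> card ?W" by simp
  moreover have "(3::nat) ^ length As \<le> 3 ^ (n - length ts)" using len by simp
  ultimately have "card ?V \<le> card ?W" using card_fixed_functions_le[OF f] by linarith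
  then have eq: "?W = ?V" using card_seteq[OF finite_fixed_functions sub] by blast
  define g where "g x = (of_bool (x \<in> set w) - of_bool (- x \<in> set w) :: 3)" for x
  have h: "\<omega> \<in> hyperoctahedral n" and cyc: "is_cycle \<omega> w" using f w by (auto simp: cycle_form_def)
  have "\<omega> ` set w = set w"
    using is_cycle_closed[OF cyc] hyperoctahedral_inj[OF h]
    by (intro endo_inj_surj) (auto simp: inj_on_def)
  then have iff: "\<omega> x \<in> set w \<longleftrightarrow> x \<in> set w" for x
    using hyperoctahedral_inj[OF h] by (metis imageE image_eqI)
  have "g (\<omega> x) = g x" for x
    using iff[of x] iff[of "- x"] hyperoctahedral_odd[OF h, of x] by (simp add: g_def)
  moreover have "g \<in> odd_functions n"
    using cycle_form_word[OF f w] by (auto simp: odd_functions_def g_def)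
      (metis signed_points_uminus minus_minus)+
  ultimately have "g \<in> ?W" unfolding eq by (simp add: fixed_functions_def)
  then have "g (signed_swap a b a) = g a" using t by (auto simp: fixed_functions_def)
  then have gab: "g a = g b" using ab by (simp add: signed_points_nonzero)
  obtain A1 A2 where A: "As = A1 @ w # A2" using w by (auto simp: in_set_conv_decomp)
  have dist: "distinct (map abs w)" using cycle_form_distinct[OF f] A by simp
  have disj: "- x \<notin> set w" if "x \<in> set w" for x
  proof
    assume "- x \<in> set w"
    moreover have "inj_on abs (set w)" using dist by (simp add: distinct_map)
    ultimately have "x = - x" using that by (metis abs_minus_cancel inj_onD)
    then show False using cycle_form_word[OF f w that] by (auto dest: signed_points_nonzero)
  qed
  have "(1::3) \<noteq> -1" "(0::3) \<noteq> 1" "(0::3) \<noteq> -1" by simp_all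
  then show "a \<in> set w \<longleftrightarrow> b \<in> set w" "- a \<in> set w \<longleftrightarrow> - b \<in> set w"
    using gab disj[of a] disj[of "- a"] disj[of b] disj[of "- b"] unfolding g_def
    by (cases "a \<in> set w"; cases "b \<in> set w"; cases "- a \<in> set w"; cases "- b \<in> set w"; simp)+
qed

section \<open>Splitting cycles\<close>

lemma split_at_two:
  assumes "i < j" "j < length w"
  shows "w = take i w @ w ! i # take (j - Suc i) (drop (Suc i) w) @ w ! j # drop (Suc j) w"
proof -
  have "drop (Suc i) w = take (j - Suc i) (drop (Suc i) w) @ drop (j - Suc i) (drop (Suc i) w)"
    by (rule append_take_drop_id[symmetric])
  also have "drop (j - Suc i) (drop (Suc i) w) = drop j w" using assms by simp
  also have "\<dots> = w ! j # drop (Suc j) w" using assms by (simp add: Cons_nth_drop_Suc)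
  finally show ?thesis using assms by (metis id_take_nth_drop order.strict_trans)
qed

lemma path_nth: "path f w \<Longrightarrow> Suc i < length w \<Longrightarrow> f (w ! i) = w ! Suc i"
  by (simp add: path_def successively_conv_nth)

text \<open>
  An arc of length \<open>d\<close> on the cycle through \<open>bs\<close> and its negative is determined up to negation by
  its last position \<open>j\<close>, counted modulo \<open>length bs\<close>.  The reflection that cuts it off exchanges its
  last point with the point before the arc, which is among the negatives for \<open>d > j\<close>.
\<close>

definition neg_reflection :: "int list \<Rightarrow> nat \<Rightarrow> nat \<Rightarrow> int \<Rightarrow> int" where
  "neg_reflection bs d j =
     (if d \<le> j then signed_swap (bs ! (j - d)) (bs ! j)
      else signed_swap (- (bs ! j)) (bs ! (length bs - d + j)))"

definition pos_reflection :: "int list \<Rightarrow> nat \<Rightarrow> nat \<Rightarrow> int \<Rightarrow> int" where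
  "pos_reflection w d i = signed_swap (w ! i) (w ! (i + d))"

text \<open>
  The cases are those of the point before the arc: it is positive, or negative, or opposite to the
  last point of the arc.
\<close>
lemma neg_split:
  assumes f: "cycle_form n \<omega> bs As" and d: "1 \<le> d" "d \<le> length bs" and j: "j < length bs"
  shows "\<exists>bs' w. cycle_form n (\<omega> \<circ> neg_reflection bs d j) bs' (w # As) \<and>
    length bs' = length bs - d \<and> length w = d"
proof (cases "d \<le> j")
  case True
  note split = split_at_two[of "j - d" j bs]
  show ?thesis
    using cycle_form_neg_swap[of n \<omega> "take (j - d) bs" "bs ! (j - d)"
        "take (j - Suc (j - d)) (drop (Suc (j - d)) bs)" "bs ! j" "drop (Suc j) bs" As]
      split f d j True
    by (intro exI[of _ "take (j - d) bs @ bs ! (j - d) # drop (Suc j) bs"]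
        exI[of _ "peak_rotation (take (j - Suc (j - d)) (drop (Suc (j - d)) bs)) (bs ! j)"])
      (auto simp: neg_reflection_def)
next
  case False
  let ?q = "length bs - d + j"
  show ?thesis
  proof (cases "j < ?q")
    case True
    note split = split_at_two[of j ?q bs]
    show ?thesis
      using cycle_form_neg_swap_opposite[of n \<omega> "take j bs" "bs ! j"
          "take (?q - Suc j) (drop (Suc j) bs)" "bs ! ?q" "drop (Suc ?q) bs" As]
        split f d j True False
      by (intro exI[of _ "take (?q - Suc j) (drop (Suc j) bs) @ [bs ! ?q]"]
          exI[of _ "wrapped_arc (drop (Suc ?q) bs) (take j bs @ [bs ! j])"])
        (auto simp: neg_reflection_def)
  next
    case eq: False
    then have "d = length bs" using d by linarith
    then show ?thesis
      using cycle_form_neg_swap_self[of n \<omega> "take j bs" "bs ! j" "drop (Suc j) bs" As]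
        id_take_nth_drop[OF j] f j
      by (intro exI[of _ "[]"] exI[of _ "wrapped_arc (drop (Suc j) bs) (take j bs @ [bs ! j])"])
        (auto simp: neg_reflection_def)
  qed
qed

lemma pos_split:
  assumes f: "cycle_form n \<omega> bs As" and k: "k < length As" and d: "1 \<le> d" "i + d < length (As ! k)"
  shows "\<exists>u v. cycle_form n (\<omega> \<circ> pos_reflection (As ! k) d i) bs (take k As @ [u, v] @ drop (Suc k) As) \<and>
    length u = d \<and> length v = length (As ! k) - d"
proof -
  let ?w = "As ! k" and ?j = "i + d"
  have "cycle_form n \<omega> bs (take k As @ ?w # drop (Suc k) As)"
    using f k by (simp add: id_take_nth_drop[symmetric])
  moreover have "?w = take i ?w @ ?w ! i # take (?j - Suc i) (drop (Suc i) ?w) @ ?w ! ?j # drop (Suc ?j) ?w"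
    using d by (intro split_at_two) auto
  ultimately have "cycle_form n (\<omega> \<circ> signed_swap (?w ! i) (?w ! ?j)) bs
    (take k As @ [peak_rotation (take (?j - Suc i) (drop (Suc i) ?w)) (?w ! ?j),
      take i ?w @ ?w ! i # drop (Suc ?j) ?w] @ drop (Suc k) As)"
    using cycle_form_pos_swap by metis
  then show ?thesis using d
    by (intro exI[of _ "peak_rotation (take (?j - Suc i) (drop (Suc i) ?w)) (?w ! ?j)"]
        exI[of _ "take i ?w @ ?w ! i # drop (Suc ?j) ?w"])
      (auto simp: pos_reflection_def)
qed

section \<open>Good and bad splittings\<close>

lemma bruhat_less_signed_swap:
  assumes "1 \<le> n" "\<omega> \<in> hyperoctahedral n" "x \<in> signed_points n" "y \<in> signed_points n" "x \<noteq> y"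
  shows "bruhat_less n \<omega> (\<omega> \<circ> signed_swap x y) \<longleftrightarrow> (x < y \<longleftrightarrow> \<omega> x < \<omega> y)"
proof (cases "x < y")
  case True
  then show ?thesis using bruhat_less_swap_iff[OF assms(1-4)] by simp
next
  case False
  moreover have "\<omega> x \<noteq> \<omega> y" using assms by (simp add: hyperoctahedral_inj)
  ultimately show ?thesis
    using bruhat_less_swap_iff[OF assms(1,2,4,3)] assms(5) by (auto simp: signed_swap_commute[of x y])
qed

text \<open>
  The cycle through \<open>bs\<close> and its negative increases as long as it stays among the points \<open>bs\<close>, and
  falls below all of them after the last one.  So, moving both end points of an arc one place on,
  their order is reversed only if the later one leaves \<open>bs\<close> and the earlier one either stays
  positive or enters \<open>bs\<close> from below at the same moment.
\<close>
lemma neg_reflection_bad_iff: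
  assumes n: "1 \<le> n" and f: "cycle_form n \<omega> bs As" and d: "1 \<le> d" "d \<le> length bs" and j: "j < length bs"
  shows "bruhat_less n \<omega> (\<omega> \<circ> neg_reflection bs d j) \<longleftrightarrow> j \<noteq> length bs - 1"
proof -
  let ?b = "length bs"
  note h = cycle_form_hyperoctahedral[OF f]
  have "bs \<noteq> []" using j by auto
  then have "path \<omega> bs" and last: "\<omega> (bs ! (?b - 1)) = - (bs ! 0)"
    using f by (simp_all add: cycle_form_def is_neg_cycle_def last_conv_nth hd_conv_nth)
  then have step: "\<omega> (bs ! i) = bs ! Suc i" if "Suc i < ?b" for i using path_nth that by blast
  have less: "bs ! i < bs ! i'" if "i < i'" "i' < ?b" for i i'
    using f that by (simp add: cycle_form_def sorted_wrt_nth_less)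
  have pts: "bs ! i \<in> signed_points n" "0 < bs ! i" if "i < ?b" for i
    using cycle_form_neg_word[OF f] that by auto
  show ?thesis
  proof (cases "d \<le> j")
    case True
    have x: "\<omega> (bs ! (j - d)) = bs ! Suc (j - d)" using step d j True by simp
    have lt: "bs ! (j - d) < bs ! j" using less d j True by simp
    then have "bruhat_less n \<omega> (\<omega> \<circ> neg_reflection bs d j) \<longleftrightarrow> bs ! Suc (j - d) < \<omega> (bs ! j)"
      using bruhat_less_signed_swap[OF n h pts(1) pts(1), of "j - d" j] j True x
      by (simp add: neg_reflection_def)
    also have "\<dots> \<longleftrightarrow> j \<noteq> ?b - 1"
    proof (cases "j = ?b - 1")
      case True
      then have "\<omega> (bs ! j) = - (bs ! 0)" using last by simp
      moreover have "0 < bs ! 0" "0 < bs ! Suc (j - d)"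
        using pts(2)[of 0] pts(2)[of "Suc (j - d)"] j d \<open>d \<le> j\<close> by linarith+
      ultimately show ?thesis using True by simp
    next
      case False
      then have "\<omega> (bs ! j) = bs ! Suc j" using step j by simp
      moreover have "bs ! Suc (j - d) < bs ! Suc j" using less[of "Suc (j - d)" "Suc j"] d j False True by simp
      ultimately show ?thesis using False by simp
    qed
    finally show ?thesis .
  next
    case False
    let ?q = "?b - d + j"
    have q: "j \<le> ?q" "?q < ?b" using d False by auto
    have "- (bs ! j) < bs ! ?q" using pts(2)[OF j] pts(2)[OF q(2)] by linarith
    moreover have "- (bs ! j) \<in> signed_points n" using pts(1)[OF j] by simp
    moreover have "\<omega> (- (bs ! j)) = - \<omega> (bs ! j)" using hyperoctahedral_odd[OF h] .
    ultimately have "bruhat_less n \<omega> (\<omega> \<circ> neg_reflection bs d j) \<longleftrightarrow> - \<omega> (bs ! j) < \<omega> (bs ! ?q)"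
      using bruhat_less_signed_swap[OF n h _ pts(1)[OF q(2)], of "- (bs ! j)"] False
      by (simp add: neg_reflection_def)
    also have "\<dots> \<longleftrightarrow> j \<noteq> ?b - 1"
    proof (cases "j = ?b - 1")
      case True
      then have "?q = ?b - 1" using q by linarith
      moreover have "0 < bs ! 0" using pts(2)[of 0] j by linarith
      ultimately show ?thesis using True last by simp
    next
      case F: False
      then have sj: "Suc j < ?b" using j by simp
      then have "\<omega> (bs ! j) = bs ! Suc j" using step by simp
      moreover have "- (bs ! Suc j) < \<omega> (bs ! ?q)"
      proof (cases "?q = ?b - 1")
        case True
        then have "\<omega> (bs ! ?q) = - (bs ! 0)" using last by simp
        then show ?thesis using less[of 0 "Suc j"] sj by simp
      next
        case False
        then have "Suc ?q < ?b" using q(2) by simp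
        then have "\<omega> (bs ! ?q) = bs ! Suc ?q" "0 < bs ! Suc ?q" "0 < bs ! Suc j"
          using step[of ?q] pts(2) sj by simp_all
        then show ?thesis by linarith
      qed
      ultimately show ?thesis using F by simp
    qed
    finally show ?thesis .
  qed
qed

lemma valley_nth:
  assumes "valley u" "i < j" "j < k" "k < length u"
  shows "u ! j < u ! i \<or> u ! j < u ! k"
proof -
  have u: "u = take i u @ u ! i # take (j - Suc i) (drop (Suc i) u) @ u ! j # drop (Suc j) u"
    using assms by (intro split_at_two) auto
  have "u ! k \<in> set (drop (Suc j) u)"
    using assms by (auto simp: in_set_conv_nth intro!: exI[of _ "k - Suc j"])
  then have "subseq [u ! j, u ! k] (u ! j # drop (Suc j) u)" by (simp add: subseq_singleton_left)
  then have "subseq [u ! j, u ! k] (take (j - Suc i) (drop (Suc i) u) @ u ! j # drop (Suc j) u)"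
    by (rule list_emb_append2)
  then have "subseq [u ! i, u ! j, u ! k]
    (u ! i # take (j - Suc i) (drop (Suc i) u) @ u ! j # drop (Suc j) u)"
    by (rule subseq_Cons2)
  then have "subseq [u ! i, u ! j, u ! k]
    (take i u @ u ! i # take (j - Suc i) (drop (Suc i) u) @ u ! j # drop (Suc j) u)"
    by (rule list_emb_append2)
  then have "subseq [u ! i, u ! j, u ! k] u" using u by simp
  then show ?thesis using assms(1) by (simp add: valley_def)
qed

lemma card_single_switch:
  assumes "\<not> s 0" "s N" "\<And>i. i < N \<Longrightarrow> s i \<Longrightarrow> s (Suc i)"
  shows "card {i. i < N \<and> s i \<noteq> s (Suc i)} = 1"
proof -
  define m where "m = (LEAST i. s i)"
  have m: "s m" unfolding m_def using assms(2) by (rule LeastI)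
  have min: "\<not> s i" if "i < m" for i using not_less_Least that unfolding m_def by blast
  have "m \<le> N" unfolding m_def using assms(2) by (rule Least_le)
  moreover have "m > 0" using m assms(1) by (cases m) auto
  moreover have "s i" if "m \<le> i" "i \<le> N" for i
    using that(1,2) by (induction i rule: dec_induct) (auto intro: m assms(3))
  ultimately have "{i. i < N \<and> s i \<noteq> s (Suc i)} = {m - 1}"
    using min m by (auto simp: not_less_eq) (metis Suc_leI Suc_pred leD le_antisym not_le_imp_less less_Suc_eq_le less_imp_le_nat)+
  then show ?thesis by simp
qed

text \<open>
  Let \<open>e\<close> run through the word from its peak and return to the peak.  The difference
  \<open>e (i + d) - e i\<close> starts negative and ends positive, and the valley shape allows no return to
  negative values.  A splitting is good exactly where the sign changes.
\<close>

lemma card_good_pos_reflections: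
  assumes n: "1 \<le> n" and f: "cycle_form n \<omega> bs As" and w: "w \<in> set As" and d: "1 \<le> d" "d < length w"
  shows "card {i. i < length w - d \<and> \<not> bruhat_less n \<omega> (\<omega> \<circ> pos_reflection w d i)} = 1"
proof -
  let ?m = "length w"
  note h = cycle_form_hyperoctahedral[OF f]
  define e where "e i = (if i < ?m then w ! i else w ! 0)" for i
  define s where "s i \<longleftrightarrow> e i < e (i + d)" for i
  have cyc: "is_cycle \<omega> w" and pk: "peak_first w" using f w by (auto simp: cycle_form_def)
  obtain x u where xu: "w = x # u" using pk by (cases w) (auto simp: peak_first_def)
  have step: "\<omega> (w ! i) = e (Suc i)" if "i < ?m" for i
  proof (cases "Suc i < ?m")
    case True
    then show ?thesis using cyc path_nth by (auto simp: is_cycle_def e_def)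
  next
    case False
    then have "i = ?m - 1" using that by simp
    moreover have "\<omega> (w ! (?m - 1)) = w ! 0"
      using cyc last_conv_nth[of w] hd_conv_nth[of w] by (simp add: is_cycle_def)
    ultimately show ?thesis using xu by (simp add: e_def)
  qed
  have pts: "w ! i \<in> signed_points n" if "i < ?m" for i using cycle_form_word[OF f w] that by simp
  obtain A1 A2 where A: "As = A1 @ w # A2" using w by (auto simp: in_set_conv_decomp)
  have "distinct (map abs w)" using cycle_form_distinct[OF f] A by simp
  then have dist: "distinct w" by (simp add: distinct_map)
  have max: "e i < e 0" if "0 < i" "i < ?m" for i
    using pk xu that by (auto simp: e_def peak_first_def nth_Cons split: nat.splits)
  have val: "e j < e i \<or> e j < e k" if "0 < i" "i < j" "j < k" "k < ?m" for i j k
    using valley_nth[of u "i - 1" "j - 1" "k - 1"] pk xu that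
    by (auto simp: e_def peak_first_def nth_Cons split: nat.splits)
  have "\<not> s 0" using max[of d] d by (auto simp: s_def)
  moreover have top: "s (?m - d)" using max[of "?m - d"] d by (auto simp: s_def e_def)
  moreover have "s (Suc i)" if i: "i < ?m - d" "s i" for i
  proof (cases "Suc i = ?m - d")
    case False
    have "0 < i" using i(2) \<open>\<not> s 0\<close> by (cases i) auto
    have lt: "e i < e (i + d)" using i(2) by (simp add: s_def)
    have up: "e (i + d) < e (Suc i + d)"
      using val[of i "i + d" "Suc i + d"] \<open>0 < i\<close> lt d(1) i(1) False by auto
    show ?thesis
    proof (cases "d = 1")
      case True
      then show ?thesis using up by (simp add: s_def)
    next
      case False
      then have "e (Suc i) < e i \<or> e (Suc i) < e (Suc i + d)"
        using val[of i "Suc i" "Suc i + d"] \<open>0 < i\<close> d(1) i(1) \<open>Suc i \<noteq> ?m - d\<close> by auto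
      then show ?thesis using lt up by (auto simp: s_def)
    qed
  qed (use top in simp)
  ultimately have "card {i. i < ?m - d \<and> s i \<noteq> s (Suc i)} = 1" by (rule card_single_switch)
  moreover have "bruhat_less n \<omega> (\<omega> \<circ> pos_reflection w d i) \<longleftrightarrow> s i = s (Suc i)" if "i < ?m - d" for i
  proof -
    have i: "i < ?m" "i + d < ?m" using that d by auto
    then have "w ! i \<noteq> w ! (i + d)" using dist d by (simp add: nth_eq_iff_index_eq)
    from bruhat_less_signed_swap[OF n h pts[OF i(1)] pts[OF i(2)] this]
    show ?thesis using i step[OF i(1)] step[OF i(2)] by (auto simp: pos_reflection_def s_def e_def)
  qed
  then have "{i. i < ?m - d \<and> \<not> bruhat_less n \<omega> (\<omega> \<circ> pos_reflection w d i)} = {i. i < ?m - d \<and> s i \<noteq> s (Suc i)}"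
    by auto
  ultimately show ?thesis by simp
qed

section \<open>Counting chains by their bad edges\<close>

definition down_steps :: "nat \<Rightarrow> bool \<Rightarrow> (int \<Rightarrow> int) \<Rightarrow> (int \<Rightarrow> int) set" where
  "down_steps n r \<omega> = {t \<in> reflections n. bruhat_less n \<omega> (\<omega> \<circ> t) = r}"

text \<open>
  Chains from \<open>\<omega>\<close> down to the identity, listed from the top; the head of the pattern belongs to
  the uppermost edge, and \<open>True\<close> stands for a bad edge.
\<close>
fun lower_chains :: "nat \<Rightarrow> bool list \<Rightarrow> (int \<Rightarrow> int) \<Rightarrow> (int \<Rightarrow> int) list set" where
  "lower_chains n [] \<omega> = (if \<omega> = id then {[id]} else {})"
| "lower_chains n (r # R) \<omega> = (\<Union>t\<in>down_steps n r \<omega>. (#) \<omega> ` lower_chains n R (\<omega> \<circ> t))"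

lemma finite_down_steps [simp]: "finite (down_steps n r \<omega>)"
  by (simp add: down_steps_def)

lemma finite_lower_chains: "finite (lower_chains n R \<omega>)"
  by (induction R arbitrary: \<omega>) auto

lemma lower_chains_hd: "us \<in> lower_chains n R \<omega> \<Longrightarrow> us \<noteq> [] \<and> hd us = \<omega>"
  by (cases R) (auto split: if_splits)

lemma lower_chains_factorization:
  "us \<in> lower_chains n R \<omega> \<Longrightarrow>
    \<exists>ts. set ts \<subseteq> reflections n \<and> length ts = length R \<and> word_product ts = \<omega>"
proof (induction R arbitrary: us \<omega>)
  case Nil
  then show ?case by (intro exI[of _ "[]"]) (auto split: if_splits)
next
  case (Cons r R)
  then obtain t us' where t: "t \<in> reflections n" "us' \<in> lower_chains n R (\<omega> \<circ> t)"
    by (auto simp: down_steps_def)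
  from Cons.IH[OF t(2)] obtain ts where ts: "set ts \<subseteq> reflections n" "length ts = length R"
    "word_product ts = \<omega> \<circ> t" by blast
  have "word_product (ts @ [t]) = \<omega> \<circ> (t \<circ> t)" by (simp only: word_product_append ts(3)) (simp add: o_assoc)
  then have "word_product (ts @ [t]) = \<omega>" by (simp only: reflection_involution[OF t(1)] comp_id)
  then show ?case using ts t by (intro exI[of _ "ts @ [t]"]) auto
qed

lemma card_lower_chains_Cons:
  assumes "\<omega> \<in> hyperoctahedral n"
  shows "card (lower_chains n (r # R) \<omega>) = (\<Sum>t\<in>down_steps n r \<omega>. card (lower_chains n R (\<omega> \<circ> t)))"
proof -
  have "(#) \<omega> ` lower_chains n R (\<omega> \<circ> t) \<inter> (#) \<omega> ` lower_chains n R (\<omega> \<circ> t') = {}" if "t \<noteq> t'" for t t'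
  proof -
    have "\<omega> \<circ> t \<noteq> \<omega> \<circ> t'" using that hyperoctahedral_inj[OF assms] by (auto simp: fun_eq_iff)
    then show ?thesis by (auto dest!: lower_chains_hd)
  qed
  then have "card (lower_chains n (r # R) \<omega>) =
    (\<Sum>t\<in>down_steps n r \<omega>. card ((#) \<omega> ` lower_chains n R (\<omega> \<circ> t)))"
    unfolding lower_chains.simps by (intro card_UN_disjoint) (auto simp: finite_lower_chains)
  then show ?thesis by (simp add: card_image)
qed

text \<open>
  If an arc length admits \<open>m\<close> ways to split a cycle, one of them is good; this counts those of
  kind \<open>r\<close>.
\<close>

definition weight :: "bool \<Rightarrow> nat \<Rightarrow> nat" where
  "weight r m = (if r then m - 1 else 1)"

text \<open>
  The number of chains below an element with a self-opposite cycle on \<open>b\<close> points up to sign and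
  opposite pairs of cycles of lengths \<open>ms\<close>, for patterns of the fitting length.  When the pattern is
  exhausted, the type of fitting size is that of the identity.
\<close>
fun split_count :: "bool list \<Rightarrow> nat \<Rightarrow> nat list \<Rightarrow> nat" where
  "split_count [] b ms = 1"
| "split_count (r # R) b ms =
     (\<Sum>d=1..b. weight r b * split_count R (b - d) (d # ms)) +
     (\<Sum>k<length ms. \<Sum>d=1..<ms ! k. weight r (ms ! k - d) *
        split_count R b (take k ms @ [d, ms ! k - d] @ drop (Suc k) ms))"

lemma sum_one_exception:
  assumes "finite I" "card {i \<in> I. \<not> P i} = 1"
  shows "(\<Sum>i\<in>I. if P i = r then (c::nat) else 0) = weight r (card I) * c"
proof (cases r)
  case True
  have "card {i \<in> I. P i} + card {i \<in> I. \<not> P i} = card ({i \<in> I. P i} \<union> {i \<in> I. \<not> P i})"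
    using assms(1) by (intro card_Un_disjoint[symmetric]) auto
  also have "{i \<in> I. P i} \<union> {i \<in> I. \<not> P i} = I" by auto
  finally have "card {i \<in> I. P i} = card I - 1" using assms(2) by simp
  then show ?thesis using True assms(1) by (simp add: weight_def sum.inter_filter[symmetric])
next
  case False
  have "(\<Sum>i\<in>I. if P i = r then c else 0) = (\<Sum>i\<in>I. if \<not> P i then c else 0)"
    using False by (intro sum.cong) auto
  also have "\<dots> = card {i \<in> I. \<not> P i} * c"
    using assms(1) by (simp only: sum.inter_filter[symmetric] sum_constant of_nat_id)
  finally show ?thesis using False assms(2) by (simp add: weight_def)
qed

definition neg_splits :: "int list \<Rightarrow> (nat \<times> nat) set" where
  "neg_splits bs = {1..length bs} \<times> {..<length bs}"

definition pos_splits :: "int list \<Rightarrow> (nat \<times> nat) set" where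
  "pos_splits w = (SIGMA d:{1..<length w}. {..<length w - d})"

lemma inj_on_neg_reflection:
  assumes f: "cycle_form n \<omega> bs As"
  shows "inj_on (\<lambda>(d, j). neg_reflection bs d j) (neg_splits bs)"
proof (rule inj_onI, clarify)
  fix d j d' j'
  assume dj: "(d, j) \<in> neg_splits bs" "(d', j') \<in> neg_splits bs"
    and eq: "neg_reflection bs d j = neg_reflection bs d' j'"
  let ?b = "length bs"
  have b: "1 \<le> d" "d \<le> ?b" "j < ?b" "1 \<le> d'" "d' \<le> ?b" "j' < ?b"
    using dj by (auto simp: neg_splits_def)
  have pos: "0 < bs ! i" if "i < ?b" for i using cycle_form_neg_word[OF f] that by simp
  have "distinct bs" using cycle_form_distinct[OF f] by (simp add: distinct_map)
  then have nth: "bs ! i = bs ! i' \<longleftrightarrow> i = i'" if "i < ?b" "i' < ?b" for i i'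
    using that by (simp add: nth_eq_iff_index_eq)
  define x where "x d j = (if d \<le> j then bs ! (j - d) else - (bs ! j))" for d j
  define y where "y d j = (if d \<le> j then bs ! j else bs ! (?b - d + j))" for d j
  have xy: "neg_reflection bs d j = signed_swap (x d j) (y d j)" for d j
    by (simp add: neg_reflection_def x_def y_def)
  have ne: "x d j \<noteq> y d j \<and> x d j \<noteq> 0 \<and> y d j \<noteq> 0" if "1 \<le> d" "d \<le> ?b" "j < ?b" for d j
  proof (cases "d \<le> j")
    case True
    then have "j - d < ?b" "j - d \<noteq> j" using that by linarith+
    then show ?thesis using that True pos[of "j - d"] pos[of j] nth[of "j - d" j] by (auto simp: x_def y_def)
  next
    case False
    then have "?b - d + j < ?b" using that by linarith
    then show ?thesis using False that pos[of "?b - d + j"] pos[of j] by (auto simp: x_def y_def)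
  qed
  have "{x d' j', y d' j'} = {x d j, y d j} \<or> {x d' j', y d' j'} = {- x d j, - y d j}"
    using eq ne[OF b(1-3)] ne[OF b(4-6)] by (simp add: xy signed_swap_eq_iff)
  then have *: "(x d' j' = x d j \<and> y d' j' = y d j) \<or> (x d' j' = y d j \<and> y d' j' = x d j) \<or>
    (x d' j' = - x d j \<and> y d' j' = - y d j) \<or> (x d' j' = - y d j \<and> y d' j' = - x d j)"
    by (auto simp: doubleton_eq_iff)
  have sgn: "if d \<le> j then 0 < x d j \<and> 0 < y d j else x d j < 0 \<and> 0 < y d j"
    if "1 \<le> d" "d \<le> ?b" "j < ?b" for d j
  proof (cases "d \<le> j")
    case True
    then show ?thesis using pos[of "j - d"] pos[of j] that by (simp add: x_def y_def)
  next
    case False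
    then have "?b - d + j < ?b" using that by linarith
    then show ?thesis using False pos[of "?b - d + j"] pos[of j] that by (simp add: x_def y_def)
  qed
  \<comment> \<open>The sign of the first point tells which clause of the definition applies.\<close>
  note sgn' = sgn[OF b(1-3)] sgn[OF b(4-6)]
  show "d = d' \<and> j = j'"
  proof (cases "d \<le> j")
    case c: True
    have c': "d' \<le> j'"
    proof (rule ccontr)
      assume "\<not> d' \<le> j'"
      then show False using * sgn' c by (elim disjE) simp_all
    qed
    then have "(bs ! (j' - d') = bs ! (j - d) \<and> bs ! j' = bs ! j) \<or>
      (bs ! (j' - d') = bs ! j \<and> bs ! j' = bs ! (j - d))"
      using * sgn' c by (elim disjE) (simp_all add: x_def y_def)
    moreover have "j - d < ?b" "j' - d' < ?b" using b by auto
    ultimately have "(j' - d' = j - d \<and> j' = j) \<or> (j' - d' = j \<and> j' = j - d)"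
      using nth b by simp
    then show ?thesis using b c c' by linarith
  next
    case c: False
    have c': "\<not> d' \<le> j'"
    proof
      assume "d' \<le> j'"
      then show False using * sgn' c by (elim disjE) simp_all
    qed
    then have "(bs ! j' = bs ! j \<and> bs ! (?b - d' + j') = bs ! (?b - d + j)) \<or>
      (bs ! j' = bs ! (?b - d + j) \<and> bs ! (?b - d' + j') = bs ! j)"
      using * sgn' c by (elim disjE) (simp_all add: x_def y_def)
    moreover have "?b - d + j < ?b" "?b - d' + j' < ?b" using b c c' by linarith+
    ultimately have "(j' = j \<and> ?b - d' + j' = ?b - d + j) \<or> (j' = ?b - d + j \<and> ?b - d' + j' = j)"
      using nth b by simp
    then show ?thesis using b by linarith
  qed
qed

lemma inj_on_pos_reflection:
  assumes "distinct (map abs w)" "\<And>x. x \<in> set w \<Longrightarrow> x \<noteq> 0"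
  shows "inj_on (\<lambda>(d, i). pos_reflection w d i) (pos_splits w)"
proof (rule inj_onI, clarify)
  fix d i d' i'
  assume di: "(d, i) \<in> pos_splits w" "(d', i') \<in> pos_splits w"
    and eq: "pos_reflection w d i = pos_reflection w d' i'"
  have b: "1 \<le> d" "i + d < length w" "1 \<le> d'" "i' + d' < length w"
    using di by (auto simp: pos_splits_def)
  have inj: "\<bar>w ! p\<bar> = \<bar>w ! q\<bar> \<longleftrightarrow> p = q" if "p < length w" "q < length w" for p q
    using nth_eq_iff_index_eq[OF assms(1), of p q] that by simp
  have ne: "w ! p \<noteq> w ! q" if "p < length w" "q < length w" "p \<noteq> q" for p q
    using inj[of p q] that by auto
  have "{w ! i', w ! (i' + d')} = {w ! i, w ! (i + d)} \<or> {w ! i', w ! (i' + d')} = {- (w ! i), - (w ! (i + d))}"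
    using eq b assms(2) ne[of i "i + d"] ne[of i' "i' + d'"]
    by (subst signed_swap_eq_iff[symmetric]) (auto simp: pos_reflection_def)
  then have "(\<bar>w ! i'\<bar> = \<bar>w ! i\<bar> \<and> \<bar>w ! (i' + d')\<bar> = \<bar>w ! (i + d)\<bar>) \<or>
    (\<bar>w ! i'\<bar> = \<bar>w ! (i + d)\<bar> \<and> \<bar>w ! (i' + d')\<bar> = \<bar>w ! i\<bar>)"
    by (auto simp: doubleton_eq_iff)
  then show "d = d' \<and> i = i'" using inj b by auto
qed

lemma neg_reflection_pair:
  assumes "\<forall>b\<in>set bs. 0 < b" "(d, j) \<in> neg_splits bs" "distinct bs"
  shows "\<exists>x y. neg_reflection bs d j = signed_swap x y \<and> x \<noteq> y \<and> \<bar>x\<bar> \<in> set bs \<and> \<bar>y\<bar> \<in> set bs"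
proof (cases "d \<le> j")
  case True
  have "bs ! (j - d) \<noteq> bs ! j" "bs ! (j - d) \<in> set bs" "bs ! j \<in> set bs"
    using assms(2,3) True by (auto simp: neg_splits_def nth_eq_iff_index_eq)
  then show ?thesis using assms(1) True
    by (intro exI[of _ "bs ! (j - d)"] exI[of _ "bs ! j"]) (auto simp: neg_reflection_def)
next
  case False
  then have "bs ! j \<in> set bs" "bs ! (length bs - d + j) \<in> set bs"
    using assms(2) by (auto simp: neg_splits_def)
  moreover have "neg_reflection bs d j = signed_swap (- (bs ! j)) (bs ! (length bs - d + j))"
    using False by (simp add: neg_reflection_def)
  moreover have "0 < bs ! j" "0 < bs ! (length bs - d + j)" using assms(1) calculation by auto
  moreover from this have "- (bs ! j) \<noteq> bs ! (length bs - d + j)" "\<bar>- (bs ! j)\<bar> = bs ! j"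
    "\<bar>bs ! (length bs - d + j)\<bar> = bs ! (length bs - d + j)" by linarith+
  ultimately show ?thesis by metis
qed

lemma neg_reflection_surj:
  assumes pos: "\<forall>b\<in>set bs. 0 < b" and xy: "x \<noteq> y" "\<bar>x\<bar> \<in> set bs" "\<bar>y\<bar> \<in> set bs"
  shows "signed_swap x y \<in> (\<lambda>(d, j). neg_reflection bs d j) ` neg_splits bs"
proof -
  let ?T = "(\<lambda>(d, j). neg_reflection bs d j) ` neg_splits bs"
  have same: "signed_swap (bs ! p) (bs ! q) \<in> ?T" if "p < q" "q < length bs" for p q
    using that by (intro image_eqI[of _ _ "(q - p, q)"]) (auto simp: neg_reflection_def neg_splits_def)
  have opposite: "signed_swap (- (bs ! p)) (bs ! q) \<in> ?T" if "p \<le> q" "q < length bs" for p q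
  proof (intro image_eqI[of _ _ "(length bs - q + p, p)"])
    have "\<not> length bs - q + p \<le> p" "length bs - (length bs - q + p) + p = q" using that by auto
    then show "signed_swap (- (bs ! p)) (bs ! q) = (case (length bs - q + p, p) of (d, j) \<Rightarrow> neg_reflection bs d j)"
      by (simp only: neg_reflection_def prod.case if_False)
  qed (use that in \<open>auto simp: neg_splits_def\<close>)
  obtain p q where pq: "p < length bs" "q < length bs" "\<bar>x\<bar> = bs ! p" "\<bar>y\<bar> = bs ! q"
    using xy by (metis in_set_conv_nth)
  show ?thesis
  proof (cases "(0 \<le> x) = (0 \<le> y)")
    case True
    then have "signed_swap x y = signed_swap (bs ! p) (bs ! q)"
      using pq(3,4) signed_swap_uminus[of x y] by (auto simp: abs_if split: if_splits)
    moreover have "p \<noteq> q" using True pq(3,4) xy(1) by (auto simp: abs_if split: if_splits)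
    ultimately show ?thesis using same[of p q] same[of q p] pq(1,2)
      by (metis linorder_neqE_nat signed_swap_commute)
  next
    case False
    then have "(x = - (bs ! p) \<and> y = bs ! q) \<or> (- x = - (bs ! p) \<and> - y = bs ! q)"
      using pq(3,4) by (auto simp: abs_if split: if_splits)
    then have "signed_swap x y = signed_swap (- (bs ! p)) (bs ! q)"
      using signed_swap_uminus[of x y] by auto
    moreover have "signed_swap (- (bs ! p)) (bs ! q) = signed_swap (- (bs ! q)) (bs ! p)"
      by (metis minus_minus signed_swap_commute signed_swap_uminus)
    ultimately show ?thesis using opposite[of p q] opposite[of q p] pq(1,2)
      by (metis linorder_le_cases)
  qed
qed

lemma pos_reflection_pair:
  assumes "(d, i) \<in> pos_splits w" "distinct w"
  shows "\<exists>x y. pos_reflection w d i = signed_swap x y \<and> x \<noteq> y \<and> x \<in> set w \<and> y \<in> set w"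
proof -
  have "w ! i \<noteq> w ! (i + d)" "w ! i \<in> set w" "w ! (i + d) \<in> set w"
    using assms by (auto simp: pos_splits_def nth_eq_iff_index_eq)
  then show ?thesis unfolding pos_reflection_def by blast
qed

lemma pos_reflection_surj:
  assumes xy: "x \<noteq> y" "x \<in> set w" "y \<in> set w"
  shows "signed_swap x y \<in> (\<lambda>(d, i). pos_reflection w d i) ` pos_splits w"
proof -
  have less: "signed_swap (w ! p) (w ! q) \<in> (\<lambda>(d, i). pos_reflection w d i) ` pos_splits w"
    if "p < q" "q < length w" for p q
    using that by (intro image_eqI[of _ _ "(q - p, p)"]) (auto simp: pos_reflection_def pos_splits_def)
  obtain p q where "p < length w" "q < length w" "x = w ! p" "y = w ! q"
    using xy by (metis in_set_conv_nth)
  then show ?thesis using less[of p q] less[of q p] xy(1)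
    by (metis linorder_neqE_nat signed_swap_commute)
qed

text \<open>
  A reflection that does not split a cycle leads to an element that is not a product of the
  remaining number of reflections, so no chain continues there.
\<close>

lemma sum_reflections_splits:
  fixes X :: "(int \<Rightarrow> int) \<Rightarrow> nat"
  assumes f: "cycle_form n \<omega> bs As" and len: "Suc (length R) + length As = n"
    and X: "\<And>t. X t \<noteq> 0 \<Longrightarrow> lower_chains n R (\<omega> \<circ> t) \<noteq> {}"
  shows "(\<Sum>t\<in>reflections n. X t) =
    (\<Sum>(d, j)\<in>neg_splits bs. X (neg_reflection bs d j)) +
    (\<Sum>k<length As. \<Sum>(d, i)\<in>pos_splits (As ! k). X (pos_reflection (As ! k) d i))"
proof -
  let ?B = "(\<lambda>(d, j). neg_reflection bs d j) ` neg_splits bs"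
  let ?A = "\<lambda>k. (\<lambda>(d, i). pos_reflection (As ! k) d i) ` pos_splits (As ! k)"
  have dist: "distinct (map abs (bs @ concat As))" using cycle_form_distinct[OF f] .
  have pos: "\<forall>b\<in>set bs. 0 < b" using f by (simp add: cycle_form_def)
  have absbs: "abs ` set bs = set bs" using pos by force
  have dbs: "distinct bs" using dist by (simp add: distinct_map)
  have disj_BA: "abs ` set bs \<inter> abs ` set (As ! k) = {}" if "k < length As" for k
  proof -
    have "set (As ! k) \<subseteq> set (concat As)" using nth_mem[OF that] by auto
    moreover have "abs ` set bs \<inter> abs ` set (concat As) = {}" using dist by auto
    ultimately show ?thesis by blast
  qed
  have disj_AA: "abs ` set (As ! k) \<inter> abs ` set (As ! l) = {}" if "k < l" "l < length As" for k l
  proof -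
    have "As = take k As @ As ! k # take (l - Suc k) (drop (Suc k) As) @ As ! l # drop (Suc l) As"
      using split_at_two[OF that] .
    then obtain P Q S where "As = P @ As ! k # Q @ As ! l # S" by blast
    then have "distinct (map abs (concat (P @ As ! k # Q @ As ! l # S)))" using dist by simp
    then show ?thesis by auto
  qed
  have dw: "distinct (map abs w)" if "w \<in> set As" for w
  proof -
    obtain P Q where "As = P @ w # Q" using \<open>w \<in> set As\<close> by (auto simp: in_set_conv_decomp)
    then show ?thesis using dist by simp
  qed
  have ptsB: "x \<in> signed_points n" if "\<bar>x\<bar> \<in> set bs" for x
    using cycle_form_neg_word(1)[OF f that] by (simp add: signed_points_abs)
  have ptsA: "x \<in> signed_points n" if "x \<in> set w" "w \<in> set As" for x w
    using cycle_form_word[OF f that(2,1)] .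
  have Bpair: "\<exists>x y. t = signed_swap x y \<and> x \<noteq> y \<and> \<bar>x\<bar> \<in> set bs \<and> \<bar>y\<bar> \<in> set bs" if "t \<in> ?B" for t
    using that neg_reflection_pair[OF pos _ dbs] by auto
  have Apair: "\<exists>x y. t = signed_swap x y \<and> x \<noteq> y \<and> x \<in> set (As ! k) \<and> y \<in> set (As ! k)"
    if "t \<in> ?A k" "k < length As" for t k
  proof -
    have "distinct (As ! k)" using dw[of "As ! k"] that(2) by (simp add: distinct_map)
    then show ?thesis using that pos_reflection_pair by auto
  qed
  have sub: "?B \<union> (\<Union>k<length As. ?A k) \<subseteq> reflections n"
  proof
    fix t assume "t \<in> ?B \<union> (\<Union>k<length As. ?A k)"
    then obtain x y where "t = signed_swap x y" "x \<noteq> y" "x \<in> signed_points n" "y \<in> signed_points n"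
      using Bpair Apair ptsB ptsA by (metis (no_types, lifting) UN_E UnE lessThan_iff nth_mem)
    then show "t \<in> reflections n" by (auto simp: reflections_eq)
  qed
  have meet: "\<bar>x'\<bar> = \<bar>x\<bar> \<or> \<bar>x'\<bar> = \<bar>y\<bar>" if "signed_swap x y = signed_swap x' y'" "x \<noteq> y" "x' \<noteq> y'"
    "x \<in> signed_points n" "y \<in> signed_points n" "x' \<in> signed_points n" "y' \<in> signed_points n" for x y x' y'
  proof -
    have "{x', y'} = {x, y} \<or> {x', y'} = {- x, - y}"
      using that by (simp add: signed_swap_eq_iff signed_points_nonzero)
    then show ?thesis by (auto simp: doubleton_eq_iff)
  qed
  have BA: "?B \<inter> ?A k = {}" if k: "k < length As" for k
  proof (rule ccontr)
    assume "?B \<inter> ?A k \<noteq> {}"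
    then obtain t where t: "t \<in> ?B" "t \<in> ?A k" by blast
    obtain x y where xy: "t = signed_swap x y" "x \<noteq> y" "\<bar>x\<bar> \<in> set bs" "\<bar>y\<bar> \<in> set bs"
      using Bpair[OF t(1)] by blast
    obtain x' y' where xy': "t = signed_swap x' y'" "x' \<noteq> y'" "x' \<in> set (As ! k)" "y' \<in> set (As ! k)"
      using Apair[OF t(2) k] by blast
    have "\<bar>x'\<bar> = \<bar>x\<bar> \<or> \<bar>x'\<bar> = \<bar>y\<bar>"
      using xy xy' k by (intro meet) (auto intro: ptsA ptsB)
    then have "\<bar>x'\<bar> \<in> abs ` set bs" using xy absbs by auto
    then show False using disj_BA[OF k] xy'(3) by blast
  qed
  have AA: "?A k \<inter> ?A l = {}" if kl: "k < l" "l < length As" for k l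
  proof (rule ccontr)
    assume "?A k \<inter> ?A l \<noteq> {}"
    then obtain t where t: "t \<in> ?A k" "t \<in> ?A l" by blast
    have k: "k < length As" using kl by simp
    obtain x y where xy: "t = signed_swap x y" "x \<noteq> y" "x \<in> set (As ! k)" "y \<in> set (As ! k)"
      using Apair[OF t(1) k] by blast
    obtain x' y' where xy': "t = signed_swap x' y'" "x' \<noteq> y'" "x' \<in> set (As ! l)" "y' \<in> set (As ! l)"
      using Apair[OF t(2) kl(2)] by blast
    have "\<bar>x'\<bar> = \<bar>x\<bar> \<or> \<bar>x'\<bar> = \<bar>y\<bar>"
      using xy xy' k kl by (intro meet) (auto intro: ptsA)
    then have "\<bar>x'\<bar> \<in> abs ` set (As ! k)" using xy by auto
    then show False using disj_AA[OF kl] xy'(3) by blast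
  qed
  have zero: "X t = 0" if t: "t \<in> reflections n" "t \<notin> ?B \<union> (\<Union>k<length As. ?A k)" for t
  proof (rule ccontr)
    assume "X t \<noteq> 0"
    then obtain ts where ts: "set ts \<subseteq> reflections n" "length ts = length R" "word_product ts = \<omega> \<circ> t"
      using X lower_chains_factorization by blast
    obtain x y where xy: "t = signed_swap x y" "x \<in> signed_points n" "y \<in> signed_points n" "x \<noteq> y"
      using t(1) by (auto simp: reflections_eq)
    have prod: "word_product (ts @ [t]) = \<omega>"
      by (simp only: word_product_append ts(3)) (simp add: xy(1))
    have keep: "(x \<in> set w \<longleftrightarrow> y \<in> set w) \<and> (- x \<in> set w \<longleftrightarrow> - y \<in> set w)" if "w \<in> set As" for w
      using reflection_preserves_cycles[OF f _ prod, of x y w] ts len t(1) xy that by auto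
    have covered: "\<bar>z\<bar> \<in> set bs \<or> (\<exists>w\<in>set As. z \<in> set w \<or> - z \<in> set w)" if "z \<in> signed_points n" for z
    proof -
      have "\<bar>z\<bar> \<in> abs ` (set bs \<union> set (concat As))"
        using cycle_form_points[OF f] that by (simp add: signed_points_abs)
      then obtain u where "u \<in> set bs \<union> set (concat As)" "\<bar>z\<bar> = \<bar>u\<bar>" by blast
      then have zu: "z = u \<or> - z = u" by linarith
      have "\<bar>z\<bar> \<in> set bs" if "u \<in> set bs"
      proof -
        have "\<bar>z\<bar> = u" using pos that \<open>\<bar>z\<bar> = \<bar>u\<bar>\<close> by auto
        then show ?thesis using that by simp
      qed
      moreover have "\<exists>w\<in>set As. u \<in> set w" if "u \<notin> set bs"
        using that \<open>u \<in> set bs \<union> set (concat As)\<close> by auto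
      ultimately show ?thesis using zu by blast
    qed
    have "\<bar>x\<bar> \<in> set bs \<or> (\<exists>w\<in>set As. x \<in> set w \<or> - x \<in> set w)" using covered xy(2) .
    moreover have "t \<in> (\<Union>k<length As. ?A k)" if "w \<in> set As" "x \<in> set w \<or> - x \<in> set w" for w
    proof -
      obtain k where k: "k < length As" "w = As ! k" using \<open>w \<in> set As\<close> by (metis in_set_conv_nth)
      have "t \<in> ?A k"
      proof (cases "x \<in> set w")
        case True
        then show ?thesis using keep[OF that(1)] pos_reflection_surj[OF xy(4)] k xy(1) by blast
      next
        case False
        then have "- x \<in> set w" "- y \<in> set w" using keep[OF that(1)] that(2) by auto
        then have "signed_swap (- x) (- y) \<in> ?A k" using pos_reflection_surj[of "- x" "- y"] xy(4) k by simp
        then show ?thesis using xy(1) by (simp add: signed_swap_uminus)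
      qed
      then show ?thesis using k by blast
    qed
    ultimately have xb: "\<bar>x\<bar> \<in> set bs" using t(2) by blast
    have "\<bar>y\<bar> \<in> set bs \<or> (\<exists>w\<in>set As. y \<in> set w \<or> - y \<in> set w)" using covered xy(3) .
    moreover have False if "w \<in> set As" "y \<in> set w \<or> - y \<in> set w" for w
    proof -
      obtain k where k: "k < length As" "w = As ! k" using \<open>w \<in> set As\<close> by (metis in_set_conv_nth)
      have "x \<in> set w \<or> - x \<in> set w" using keep[OF that(1)] that(2) by blast
      then have "\<bar>x\<bar> \<in> abs ` set w" by (metis abs_minus_cancel image_eqI)
      then show False using disj_BA[OF k(1)] xb absbs k(2) by blast
    qed
    ultimately have "\<bar>y\<bar> \<in> set bs" by blast
    then have "t \<in> ?B" using neg_reflection_surj[OF pos xy(4) xb] xy(1) by blast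
    then show False using t(2) by blast
  qed
  have fin: "finite (neg_splits bs)" "finite (pos_splits w)" for w
    by (simp_all add: neg_splits_def pos_splits_def)
  have "(\<Sum>t\<in>reflections n. X t) = (\<Sum>t\<in>?B \<union> (\<Union>k<length As. ?A k). X t)"
    using sub zero by (intro sum.mono_neutral_right) auto
  also have "\<dots> = (\<Sum>t\<in>?B. X t) + (\<Sum>t\<in>(\<Union>k<length As. ?A k). X t)"
    using BA fin by (intro sum.union_disjoint) blast+
  also have "(\<Sum>t\<in>(\<Union>k<length As. ?A k). X t) = (\<Sum>k<length As. \<Sum>t\<in>?A k. X t)"
  proof (rule sum.UNION_disjoint)
    show "\<forall>k\<in>{..<length As}. \<forall>l\<in>{..<length As}. k \<noteq> l \<longrightarrow> ?A k \<inter> ?A l = {}"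
      using AA by (metis Int_commute lessThan_iff linorder_neqE_nat)
  qed (use fin in auto)
  also have "(\<Sum>t\<in>?B. X t) = (\<Sum>(d, j)\<in>neg_splits bs. X (neg_reflection bs d j))"
    by (subst sum.reindex[OF inj_on_neg_reflection[OF f]]) (auto simp: case_prod_unfold intro!: sum.cong)
  also have "(\<Sum>k<length As. \<Sum>t\<in>?A k. X t) =
    (\<Sum>k<length As. \<Sum>(d, i)\<in>pos_splits (As ! k). X (pos_reflection (As ! k) d i))"
  proof (rule sum.cong[OF refl])
    fix k assume "k \<in> {..<length As}"
    then have "As ! k \<in> set As" by simp
    then have "inj_on (\<lambda>(d, i). pos_reflection (As ! k) d i) (pos_splits (As ! k))"
      using dw ptsA by (intro inj_on_pos_reflection) (auto dest: signed_points_nonzero)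
    then show "(\<Sum>t\<in>?A k. X t) = (\<Sum>(d, i)\<in>pos_splits (As ! k). X (pos_reflection (As ! k) d i))"
      by (subst sum.reindex) (auto simp: case_prod_unfold intro!: sum.cong)
  qed
  finally show ?thesis .
qed

lemma card_lower_chains:
  assumes n: "1 \<le> n"
  shows "cycle_form n \<omega> bs As \<Longrightarrow> length R + length As = n \<Longrightarrow>
    card (lower_chains n R \<omega>) = split_count R (length bs) (map length As)"
proof (induction R arbitrary: \<omega> bs As)
  case Nil
  note f = Nil.prems(1)
  have "length (bs @ concat As) = n"
    using f by (metis (no_types, lifting) cycle_form_def length_map size_mset length_upto diff_add_cancel nat_int)
  then have len: "length bs + sum_list (map length As) = length As"
    using Nil.prems(2) by (simp add: length_concat)
  have ne: "1 \<le> length w" if "w \<in> set As" for w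
    using f that by (cases w) (auto simp: cycle_form_def is_cycle_def)
  then have "length As \<le> sum_list (map length As)"
    using sum_list_mono[of As "\<lambda>_. 1" length] by (simp add: sum_list_triv)
  then have "length bs = 0" and eq: "sum_list (map length As) = length As" using len by linarith+
  then have "bs = []" by simp
  have one: "length w = 1" if w: "w \<in> set As" for w
  proof (rule ccontr)
    assume "length w \<noteq> 1"
    then have "2 \<le> length w" using ne[OF w] by linarith
    obtain P Q where As: "As = P @ w # Q" using w by (auto simp: in_set_conv_decomp)
    have "length P \<le> sum_list (map length P)" "length Q \<le> sum_list (map length Q)"
      using ne As sum_list_mono[of P "\<lambda>_. 1" length] sum_list_mono[of Q "\<lambda>_. 1" length]
      by (auto simp: sum_list_triv)
    then show False using eq As \<open>2 \<le> length w\<close> by simp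
  qed
  note h = cycle_form_hyperoctahedral[OF f]
  have "\<omega> x = x" for x
  proof (cases "x \<in> signed_points n")
    case True
    then have "\<bar>x\<bar> \<in> abs ` set (concat As)"
      using cycle_form_points[OF f] \<open>bs = []\<close> by (simp add: signed_points_abs)
    then obtain y w where y: "w \<in> set As" "y \<in> set w" "\<bar>x\<bar> = \<bar>y\<bar>" by auto
    obtain z where "w = [z]" using one[OF y(1)] by (metis One_nat_def length_0_conv length_Suc_conv)
    then have "w = [y]" using y(2) by simp
    then have "\<omega> y = y" using f y(1) by (auto simp: cycle_form_def is_cycle_def)
    then show ?thesis using y(3) hyperoctahedral_odd[OF h, of y] by (auto simp: abs_if split: if_splits)
  next
    case False
    then show ?thesis using h by (auto simp: hyperoctahedral_iff permutes_def)
  qed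
  then have "\<omega> = id" by auto
  then have "lower_chains n [] \<omega> = {[id]}" unfolding lower_chains.simps by (rule if_P)
  then show ?case by (simp only: split_count.simps) simp
next
  case (Cons r R)
  note f = Cons.prems(1)
  let ?X = "\<lambda>t. if bruhat_less n \<omega> (\<omega> \<circ> t) = r then card (lower_chains n R (\<omega> \<circ> t)) else 0"
  have len: "Suc (length R) + length As = n" using Cons.prems(2) by simp
  have "card (lower_chains n (r # R) \<omega>) = (\<Sum>t\<in>reflections n. ?X t)"
    unfolding card_lower_chains_Cons[OF cycle_form_hyperoctahedral[OF f]] down_steps_def
    by (simp add: sum.inter_filter)
  also have "\<dots> = (\<Sum>(d, j)\<in>neg_splits bs. ?X (neg_reflection bs d j)) +
    (\<Sum>k<length As. \<Sum>(d, i)\<in>pos_splits (As ! k). ?X (pos_reflection (As ! k) d i))"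
    by (rule sum_reflections_splits[OF f len]) (auto split: if_splits)
  also have "(\<Sum>(d, j)\<in>neg_splits bs. ?X (neg_reflection bs d j)) =
    (\<Sum>d=1..length bs. \<Sum>j<length bs. ?X (neg_reflection bs d j))"
    unfolding neg_splits_def by (rule sum.cartesian_product[symmetric])
  also have "\<dots> = (\<Sum>d=1..length bs. weight r (length bs) * split_count R (length bs - d) (d # map length As))"
  proof (rule sum.cong[OF refl])
    fix d assume d: "d \<in> {1..length bs}"
    let ?c = "split_count R (length bs - d) (d # map length As)"
    have "?X (neg_reflection bs d j) = (if (j \<noteq> length bs - 1) = r then ?c else 0)" if j: "j < length bs" for j
    proof -
      obtain bs' w where w: "cycle_form n (\<omega> \<circ> neg_reflection bs d j) bs' (w # As)"
        "length bs' = length bs - d" "length w = d"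
        using neg_split[OF f _ _ j] d by (metis atLeastAtMost_iff)
      have "card (lower_chains n R (\<omega> \<circ> neg_reflection bs d j)) = ?c"
        using Cons.IH[OF w(1)] w(2,3) len by (simp add: comp_def)
      then show ?thesis using neg_reflection_bad_iff[OF n f _ _ j, of d] d by simp
    qed
    then have "(\<Sum>j<length bs. ?X (neg_reflection bs d j)) =
      (\<Sum>j<length bs. if (j \<noteq> length bs - 1) = r then ?c else 0)" by (intro sum.cong) auto
    also have "{j \<in> {..<length bs}. \<not> j \<noteq> length bs - 1} = {length bs - 1}" using d by auto
    then have "card {j \<in> {..<length bs}. \<not> j \<noteq> length bs - 1} = 1" by simp
    then have "(\<Sum>j<length bs. if (j \<noteq> length bs - 1) = r then ?c else 0) = weight r (length bs) * ?c"
      using sum_one_exception[of "{..<length bs}" "\<lambda>j. j \<noteq> length bs - 1" r ?c] by simp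
    finally show "(\<Sum>j<length bs. ?X (neg_reflection bs d j)) = weight r (length bs) * ?c" .
  qed
  also have "(\<Sum>k<length As. \<Sum>(d, i)\<in>pos_splits (As ! k). ?X (pos_reflection (As ! k) d i)) =
    (\<Sum>k<length (map length As). \<Sum>d=1..<map length As ! k. weight r (map length As ! k - d) *
        split_count R (length bs)
          (take k (map length As) @ [d, map length As ! k - d] @ drop (Suc k) (map length As)))"
  proof (rule sum.cong)
    fix k assume "k \<in> {..<length (map length As)}"
    then have k: "k < length As" by simp
    let ?w = "As ! k"
    have "(\<Sum>(d, i)\<in>pos_splits ?w. ?X (pos_reflection ?w d i)) =
      (\<Sum>d=1..<length ?w. \<Sum>i<length ?w - d. ?X (pos_reflection ?w d i))"
      unfolding pos_splits_def by (rule sum.Sigma[symmetric]) auto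
    also have "\<dots> = (\<Sum>d=1..<length ?w. weight r (length ?w - d) *
        split_count R (length bs) (take k (map length As) @ [d, length ?w - d] @ drop (Suc k) (map length As)))"
    proof (rule sum.cong[OF refl])
      fix d assume d: "d \<in> {1..<length ?w}"
      let ?c = "split_count R (length bs) (take k (map length As) @ [d, length ?w - d] @ drop (Suc k) (map length As))"
      let ?I = "{..<length ?w - d}"
      have c: "card (lower_chains n R (\<omega> \<circ> pos_reflection ?w d i)) = ?c" if i: "i \<in> ?I" for i
      proof -
        have "1 \<le> d" "i + d < length ?w" using i d by auto
        obtain u v where uv: "cycle_form n (\<omega> \<circ> pos_reflection ?w d i) bs (take k As @ [u, v] @ drop (Suc k) As)"
          "length u = d" "length v = length ?w - d"
          using pos_split[OF f k] \<open>1 \<le> d\<close> \<open>i + d < length ?w\<close> by blast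
        have "length R + length (take k As @ [u, v] @ drop (Suc k) As) = n" using len k by simp
        then show ?thesis using Cons.IH[OF uv(1)] uv(2,3) by (simp add: take_map drop_map comp_def)
      qed
      have "card {i \<in> ?I. \<not> bruhat_less n \<omega> (\<omega> \<circ> pos_reflection ?w d i)} = 1"
        using card_good_pos_reflections[OF n f nth_mem[OF k], of d] d by simp
      then have "(\<Sum>i\<in>?I. if bruhat_less n \<omega> (\<omega> \<circ> pos_reflection ?w d i) = r then ?c else 0) =
        weight r (card ?I) * ?c" by (intro sum_one_exception) auto
      moreover have "(\<Sum>i\<in>?I. ?X (pos_reflection ?w d i)) =
        (\<Sum>i\<in>?I. if bruhat_less n \<omega> (\<omega> \<circ> pos_reflection ?w d i) = r then ?c else 0)"
        using c by (intro sum.cong) auto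
      ultimately show "(\<Sum>i<length ?w - d. ?X (pos_reflection ?w d i)) = weight r (length ?w - d) * ?c" by simp
    qed
    finally show "(\<Sum>(d, i)\<in>pos_splits ?w. ?X (pos_reflection ?w d i)) =
      (\<Sum>d=1..<map length As ! k. weight r (map length As ! k - d) *
        split_count R (length bs)
          (take k (map length As) @ [d, map length As ! k - d] @ drop (Suc k) (map length As)))"
      using k by simp
  qed simp
  finally show ?case by simp
qed

section \<open>Summation over cycle types\<close>

definition cycle_types :: "nat \<Rightarrow> nat \<Rightarrow> (nat \<times> nat list) set" where
  "cycle_types k N = {(b, ms). length ms = k \<and> (\<forall>m\<in>set ms. 1 \<le> m) \<and> b + sum_list ms = N}"

text \<open>
  The number of points is determined by the number \<open>k\<close> of opposite pairs, since every step of the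
  pattern splits off one more pair and \<open>n\<close> pairs of fixed points are reached in the end.
\<close>
definition total_split_count :: "nat \<Rightarrow> bool list \<Rightarrow> nat" where
  "total_split_count k R = (\<Sum>(b, ms)\<in>cycle_types k (length R + k). split_count R b ms)"

lemma finite_cycle_types: "finite (cycle_types k N)"
proof -
  have "cycle_types k N \<subseteq> {..N} \<times> {ms. set ms \<subseteq> {..N} \<and> length ms = k}"
    by (auto simp: cycle_types_def dest: member_le_sum_list)
  then show ?thesis by (rule finite_subset) (simp add: finite_lists_length_eq)
qed

lemma cycle_types_minimal: "cycle_types k k = {(0, replicate k 1)}"
proof -
  have ge: "length ms \<le> sum_list ms" if "\<forall>m\<in>set ms. 1 \<le> m" for ms :: "nat list"
    using that by (induction ms) auto
  have ones: "ms = replicate (length ms) 1" if "\<forall>m\<in>set ms. 1 \<le> m" "sum_list ms = length ms" for ms :: "nat list"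
    using that
  proof (induction ms)
    case (Cons m ms)
    then have "m = 1 \<and> sum_list ms = length ms" using ge[of ms] by fastforce
    then show ?case using Cons by simp
  qed simp
  show ?thesis
  proof (intro equalityI subsetI)
    fix x assume "x \<in> cycle_types k k"
    then obtain b ms where x: "x = (b, ms)" "length ms = k" "\<forall>m\<in>set ms. 1 \<le> m" "b + sum_list ms = k"
      by (auto simp: cycle_types_def)
    then have "b = 0" "sum_list ms = k" using ge[of ms] by auto
    then show "x \<in> {(0, replicate k 1)}" using x ones[of ms] by simp
  qed (auto simp: cycle_types_def sum_list_replicate)
qed

lemma sum_neg_splits_types:
  "(\<Sum>(b, ms)\<in>cycle_types k N. \<Sum>d=1..b. h b (b - d) (d # ms)) =
   (\<Sum>(b, ms)\<in>cycle_types (Suc k) N. h (b + ms ! 0) b ms)"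
proof -
  have "(\<Sum>(b, ms)\<in>cycle_types k N. \<Sum>d=1..b. h b (b - d) (d # ms)) =
    (\<Sum>((b, ms), d)\<in>(SIGMA (b, ms):cycle_types k N. {1..b}). h b (b - d) (d # ms))"
    using finite_cycle_types by (simp add: sum.Sigma case_prod_unfold)
  also have "\<dots> = (\<Sum>(b, ms)\<in>cycle_types (Suc k) N. h (b + ms ! 0) b ms)"
    by (rule sum.reindex_bij_witness[of _ "\<lambda>(b, ms). ((b + hd ms, tl ms), hd ms)" "\<lambda>((b, ms), d). (b - d, d # ms)"])
      (auto simp: cycle_types_def length_Suc_conv)
  finally show ?thesis .
qed

text \<open>
  Splitting the \<open>q\<close>-th part is inverse to merging the parts at \<open>q\<close> and \<open>q + 1\<close>, when the length of
  the first part is remembered.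
\<close>
lemma sum_pos_splits_types:
  assumes q: "q < k"
  shows "(\<Sum>(b, ms)\<in>cycle_types k N. \<Sum>d=1..<ms ! q. h (ms ! q - d) b (take q ms @ [d, ms ! q - d] @ drop (Suc q) ms)) =
   (\<Sum>(b, ms)\<in>cycle_types (Suc k) N. h (ms ! Suc q) b ms)"
proof -
  let ?split = "\<lambda>((b, ms), d). (b, take q ms @ [d, ms ! q - d] @ drop (Suc q) ms) :: nat \<times> nat list"
  let ?merge = "\<lambda>(b, ms). ((b, take q ms @ [ms ! q + ms ! Suc q] @ drop (Suc (Suc q)) ms), ms ! q) :: (nat \<times> nat list) \<times> nat"
  let ?S = "SIGMA (b, ms):cycle_types k N. {1..<ms ! q}"
  have dec: "\<exists>P x S. ms = P @ x # S \<and> length P = q" if "length ms = k" for ms :: "nat list"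
    using that q by (intro exI[of _ "take q ms"] exI[of _ "ms ! q"] exI[of _ "drop (Suc q) ms"])
      (simp add: id_take_nth_drop[symmetric])
  have dec2: "\<exists>P x y S. ms = P @ x # y # S \<and> length P = q" if "length ms = Suc k" for ms :: "nat list"
    using that q by (intro exI[of _ "take q ms"] exI[of _ "ms ! q"] exI[of _ "ms ! Suc q"] exI[of _ "drop (Suc (Suc q)) ms"])
      (simp add: Cons_nth_drop_Suc)
  have "(\<Sum>(b, ms)\<in>cycle_types k N. \<Sum>d=1..<ms ! q. h (ms ! q - d) b (take q ms @ [d, ms ! q - d] @ drop (Suc q) ms)) =
    (\<Sum>((b, ms), d)\<in>?S. h (ms ! q - d) b (take q ms @ [d, ms ! q - d] @ drop (Suc q) ms))"
    using finite_cycle_types by (simp add: sum.Sigma case_prod_unfold)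
  also have "\<dots> = (\<Sum>(b, ms)\<in>cycle_types (Suc k) N. h (ms ! Suc q) b ms)"
  proof (rule sum.reindex_bij_witness[of _ ?merge ?split], goal_cases)
    case (1 a)
    then obtain b ms d where a: "a = ((b, ms), d)" "(b, ms) \<in> cycle_types k N" "1 \<le> d" "d < ms ! q" by auto
    then obtain P x S where ms: "ms = P @ x # S" "length P = q" using dec[of ms] by (auto simp: cycle_types_def)
    then show ?case using a by (auto simp: nth_append)
  next
    case (2 a)
    then obtain b ms d where a: "a = ((b, ms), d)" "(b, ms) \<in> cycle_types k N" "1 \<le> d" "d < ms ! q" by auto
    then obtain P x S where ms: "ms = P @ x # S" "length P = q" using dec[of ms] by (auto simp: cycle_types_def)
    then show ?case using a by (auto simp: cycle_types_def nth_append)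
  next
    case (3 a)
    then obtain b ms where a: "a = (b, ms)" "(b, ms) \<in> cycle_types (Suc k) N" by (cases a) auto
    then obtain P x y S where ms: "ms = P @ x # y # S" "length P = q" using dec2[of ms] by (auto simp: cycle_types_def)
    then show ?case using a by (auto simp: nth_append)
  next
    case (4 a)
    then obtain b ms where a: "a = (b, ms)" "(b, ms) \<in> cycle_types (Suc k) N" by (cases a) auto
    then obtain P x y S where ms: "ms = P @ x # y # S" "length P = q" using dec2[of ms] by (auto simp: cycle_types_def)
    then show ?case using a by (auto simp: cycle_types_def nth_append)
  next
    case (5 a)
    then obtain b ms d where a: "a = ((b, ms), d)" "(b, ms) \<in> cycle_types k N" "1 \<le> d" "d < ms ! q" by auto
    then obtain P x S where ms: "ms = P @ x # S" "length P = q" using dec[of ms] by (auto simp: cycle_types_def)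
    then show ?case using a by (auto simp: nth_append)
  qed
  finally show ?thesis .
qed

text \<open>
  Exchange the summations over a type and its splittings: each type with \<open>k + 1\<close> pairs is reached
  by splitting the type in which two consecutive entries are merged, which is possible in \<open>k + 1\<close>
  ways.  Each way is realized by one good splitting.  It is realized by \<open>b + m\<^sub>1 - 1\<close> bad ones if
  the merged entries are \<open>b\<close> and \<open>m\<^sub>1\<close>, and by \<open>m - 1\<close> if the second one is \<open>m\<close>, which makes
  \<open>b + m\<^sub>1 + \<dots> - (k + 1)\<close> in total, the same number for all types.
\<close>

lemma total_split_count_Cons:
  "total_split_count k (r # R) = (if r then length R else k + 1) * total_split_count (Suc k) R"
proof -
  let ?N = "length R + Suc k"
  let ?G = "split_count R"
  have "total_split_count k (r # R) =
    (\<Sum>(b, ms)\<in>cycle_types k ?N. \<Sum>d=1..b. weight r b * ?G (b - d) (d # ms)) +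
    (\<Sum>(b, ms)\<in>cycle_types k ?N. \<Sum>q<k. \<Sum>d=1..<ms ! q. weight r (ms ! q - d) *
        ?G b (take q ms @ [d, ms ! q - d] @ drop (Suc q) ms))"
    unfolding total_split_count_def sum.distrib[symmetric]
    by (intro sum.cong) (auto simp: cycle_types_def)
  also have "(\<Sum>(b, ms)\<in>cycle_types k ?N. \<Sum>d=1..b. weight r b * ?G (b - d) (d # ms)) =
    (\<Sum>(b, ms)\<in>cycle_types (Suc k) ?N. weight r (b + ms ! 0) * ?G b ms)"
    by (rule sum_neg_splits_types)
  also have "(\<Sum>(b, ms)\<in>cycle_types k ?N. \<Sum>q<k. \<Sum>d=1..<ms ! q. weight r (ms ! q - d) *
        ?G b (take q ms @ [d, ms ! q - d] @ drop (Suc q) ms)) =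
    (\<Sum>q<k. \<Sum>(b, ms)\<in>cycle_types k ?N. \<Sum>d=1..<ms ! q. weight r (ms ! q - d) *
        ?G b (take q ms @ [d, ms ! q - d] @ drop (Suc q) ms))"
    unfolding case_prod_unfold by (rule sum.swap)
  also have "\<dots> = (\<Sum>q<k. \<Sum>(b, ms)\<in>cycle_types (Suc k) ?N. weight r (ms ! Suc q) * ?G b ms)"
    by (intro sum.cong refl sum_pos_splits_types) simp
  also have "\<dots> = (\<Sum>(b, ms)\<in>cycle_types (Suc k) ?N. \<Sum>q<k. weight r (ms ! Suc q) * ?G b ms)"
    unfolding case_prod_unfold by (rule sum.swap)
  also have "(\<Sum>(b, ms)\<in>cycle_types (Suc k) ?N. weight r (b + ms ! 0) * ?G b ms) + \<dots> =
    (\<Sum>(b, ms)\<in>cycle_types (Suc k) ?N. (if r then length R else k + 1) * ?G b ms)"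
    unfolding sum.distrib[symmetric]
  proof (intro sum.cong refl)
    fix a assume "a \<in> cycle_types (Suc k) ?N"
    then obtain b m ms where a: "a = (b, m # ms)" "length ms = k" "1 \<le> m" "\<forall>m\<in>set ms. 1 \<le> m"
      "b + m + sum_list ms = ?N" by (auto simp: cycle_types_def length_Suc_conv)
    have "(\<Sum>q<k. ms ! q - 1) + k = (\<Sum>q<k. (ms ! q - 1) + 1)"
      by (subst sum.distrib) simp
    also have "\<dots> = (\<Sum>q<k. ms ! q)"
    proof (intro sum.cong refl)
      fix q assume "q \<in> {..<k}"
      then have "1 \<le> ms ! q" using a(2,4) nth_mem by auto
      then show "ms ! q - 1 + 1 = ms ! q" by simp
    qed
    also have "\<dots> = sum_list ms" using a(2) by (simp add: sum_list_sum_nth atLeast0LessThan)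
    finally have "weight r (b + m) + (\<Sum>q<k. weight r (ms ! q)) = (if r then length R else k + 1)"
      using a by (auto simp: weight_def)
    then show "(case a of (b, ms) \<Rightarrow> weight r (b + ms ! 0) * ?G b ms) +
      (case a of (b, ms) \<Rightarrow> \<Sum>q<k. weight r (ms ! Suc q) * ?G b ms) =
      (case a of (b, ms) \<Rightarrow> (if r then length R else k + 1) * ?G b ms)"
      using a(1) by (simp add: sum_distrib_right[symmetric] add_mult_distrib[symmetric])
  qed
  finally show ?thesis by (simp add: total_split_count_def sum_distrib_left case_prod_unfold)
qed

section \<open>Counting parking functions by their reluctant cars\<close>

text \<open>
  The number of preference lists with the given pattern of reluctant cars when \<open>q\<close> of the \<open>n\<close>
  spaces are occupied at the beginning.
\<close>
fun pattern_count :: "nat \<Rightarrow> nat \<Rightarrow> bool list \<Rightarrow> nat" where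
  "pattern_count n q [] = 1"
| "pattern_count n q (r # R) = (if r then q else n - q) * pattern_count n (Suc q) R"

lemma pattern_count_snoc:
  "pattern_count n q (R @ [r]) = pattern_count n q R * (if r then q + length R else n - (q + length R))"
  by (induction R arbitrary: q) auto

lemma total_split_count_rev:
  "k + length R = n \<Longrightarrow> total_split_count k (rev R) = pattern_count n 0 R"
proof (induction R arbitrary: k rule: rev_induct)
  case Nil
  then show ?case by (simp add: total_split_count_def cycle_types_minimal[unfolded One_nat_def])
next
  case (snoc r R)
  have "n - length R = k + 1" using snoc.prems by simp
  then show ?case using snoc by (simp add: total_split_count_Cons pattern_count_snoc)
qed

lemma split_count_rev:
  assumes "length R = n" shows "split_count (rev R) n [] = pattern_count n 0 R"
proof -
  have "cycle_types 0 n = {(n, [])}" by (auto simp: cycle_types_def)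
  then have "total_split_count 0 (rev R) = split_count (rev R) n []"
    using assms by (simp add: total_split_count_def)
  then show ?thesis using total_split_count_rev[of 0 R n] assms by simp
qed

lemma next_free:
  assumes "Occ \<subset> {1..n}" "a \<in> {1..n}"
  shows "next_free n Occ a \<in> {1..n} - Occ" "next_free n Occ a = a \<longleftrightarrow> a \<notin> Occ"
proof -
  obtain s where s: "s \<in> {1..n}" "s \<notin> Occ" using assms(1) by blast
  \<comment> \<open>A free space \<open>s\<close> is reached from \<open>a\<close> after \<open>s - a\<close> steps modulo \<open>n\<close>; adding \<open>n\<close> avoids negative numbers.\<close>
  have "(a - 1 + (s + n - a)) mod n + 1 = (s - 1 + n) mod n + 1"
    using assms(2) s by (intro arg_cong[of _ _ "\<lambda>i. i mod n + 1"]) auto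
  also have "\<dots> = s" using s(1) by (simp only: mod_add_self2) auto
  finally have "circ_shift n a (s + n - a) \<notin> Occ" using s by (simp add: circ_shift_def)
  then have free: "next_free n Occ a \<notin> Occ" unfolding next_free_def by (rule LeastI)
  moreover have "0 < n" using assms(2) by auto
  then have "next_free n Occ a \<in> {1..n}" by (simp add: next_free_def circ_shift_def Suc_leI)
  ultimately show "next_free n Occ a \<in> {1..n} - Occ" by simp
  have "(a - 1) mod n = a - 1" using assms(2) by (intro mod_less) auto
  then have zero: "circ_shift n a 0 = a" using assms(2) by (simp add: circ_shift_def)
  show "next_free n Occ a = a \<longleftrightarrow> a \<notin> Occ"
  proof
    assume "a \<notin> Occ"
    then have "(LEAST k. circ_shift n a k \<notin> Occ) = 0" using zero by (intro Least_equality) auto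
    then show "next_free n Occ a = a" using zero by (simp add: next_free_def)
  qed (use free in auto)
qed

lemma length_park [simp]: "length (park n Occ \<alpha>) = length \<alpha>"
  by (induction \<alpha> arbitrary: Occ) (auto simp: Let_def)

definition reluctance :: "nat \<Rightarrow> nat set \<Rightarrow> nat list \<Rightarrow> bool list" where
  "reluctance n Occ \<alpha> = map2 (\<noteq>) (park n Occ \<alpha>) \<alpha>"

lemma length_reluctance [simp]: "length (reluctance n Occ \<alpha>) = length \<alpha>"
  by (simp add: reluctance_def)

text \<open>
  Whatever the earlier cars did, the next car is reluctant for exactly as many preferences as
  there are occupied spaces.
\<close>

lemma card_reluctance:
  assumes "Occ \<subseteq> {1..n}" "card Occ + length R \<le> n"
  shows "finite {\<alpha>. set \<alpha> \<subseteq> {1..n} \<and> reluctance n Occ \<alpha> = R} \<and>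
    card {\<alpha>. set \<alpha> \<subseteq> {1..n} \<and> reluctance n Occ \<alpha> = R} = pattern_count n (card Occ) R"
  using assms
proof (induction R arbitrary: Occ)
  case Nil
  have "{\<alpha>. set \<alpha> \<subseteq> {1..n} \<and> reluctance n Occ \<alpha> = []} = {[]}"
    by (auto simp: reluctance_def zip_eq_Nil_iff dest: arg_cong[of _ _ length])
  then show ?case by simp
next
  case (Cons r R)
  let ?S = "\<lambda>Occ R. {\<alpha>. set \<alpha> \<subseteq> {1..n} \<and> reluctance n Occ \<alpha> = R}"
  let ?I = "{a \<in> {1..n}. (next_free n Occ a \<noteq> a) = r}"
  have finO: "finite Occ" using Cons.prems(1) finite_subset by auto
  have "Occ \<noteq> {1..n}" using Cons.prems(2) by auto
  then have sub: "Occ \<subset> {1..n}" using Cons.prems(1) by blast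
  have eq: "?S Occ (r # R) = (\<Union>a\<in>?I. (#) a ` ?S (insert (next_free n Occ a) Occ) R)"
  proof (intro equalityI subsetI)
    fix \<alpha> assume "\<alpha> \<in> ?S Occ (r # R)"
    then show "\<alpha> \<in> (\<Union>a\<in>?I. (#) a ` ?S (insert (next_free n Occ a) Occ) R)"
      by (cases \<alpha>) (auto simp: reluctance_def Let_def)
  qed (auto simp: reluctance_def Let_def)
  have IH: "finite (?S (insert (next_free n Occ a) Occ) R) \<and>
    card (?S (insert (next_free n Occ a) Occ) R) = pattern_count n (Suc (card Occ)) R" if "a \<in> ?I" for a
    using Cons.IH[of "insert (next_free n Occ a) Occ"] Cons.prems next_free(1)[OF sub, of a] that finO by auto
  have "?I = (if r then Occ else {1..n} - Occ)" using next_free(2)[OF sub] Cons.prems(1) by auto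
  then have cardI: "card ?I = (if r then card Occ else n - card Occ)"
    using card_Diff_subset[OF finO Cons.prems(1)] by simp
  have "card (?S Occ (r # R)) = (\<Sum>a\<in>?I. card ((#) a ` ?S (insert (next_free n Occ a) Occ) R))"
    unfolding eq by (intro card_UN_disjoint) (use IH in auto)
  also have "\<dots> = (\<Sum>a\<in>?I. pattern_count n (Suc (card Occ)) R)"
    using IH by (intro sum.cong) (auto simp: card_image)
  also have "\<dots> = pattern_count n (card Occ) (r # R)" using cardI by simp
  finally show ?case unfolding eq using IH by auto
qed

section \<open>Maximal chains\<close>

lemma length_T_attained:
  assumes "\<omega> \<in> hyperoctahedral n"
  shows "\<exists>ts. length ts = length_T n \<omega> \<and> set ts \<subseteq> reflections n \<and> word_product ts = \<omega>"
  using reflections_generate[OF assms] word_length_attained by blast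

lemma length_T_comp:
  assumes "\<omega> \<in> hyperoctahedral n" "\<omega>' \<in> hyperoctahedral n"
  shows "length_T n (\<omega> \<circ> \<omega>') \<le> length_T n \<omega> + length_T n \<omega>'"
proof -
  obtain ts ts' where "length ts = length_T n \<omega>" "set ts \<subseteq> reflections n" "word_product ts = \<omega>"
    "length ts' = length_T n \<omega>'" "set ts' \<subseteq> reflections n" "word_product ts' = \<omega>'"
    using length_T_attained assms by metis
  then show ?thesis using word_length_le[of "ts @ ts'" "reflections n"] by simp
qed

lemma length_T_id: "length_T n id = 0"
  using word_length_le[of "[]" "reflections n"] by simp

lemma length_T_eq_0: "\<omega> \<in> hyperoctahedral n \<Longrightarrow> length_T n \<omega> = 0 \<longleftrightarrow> \<omega> = id"
  using length_T_attained[of \<omega> n] length_T_id by fastforce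

lemma length_T_reflection: "t \<in> reflections n \<Longrightarrow> length_T n t = 1"
proof -
  assume t: "t \<in> reflections n"
  then have "length_T n t \<le> 1" using word_length_le[of "[t]" "reflections n"] by simp
  moreover have "length_T n t \<noteq> 0"
    using length_T_eq_0[OF reflection_hyperoctahedral[OF t]] t id_notin_reflections by blast
  ultimately show ?thesis by simp
qed

lemma length_T_eq_1:
  assumes "\<omega> \<in> hyperoctahedral n" "length_T n \<omega> = 1" shows "\<omega> \<in> reflections n"
proof -
  obtain ts where ts: "length ts = 1" "set ts \<subseteq> reflections n" "word_product ts = \<omega>"
    using length_T_attained[OF assms(1)] assms(2) by auto
  then obtain t where "ts = [t]" by (auto simp: length_Suc_conv)
  then show ?thesis using ts(2,3) by auto
qed

text \<open>The distance in the Cayley graph of the reflections; the absolute order is its geodesic order.\<close>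
definition dist_T :: "nat \<Rightarrow> (int \<Rightarrow> int) \<Rightarrow> (int \<Rightarrow> int) \<Rightarrow> nat" where
  "dist_T n x y = length_T n (inv x \<circ> y)"

lemma comp_inv_comp: "x \<in> hyperoctahedral n \<Longrightarrow> x \<circ> (inv x \<circ> y) = y"
  by (metis comp_assoc inv_comp_hyperoctahedral(2) id_comp)

lemma inv_comp_comp: "x \<in> hyperoctahedral n \<Longrightarrow> inv x \<circ> (x \<circ> y) = y"
  by (metis comp_assoc inv_comp_hyperoctahedral(1) id_comp)

lemma dist_T_triangle:
  assumes "x \<in> hyperoctahedral n" "y \<in> hyperoctahedral n" "z \<in> hyperoctahedral n"
  shows "dist_T n x z \<le> dist_T n x y + dist_T n y z"
proof -
  have "inv x \<circ> z = (inv x \<circ> y) \<circ> (inv y \<circ> z)"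
    using comp_inv_comp[OF assms(2)] by (metis comp_assoc)
  then show ?thesis
    unfolding dist_T_def using length_T_comp assms by (metis comp_hyperoctahedral inv_hyperoctahedral)
qed

lemma length_T_le_dist:
  assumes "x \<in> hyperoctahedral n" "y \<in> hyperoctahedral n"
  shows "length_T n y \<le> length_T n x + dist_T n x y"
proof -
  have "inv x \<circ> y \<in> hyperoctahedral n" using assms by (simp add: comp_hyperoctahedral inv_hyperoctahedral)
  from length_T_comp[OF assms(1) this] show ?thesis
    unfolding dist_T_def comp_inv_comp[OF assms(1)] .
qed

lemma dist_T_id: "dist_T n id x = length_T n x"
  by (simp add: dist_T_def)

lemma dist_T_eq_0:
  assumes "x \<in> hyperoctahedral n" "y \<in> hyperoctahedral n"
  shows "dist_T n x y = 0 \<longleftrightarrow> x = y"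
proof -
  have "inv x \<circ> y \<in> hyperoctahedral n" using assms by (simp add: comp_hyperoctahedral inv_hyperoctahedral)
  then have "dist_T n x y = 0 \<longleftrightarrow> inv x \<circ> y = id" unfolding dist_T_def by (rule length_T_eq_0)
  also have "\<dots> \<longleftrightarrow> x = y" by (metis assms(1) comp_id comp_inv_comp inv_comp_hyperoctahedral(1))
  finally show ?thesis .
qed

lemma dist_T_reflection:
  assumes "x \<in> hyperoctahedral n" "t \<in> reflections n"
  shows "dist_T n x (x \<circ> t) = 1"
  unfolding dist_T_def inv_comp_comp[OF assms(1)] by (rule length_T_reflection[OF assms(2)])

lemma abs_less_iff:
  "abs_less n x y \<longleftrightarrow> x \<noteq> y \<and> length_T n y = length_T n x + dist_T n x y"
  by (simp add: abs_less_def dist_T_def)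

lemma abs_less_length:
  assumes "x \<in> hyperoctahedral n" "y \<in> hyperoctahedral n" "abs_less n x y"
  shows "length_T n x < length_T n y"
  using assms dist_T_eq_0[OF assms(1,2)] by (simp add: abs_less_iff)

lemma abs_less_trans:
  assumes "x \<in> hyperoctahedral n" "y \<in> hyperoctahedral n" "z \<in> hyperoctahedral n"
    and "abs_less n x y" "abs_less n y z"
  shows "abs_less n x z"
proof -
  have "length_T n x < length_T n z" using abs_less_length assms less_trans by metis
  moreover have "length_T n z \<le> length_T n x + dist_T n x z" using length_T_le_dist assms by blast
  moreover have "dist_T n x z \<le> dist_T n x y + dist_T n y z" using dist_T_triangle assms by blast
  ultimately show ?thesis using assms(4,5) by (auto simp: abs_less_iff)
qed

definition reflection_chain :: "nat \<Rightarrow> (int \<Rightarrow> int) list \<Rightarrow> bool" where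
  "reflection_chain n ws \<longleftrightarrow> length ws = Suc n \<and> ws ! 0 = id \<and> ws ! n = coxeter_elt n \<and>
     (\<forall>i<n. \<exists>t\<in>reflections n. ws ! Suc i = ws ! i \<circ> t)"

text \<open>All points lie on one cycle, whose first half is increasing.\<close>
lemma cycle_form_coxeter_elt:
  assumes "1 \<le> n" shows "cycle_form n (coxeter_elt n) [1..int n] []"
proof -
  let ?L = "[1..int n]" and ?c = "coxeter_elt n"
  let ?cs = "?L @ map uminus ?L"
  have set: "set ?cs = signed_points n"
    by (force simp: signed_points_def image_iff)
  have "distinct ?cs" by (auto simp: distinct_map)
  then have rot: "map ?c ?cs = rotate1 ?cs"
    using cyclic_rotation[of ?cs 1] by (simp add: coxeter_elt_def del: map_append)
  have perm: "?c permutes signed_points n"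
    using cycle_permutes[of ?cs] unfolding coxeter_elt_def set .
  obtain L' where L: "?L = 1 # L'" using assms by (simp add: upto_rec1)
  have "map ?c ?L @ map ?c (map uminus ?L) = (L' @ [- 1]) @ (map uminus L' @ [1])"
    using rot unfolding map_append by (subst (asm) (3) L) (simp add: L)
  moreover have "length (map ?c ?L) = length (L' @ [- 1])" unfolding length_map by (subst L) simp
  ultimately have "map ?c ?L = L' @ [- 1] \<and> map ?c (map uminus ?L) = map uminus L' @ [1]"
    by (subst append_eq_append_conv[symmetric]) blast+
  then have pos: "map ?c ?L = L' @ [- 1]" and neg: "map ?c (map uminus ?L) = map uminus L' @ [1]"
    by blast+
  have "map (\<lambda>x. ?c (- x)) ?L = map (\<lambda>x. - ?c x) ?L"
    using neg arg_cong[OF pos, of "map uminus"] by (simp add: comp_def)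
  then have "?c (- x) = - ?c x" if "x \<in> set ?L" for x using that by simp
  then have odd: "?c (- x) = - ?c x" if "\<bar>x\<bar> \<in> set ?L" for x
    using that by (metis abs_if minus_minus)
  have "?c (- x) = - ?c x" for x
  proof (cases "x \<in> signed_points n")
    case True
    then show ?thesis using odd by (simp add: signed_points_abs)
  next
    case False
    then have "- x \<notin> signed_points n" by simp
    then show ?thesis using False perm by (simp add: permutes_def)
  qed
  then have hyp: "?c \<in> hyperoctahedral n" using perm by (simp add: hyperoctahedral_iff)
  have nth: "?c (?L ! i) = (L' @ [- 1]) ! i" if "i < length ?L" for i
    using that pos by (metis nth_map)
  have "path ?c ?L"
    unfolding path_def successively_conv_nth
  proof (intro allI impI)
    fix i assume i: "Suc i < length ?L"
    then have "i < length L'" using L by simp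
    then show "?c (?L ! i) = ?L ! Suc i" using nth[of i] i L by (simp add: nth_append)
  qed
  moreover have "?c (last ?L) = - hd ?L"
  proof -
    have "last (map ?c ?L) = - 1" using pos by simp
    moreover have "last (map ?c ?L) = ?c (last ?L)" by (rule last_map) (simp add: L)
    moreover have "hd ?L = 1" by (simp add: L)
    ultimately show ?thesis by simp
  qed
  moreover have "map abs ?L = ?L" by (rule map_idI) auto
  ultimately show ?thesis using hyp
    by (auto simp: cycle_form_def is_neg_cycle_def sorted_wrt_upto simp del: mset_map)
qed

lemma length_T_coxeter_elt:
  assumes "1 \<le> n" shows "length_T n (coxeter_elt n) = n"
proof -
  note f = cycle_form_coxeter_elt[OF assms]
  obtain ts where ts: "length ts = length_T n (coxeter_elt n)" "set ts \<subseteq> reflections n"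
    "word_product ts = coxeter_elt n"
    using length_T_attained[OF cycle_form_hyperoctahedral[OF f]] by blast
  then have "n \<le> length_T n (coxeter_elt n)" using cycle_form_word_product_length[OF f] by fastforce
  moreover have "length_T n (coxeter_elt n) \<le> n"
    using reflections_generate[OF cycle_form_hyperoctahedral[OF f]] word_length_le by (metis le_trans)
  ultimately show ?thesis by simp
qed

lemma NC_B_iff: "x \<in> NC_B n c \<longleftrightarrow> x \<in> hyperoctahedral n \<and> (abs_less n x c \<or> x = c)"
  by (auto simp: NC_B_def abs_less_iff dist_T_id length_T_id)

lemma reflection_chain_props:
  assumes n: "1 \<le> n" and ws: "reflection_chain n ws"
  shows "i \<le> n \<Longrightarrow> ws ! i \<in> hyperoctahedral n"
    and "i \<le> n \<Longrightarrow> length_T n (ws ! i) = i"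
    and "i < j \<Longrightarrow> j \<le> n \<Longrightarrow> abs_less n (ws ! i) (ws ! j)"
    and "i \<le> n \<Longrightarrow> ws ! i \<in> NC_B n (coxeter_elt n)"
proof -
  have step: "\<exists>t\<in>reflections n. ws ! Suc i = ws ! i \<circ> t" if "i < n" for i
    using ws that by (simp add: reflection_chain_def)
  have hyp: "ws ! i \<in> hyperoctahedral n" if "i \<le> n" for i
    using that
  proof (induction i)
    case 0
    have "ws ! 0 = id" using ws by (simp only: reflection_chain_def)
    then show ?case by (simp only: id_hyperoctahedral)
  next
    case (Suc i)
    then show ?case using step[of i] reflection_hyperoctahedral comp_hyperoctahedral
      by (metis Suc_le_lessD less_imp_le_nat)
  qed
  have d: "dist_T n (ws ! i) (ws ! (i + k)) \<le> k" if "i + k \<le> n" for i k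
    using that
  proof (induction k)
    case 0
    then show ?case using dist_T_eq_0 hyp by simp
  next
    case (Suc k)
    have "dist_T n (ws ! (i + k)) (ws ! Suc (i + k)) = 1"
      using step[of "i + k"] hyp[of "i + k"] dist_T_reflection Suc.prems by (metis Suc_le_lessD add_Suc_right less_imp_le_nat)
    moreover have "dist_T n (ws ! i) (ws ! (i + Suc k)) \<le>
      dist_T n (ws ! i) (ws ! (i + k)) + dist_T n (ws ! (i + k)) (ws ! (i + Suc k))"
      using Suc.prems by (intro dist_T_triangle hyp) auto
    ultimately show ?case using Suc by simp
  qed
  have d': "dist_T n (ws ! i) (ws ! j) \<le> j - i" if "i \<le> j" "j \<le> n" for i j
    using d[of i "j - i"] that by simp
  have ends: "ws ! 0 = id" "ws ! n = coxeter_elt n" using ws by (simp_all only: reflection_chain_def)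
  have len: "length_T n (ws ! i) = i" if "i \<le> n" for i
  proof -
    have "length_T n (ws ! i) \<le> i" using d'[of 0 i] that unfolding ends dist_T_id by simp
    moreover have "length_T n (ws ! n) = n" using length_T_coxeter_elt[OF n] ends by simp
    then have "n \<le> length_T n (ws ! i) + (n - i)"
      using length_T_le_dist[OF hyp hyp, of i n] d'[of i n] that by simp
    ultimately show ?thesis using that by simp
  qed
  have less: "abs_less n (ws ! i) (ws ! j)" if "i < j" "j \<le> n" for i j
  proof -
    have "j \<le> i + dist_T n (ws ! i) (ws ! j)"
      using length_T_le_dist[OF hyp hyp, of i j] len[of i] len[of j] that by simp
    then have "length_T n (ws ! j) = length_T n (ws ! i) + dist_T n (ws ! i) (ws ! j)"
      using d'[of i j] len[of i] len[of j] that by simp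
    moreover have "ws ! i \<noteq> ws ! j" using len[of i] len[of j] that by force
    ultimately show ?thesis by (simp add: abs_less_iff)
  qed
  show "i \<le> n \<Longrightarrow> ws ! i \<in> hyperoctahedral n" by (rule hyp)
  show "i \<le> n \<Longrightarrow> length_T n (ws ! i) = i" by (rule len)
  show "i < j \<Longrightarrow> j \<le> n \<Longrightarrow> abs_less n (ws ! i) (ws ! j)" by (rule less)
  show "i \<le> n \<Longrightarrow> ws ! i \<in> NC_B n (coxeter_elt n)"
    using hyp[of i] less[of i n] ends(2) by (auto simp: NC_B_iff order.order_iff_strict)
qed

text \<open>
  The reflection lengths along the chain are \<open>0, 1, \<dots>, n\<close>, and comparable elements of equal length
  coincide, so nothing can be inserted.
\<close>
lemma reflection_chain_maximal:
  assumes n: "1 \<le> n" and ws: "reflection_chain n ws"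
  shows "ws \<in> maximal_chains n (coxeter_elt n)"
proof -
  note p = reflection_chain_props[OF n ws]
  have len: "length ws = Suc n" using ws by (simp add: reflection_chain_def)
  let ?A = "NC_B n (coxeter_elt n)"
  have "sorted_wrt (abs_less n) ws"
    unfolding sorted_wrt_iff_nth_less using p(3) len by simp
  moreover have "pred_on.chain ?A (abs_less n) (set ws)"
    unfolding pred_on.chain_def
  proof (intro conjI ballI)
    show "set ws \<subseteq> ?A" using p(4) len by (auto simp: in_set_conv_nth)
    fix x y assume "x \<in> set ws" "y \<in> set ws"
    then obtain i j where "x = ws ! i" "y = ws ! j" "i \<le> n" "j \<le> n"
      using len by (metis in_set_conv_nth less_Suc_eq_le)
    then show "(abs_less n)\<^sup>=\<^sup>= x y \<or> (abs_less n)\<^sup>=\<^sup>= y x"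
      using p(3) by (cases i j rule: linorder_cases) auto
  qed
  moreover have "x \<in> set ws" if S: "pred_on.chain ?A (abs_less n) S" "set ws \<subseteq> S" "x \<in> S" for S x
  proof -
    have x: "x \<in> hyperoctahedral n" "abs_less n x (coxeter_elt n) \<or> x = coxeter_elt n"
      using S by (auto simp: pred_on.chain_def NC_B_iff)
    have "coxeter_elt n \<in> hyperoctahedral n"
      using cycle_form_hyperoctahedral[OF cycle_form_coxeter_elt[OF n]] .
    then have "length_T n x \<le> n"
      using abs_less_length[OF x(1)] x(2) length_T_coxeter_elt[OF n] by fastforce
    then have y: "ws ! length_T n x \<in> S" "length_T n (ws ! length_T n x) = length_T n x"
      "ws ! length_T n x \<in> hyperoctahedral n"
      using S(2) len p(1,2) by auto
    have "x = ws ! length_T n x"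
    proof (rule ccontr)
      assume "x \<noteq> ws ! length_T n x"
      moreover have "\<forall>x\<in>S. \<forall>y\<in>S. abs_less n x y \<or> x = y \<or> abs_less n y x"
        using S(1) by (auto simp: pred_on.chain_def)
      ultimately have "abs_less n x (ws ! length_T n x) \<or> abs_less n (ws ! length_T n x) x"
        using S(3) y(1) by blast
      then show False using abs_less_length x(1) y(2,3) by fastforce
    qed
    then show ?thesis using len \<open>length_T n x \<le> n\<close> by (metis less_Suc_eq_le nth_mem)
  qed
  ultimately show ?thesis unfolding maximal_chains_def pred_on.maxchain_def by blast
qed

text \<open>
  If two consecutive elements of a chain are not related by a reflection, the first factor of a
  shortest factorization of their quotient leads to an element strictly between them.
\<close>
lemma maximal_chain_reflections:
  assumes n: "1 \<le> n" and ws: "ws \<in> maximal_chains n (coxeter_elt n)"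
  shows "reflection_chain n ws"
proof -
  let ?c = "coxeter_elt n" and ?A = "NC_B n (coxeter_elt n)"
  have c: "?c \<in> hyperoctahedral n" using cycle_form_hyperoctahedral[OF cycle_form_coxeter_elt[OF n]] .
  have sorted: "sorted_wrt (abs_less n) ws" and chain: "pred_on.chain ?A (abs_less n) (set ws)"
    and max: "\<And>S. pred_on.chain ?A (abs_less n) S \<Longrightarrow> set ws \<subseteq> S \<Longrightarrow> S = set ws"
    using ws by (auto simp: maximal_chains_def pred_on.maxchain_def)
  have sub: "set ws \<subseteq> ?A" and comp: "\<And>x y. x \<in> set ws \<Longrightarrow> y \<in> set ws \<Longrightarrow> x = y \<or> abs_less n x y \<or> abs_less n y x"
    using chain by (auto simp: pred_on.chain_def)
  have hyp: "x \<in> hyperoctahedral n" if "x \<in> set ws" for x using that sub by (auto simp: NC_B_iff)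
  have ins: "z \<in> set ws" if "z \<in> ?A" "\<And>x. x \<in> set ws \<Longrightarrow> x = z \<or> abs_less n x z \<or> abs_less n z x" for z
  proof -
    have "pred_on.chain ?A (abs_less n) (insert z (set ws))"
      using that chain by (auto simp: pred_on.chain_def)
    then show ?thesis using max[of "insert z (set ws)"] by blast
  qed
  have less: "length_T n x < length_T n y" if "x \<in> set ws" "y \<in> set ws" "abs_less n x y" for x y
    using abs_less_length hyp that by blast
  have nth_less: "abs_less n (ws ! i) (ws ! j)" if "i < j" "j < length ws" for i j
    using sorted that by (simp add: sorted_wrt_iff_nth_less)
  have id_less: "x = id \<or> abs_less n id x" for x
    by (auto simp: abs_less_iff dist_T_id length_T_id)
  have id: "id \<in> set ws"
  proof (rule ins)
    show "id \<in> ?A" using id_less[of ?c] by (auto simp: NC_B_iff)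
  qed (use id_less in blast)
  have cin: "?c \<in> set ws"
  proof (rule ins)
    show "?c \<in> ?A" using c by (simp add: NC_B_iff)
  qed (use sub in \<open>auto simp: NC_B_iff\<close>)
  define N where "N = length ws - 1"
  have N: "length ws = Suc N" using id by (cases ws) (auto simp: N_def)
  have first: "ws ! 0 = id"
  proof -
    obtain k where k: "k < length ws" "ws ! k = id" using id by (metis in_set_conv_nth)
    have "k = 0"
    proof (rule ccontr)
      assume "k \<noteq> 0"
      then have "length_T n (ws ! 0) < length_T n id" using less nth_less[of 0 k] k id
        by (metis bot_nat_0.not_eq_extremum nth_mem order.strict_trans)
      then show False by (simp add: length_T_id)
    qed
    then show ?thesis using k by simp
  qed
  have last: "ws ! N = ?c"
  proof -
    obtain k where k: "k < length ws" "ws ! k = ?c" using cin by (metis in_set_conv_nth)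
    have "k = N"
    proof (rule ccontr)
      assume "k \<noteq> N"
      then have 1: "abs_less n ?c (ws ! N)" using nth_less[of k N] k N by auto
      have "ws ! N \<in> set ws" using N by simp
      then have "abs_less n (ws ! N) ?c \<or> ws ! N = ?c" using sub by (auto simp: NC_B_iff)
      then show False using 1 less[OF cin \<open>ws ! N \<in> set ws\<close> 1] less[OF \<open>ws ! N \<in> set ws\<close> cin] by auto
    qed
    then show ?thesis using k by simp
  qed
  have step: "dist_T n (ws ! i) (ws ! Suc i) = 1" if i: "i < N" for i
  proof -
    let ?x = "ws ! i" and ?y = "ws ! Suc i"
    have xy: "?x \<in> set ws" "?y \<in> set ws" using i N by auto
    then have h: "?x \<in> hyperoctahedral n" "?y \<in> hyperoctahedral n" using hyp by blast+
    have lt: "abs_less n ?x ?y" using nth_less[of i "Suc i"] i N by simp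
    then have len: "length_T n ?y = length_T n ?x + dist_T n ?x ?y" by (simp add: abs_less_iff)
    have "inv ?x \<circ> ?y \<in> hyperoctahedral n" using h by (simp add: comp_hyperoctahedral inv_hyperoctahedral)
    then obtain ts where ts: "length ts = dist_T n ?x ?y" "set ts \<subseteq> reflections n" "word_product ts = inv ?x \<circ> ?y"
      using length_T_attained unfolding dist_T_def by blast
    have "dist_T n ?x ?y \<noteq> 0" using lt dist_T_eq_0[OF h] by (simp add: abs_less_iff)
    then obtain t ts' where t: "ts = t # ts'" using ts(1) by (cases ts) auto
    let ?z = "?x \<circ> t"
    have z: "?z \<in> hyperoctahedral n" using t ts(2) h(1) by (simp add: comp_hyperoctahedral reflection_hyperoctahedral)
    have xz: "dist_T n ?x ?z = 1" using dist_T_reflection[OF h(1)] t ts(2) by simp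
    have "?z \<circ> word_product ts' = ?x \<circ> (inv ?x \<circ> ?y)" using ts(3) t by (metis comp_assoc word_product_Cons)
    then have "?z \<circ> word_product ts' = ?y" by (simp only: comp_inv_comp[OF h(1)])
    then have "inv ?z \<circ> ?y = word_product ts'" using inv_comp_comp[OF z] by metis
    then have zy: "dist_T n ?z ?y \<le> length ts'"
      using word_length_le[of ts' "reflections n"] ts(2) t by (simp add: dist_T_def)
    show ?thesis
    proof (rule ccontr)
      assume ne: "dist_T n ?x ?y \<noteq> 1"
      have l1: "length_T n ?z \<le> length_T n ?x + 1" using length_T_le_dist[OF h(1) z] xz by simp
      have l2: "length_T n ?y \<le> length_T n ?z + dist_T n ?z ?y" using length_T_le_dist[OF z h(2)] .
      have l3: "length ts' + 1 = dist_T n ?x ?y" using ts(1) t by simp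
      have lens: "length_T n ?z = length_T n ?x + 1" "length_T n ?y = length_T n ?z + dist_T n ?z ?y"
        using l1 l2 l3 len zy by linarith+
      have "length_T n ?z < length_T n ?y" using lens(1) len ne l3 by linarith
      then have az: "abs_less n ?x ?z" "abs_less n ?z ?y"
        using lens xz by (auto simp: abs_less_iff)
      have "?z \<in> set ws"
      proof (rule ins)
        have "abs_less n ?y ?c \<or> ?y = ?c" using sub xy(2) by (auto simp: NC_B_iff)
        then have "abs_less n ?z ?c" using az(2) abs_less_trans[OF z h(2) c] by auto
        then show "?z \<in> ?A" using z by (simp add: NC_B_iff)
        fix u assume u: "u \<in> set ws"
        then obtain j where j: "j < length ws" "u = ws ! j" by (metis in_set_conv_nth)
        show "u = ?z \<or> abs_less n u ?z \<or> abs_less n ?z u"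
        proof (cases "j \<le> i")
          case True
          then have "u = ?x \<or> abs_less n u ?x" using nth_less[of j i] j i N by (cases "j = i") auto
          then show ?thesis using az(1) abs_less_trans[OF hyp[OF u] h(1) z] by auto
        next
          case False
          then have "u = ?y \<or> abs_less n ?y u" using nth_less[of "Suc i" j] j by (cases "j = Suc i") auto
          then show ?thesis using az(2) abs_less_trans[OF z h(2) hyp[OF u]] by auto
        qed
      qed
      then obtain j where j: "j < length ws" "?z = ws ! j" by (metis in_set_conv_nth)
      have mono: "length_T n (ws ! p) \<le> length_T n (ws ! q)" if "p \<le> q" "q < length ws" for p q
        using less[OF _ _ nth_less[of p q]] that by (cases "p = q") auto
      show False
      proof (cases "j \<le> i")
        case True
        then have "length_T n ?z \<le> length_T n ?x" using mono[of j i] i N j by simp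
        then show False using lens by simp
      next
        case False
        then have "length_T n ?y \<le> length_T n ?z" using mono[of "Suc i" j] j by simp
        then show False using \<open>length_T n ?z < length_T n ?y\<close> by simp
      qed
    qed
  qed
  have len: "length_T n (ws ! i) = i" if "i \<le> N" for i
    using that
  proof (induction i)
    case 0
    show ?case using length_T_id unfolding first .
  next
    case (Suc i)
    have "abs_less n (ws ! i) (ws ! Suc i)" using nth_less[of i "Suc i"] Suc.prems N by simp
    then show ?case using step[of i] Suc by (simp add: abs_less_iff)
  qed
  have "N = n" using len[of N] last length_T_coxeter_elt[OF n] by simp
  moreover have "\<exists>t\<in>reflections n. ws ! Suc i = ws ! i \<circ> t" if "i < N" for i
  proof -
    have h: "ws ! i \<in> hyperoctahedral n" "ws ! Suc i \<in> hyperoctahedral n" using hyp that N by auto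
    then have "inv (ws ! i) \<circ> ws ! Suc i \<in> reflections n"
      using step[OF that] by (intro length_T_eq_1) (auto simp: dist_T_def comp_hyperoctahedral inv_hyperoctahedral)
    then show ?thesis using comp_inv_comp[OF h(1)] by metis
  qed
  ultimately show ?thesis using N first last by (simp only: reflection_chain_def) simp
qed

lemma maximal_chains_eq:
  "1 \<le> n \<Longrightarrow> maximal_chains n (coxeter_elt n) = {ws. reflection_chain n ws}"
  using reflection_chain_maximal maximal_chain_reflections by blast

lemma bad_edge_iff:
  assumes n: "1 \<le> n" and ws: "reflection_chain n ws" and i: "i < n"
  shows "(ws ! i, ws ! Suc i) \<in> bad_edges n (coxeter_elt n) \<longleftrightarrow> bruhat_less n (ws ! Suc i) (ws ! i)"
proof -
  note p = reflection_chain_props[OF n ws]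
  have "abs_covers n (ws ! Suc i) (ws ! i)"
    unfolding abs_covers_def
  proof (intro conjI notI)
    show "abs_less n (ws ! i) (ws ! Suc i)" using p(3)[of i "Suc i"] i by simp
    assume "\<exists>\<rho>. \<rho> \<in> hyperoctahedral n \<and> abs_less n (ws ! i) \<rho> \<and> abs_less n \<rho> (ws ! Suc i)"
    then obtain \<rho> where "\<rho> \<in> hyperoctahedral n" "abs_less n (ws ! i) \<rho>" "abs_less n \<rho> (ws ! Suc i)" by blast
    then have "length_T n (ws ! i) < length_T n \<rho>" "length_T n \<rho> < length_T n (ws ! Suc i)"
      using abs_less_length p(1)[of i] p(1)[of "Suc i"] i by simp_all
    then show False using p(2)[of i] p(2)[of "Suc i"] i by simp
  qed
  then show ?thesis using p(4)[of i] p(4)[of "Suc i"] i by (simp add: bad_edges_def edges_def)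
qed

section \<open>The bijection\<close>

text \<open>
  The one-point rules by which the recursion for \<open>lower_chains\<close> becomes a condition on the list.
\<close>
lemma peel_first_step:
  "(u = w \<and> (\<exists>t\<in>T. B w (F w t) = r \<and> L \<and> v = F w t \<and> Z \<and> Q)) \<longleftrightarrow>
   (L \<and> u = w \<and> Z \<and> (\<exists>t\<in>T. v = F u t \<and> B u v = r) \<and> Q)"
  by auto

lemma mem_lower_chains_iff:
  "us \<in> lower_chains n R \<omega> \<longleftrightarrow> length us = Suc (length R) \<and> us ! 0 = \<omega> \<and> us ! length R = id \<and>
    (\<forall>i<length R. \<exists>t\<in>reflections n. us ! Suc i = us ! i \<circ> t \<and> bruhat_less n (us ! i) (us ! Suc i) = R ! i)"
proof (induction R arbitrary: us \<omega>)
  case Nil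
  show ?case by (cases us) (auto split: if_splits)
next
  case (Cons r R)
  show ?case
  proof (cases us)
    case (Cons u us')
    define Z where "Z \<longleftrightarrow> us' ! length R = id"
    define Q where "Q \<longleftrightarrow> (\<forall>i<length R. \<exists>t\<in>reflections n. us' ! Suc i = us' ! i \<circ> t \<and> bruhat_less n (us' ! i) (us' ! Suc i) = R ! i)"
    have "us \<in> lower_chains n (r # R) \<omega> \<longleftrightarrow>
      u = \<omega> \<and> (\<exists>t\<in>reflections n. bruhat_less n \<omega> (\<omega> \<circ> t) = r \<and> us' \<in> lower_chains n R (\<omega> \<circ> t))"
      unfolding Cons lower_chains.simps down_steps_def by blast
    also have "\<dots> \<longleftrightarrow> length us = Suc (length (r # R)) \<and> us ! 0 = \<omega> \<and> us ! length (r # R) = id \<and>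
      (\<forall>i<length (r # R). \<exists>t\<in>reflections n. us ! Suc i = us ! i \<circ> t \<and>
         bruhat_less n (us ! i) (us ! Suc i) = (r # R) ! i)"
      unfolding Cons.IH Cons length_Cons All_less_Suc2 nth_Cons_0 nth_Cons_Suc Q_def[symmetric] Z_def[symmetric]
      by (simp only: nat.inject) (rule peel_first_step[where F = "(\<circ>)" and B = "bruhat_less n"])
    finally show ?thesis .
  qed auto
qed

text \<open>
  Reversing a chain turns it into one that is listed from the top, which also reverses the pattern.
\<close>
lemma card_maximal_chains_pattern:
  assumes n: "1 \<le> n" and R: "length R = n"
  defines "B \<equiv> {ws \<in> maximal_chains n (coxeter_elt n).
    map (\<lambda>i. (ws ! i, ws ! Suc i) \<in> bad_edges n (coxeter_elt n)) [0..<n] = R}"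
  shows "finite B \<and> card B = pattern_count n 0 R"
proof -
  let ?c = "coxeter_elt n" and ?L = "lower_chains n (rev R) (coxeter_elt n)"
  have "ws \<in> B \<longleftrightarrow> rev ws \<in> ?L" for ws
  proof -
    have "ws \<in> B \<longleftrightarrow> reflection_chain n ws \<and> (\<forall>i<n. bruhat_less n (ws ! Suc i) (ws ! i) = R ! i)"
      using bad_edge_iff[OF n, of ws] R
      by (auto simp: B_def maximal_chains_eq[OF n] list_eq_iff_nth_eq)
    also have "\<dots> \<longleftrightarrow> length ws = Suc n \<and> ws ! 0 = id \<and> ws ! n = ?c \<and>
      (\<forall>i<n. (\<exists>t\<in>reflections n. ws ! i = ws ! Suc i \<circ> t) \<and> bruhat_less n (ws ! Suc i) (ws ! i) = R ! i)"
    proof -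
      have "(\<exists>t\<in>reflections n. y = x \<circ> t) \<longleftrightarrow> (\<exists>t\<in>reflections n. x = y \<circ> t)" for x y :: "int \<Rightarrow> int"
        by (metis comp_assoc comp_id reflection_involution)
      then show ?thesis unfolding reflection_chain_def by blast
    qed
    also have "\<dots> \<longleftrightarrow> length ws = Suc n \<and> ws ! 0 = id \<and> ws ! n = ?c \<and>
      (\<forall>i<n. (\<exists>t\<in>reflections n. ws ! (n - Suc i) = ws ! (n - i) \<circ> t) \<and>
         bruhat_less n (ws ! (n - i)) (ws ! (n - Suc i)) = R ! (n - Suc i))"
    proof -
      have "(\<forall>i<n. P (n - Suc i) (n - i)) \<longleftrightarrow> (\<forall>i<n. P i (Suc i))" for P
      proof (intro iffI allI impI)
        fix i assume "\<forall>i<n. P (n - Suc i) (n - i)" "i < n"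
        moreover have "n - Suc (n - Suc i) = i" "n - (n - Suc i) = Suc i" using \<open>i < n\<close> by auto
        ultimately show "P i (Suc i)" by (metis diff_Suc_less gr_implies_not0 not_gr0)
      next
        fix i assume "\<forall>i<n. P i (Suc i)" "i < n"
        then show "P (n - Suc i) (n - i)" by (metis Suc_diff_Suc diff_less_Suc diff_Suc_less gr_implies_not0 not_gr0)
      qed
      from this[of "\<lambda>i j. (\<exists>t\<in>reflections n. ws ! i = ws ! j \<circ> t) \<and> bruhat_less n (ws ! j) (ws ! i) = R ! i"]
      show ?thesis by simp
    qed
    also have "\<dots> \<longleftrightarrow> rev ws \<in> ?L"
    proof (cases "length ws = Suc n")
      case True
      have *: "rev ws ! i = ws ! (n - i)" if "i \<le> n" for i using that True by (simp add: rev_nth)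
      have **: "rev R ! i = R ! (n - Suc i)" if "i < n" for i using that R by (simp add: rev_nth)
      show ?thesis
        unfolding mem_lower_chains_iff length_rev R
        using True *[of 0] *[of n] by (auto simp: * **)
    qed (auto simp: mem_lower_chains_iff R)
    finally show ?thesis .
  qed
  note B_iff = this
  have eq: "B = rev ` ?L"
  proof (intro equalityI subsetI)
    fix ws assume "ws \<in> B"
    then have "rev (rev ws) \<in> rev ` ?L" using B_iff by blast
    then show "ws \<in> rev ` ?L" by simp
  next
    fix ws assume "ws \<in> rev ` ?L"
    then have "rev ws \<in> ?L" by (elim imageE) simp
    then show "ws \<in> B" using B_iff by blast
  qed
  have "card B = card ?L" unfolding eq by (rule card_image) simp
  also have "\<dots> = split_count (rev R) (length [1..int n]) (map length ([] :: int list list))"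
    by (rule card_lower_chains[OF n cycle_form_coxeter_elt[OF n]]) (simp add: R)
  also have "\<dots> = pattern_count n 0 R" using split_count_rev[OF R] by simp
  finally show ?thesis unfolding eq using finite_lower_chains by blast
qed

lemma fibrewise_bijection:
  assumes fin: "\<And>p. finite {a \<in> A. f a = p}" "\<And>p. finite {b \<in> B. g b = p}"
    and card: "\<And>p. card {a \<in> A. f a = p} = card {b \<in> B. g b = p}"
  shows "\<exists>\<phi>. bij_betw \<phi> A B \<and> (\<forall>a\<in>A. g (\<phi> a) = f a)"
proof -
  have "\<forall>p. \<exists>h. bij_betw h {a \<in> A. f a = p} {b \<in> B. g b = p}"
    using finite_same_card_bij[OF fin card] by blast
  then obtain h where h: "\<And>p. bij_betw (h p) {a \<in> A. f a = p} {b \<in> B. g b = p}" by metis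
  define \<phi> where "\<phi> a = h (f a) a" for a
  have \<phi>: "\<phi> a \<in> B \<and> g (\<phi> a) = f a" if "a \<in> A" for a
    using bij_betwE[OF h[of "f a"]] that by (auto simp: \<phi>_def)
  have "inj_on \<phi> A"
  proof (rule inj_onI)
    fix a a' assume a: "a \<in> A" "a' \<in> A" "\<phi> a = \<phi> a'"
    then have "f a = f a'" using \<phi> by metis
    then show "a = a'" using bij_betw_imp_inj_on[OF h[of "f a"]] a by (auto simp: \<phi>_def inj_on_def)
  qed
  moreover have "b \<in> \<phi> ` A" if "b \<in> B" for b
  proof -
    have "b \<in> h (g b) ` {a \<in> A. f a = g b}" using bij_betw_imp_surj_on[OF h[of "g b"]] that by simp
    then obtain a where "a \<in> A" "f a = g b" "b = h (g b) a" by blast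
    then have "b = \<phi> a" by (simp add: \<phi>_def)
    then show ?thesis using \<open>a \<in> A\<close> by blast
  qed
  ultimately have "bij_betw \<phi> A B" using \<phi> by (auto simp: bij_betw_def)
  then show ?thesis using \<phi> by blast
qed

theorem theorem1p3:
  fixes n :: nat
  assumes "n \<ge> 1"
  shows "\<exists>\<phi> :: nat list \<Rightarrow> (int \<Rightarrow> int) list.
    bij_betw \<phi> (parking_functions_B n) (maximal_chains n (coxeter_elt n)) \<and>
    (\<forall>\<alpha> \<in> parking_functions_B n.
       length (\<phi> \<alpha>) = n + 1 \<and> \<phi> \<alpha> ! 0 = id \<and> \<phi> \<alpha> ! n = coxeter_elt n \<and>
       (\<forall>i \<in> {1..n}. reluctant n \<alpha> i \<longleftrightarrow>
          (\<phi> \<alpha> ! (i - 1), \<phi> \<alpha> ! i) \<in> bad_edges n (coxeter_elt n)))"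
proof -
  let ?A = "parking_functions_B n" and ?B = "maximal_chains n (coxeter_elt n)"
  let ?f = "reluctance n {}"
  let ?g = "\<lambda>ws. map (\<lambda>i. (ws ! i, ws ! Suc i) \<in> bad_edges n (coxeter_elt n)) [0..<n]"
  have A: "finite {\<alpha> \<in> ?A. ?f \<alpha> = R} \<and> card {\<alpha> \<in> ?A. ?f \<alpha> = R} = pattern_count n 0 R" if "length R = n" for R
  proof -
    have "{\<alpha> \<in> ?A. ?f \<alpha> = R} = {\<alpha>. set \<alpha> \<subseteq> {1..n} \<and> ?f \<alpha> = R}"
      using that unfolding parking_functions_B_def by (auto dest: arg_cong[of _ _ length])
    then show ?thesis using card_reluctance[of "{}" n R] that by simp
  qed
  have empty: "{\<alpha> \<in> ?A. ?f \<alpha> = R} = {}" "{ws \<in> ?B. ?g ws = R} = {}" if "length R \<noteq> n" for R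
    using that by (auto simp: parking_functions_B_def)
  have "\<exists>\<phi>. bij_betw \<phi> ?A ?B \<and> (\<forall>\<alpha>\<in>?A. ?g (\<phi> \<alpha>) = ?f \<alpha>)"
  proof (rule fibrewise_bijection)
    fix R
    show "finite {\<alpha> \<in> ?A. ?f \<alpha> = R}"
    proof (cases "length R = n")
      case True
      then show ?thesis by (rule A[THEN conjunct1])
    qed (simp only: empty finite.emptyI not_False_eq_True)
    show "finite {ws \<in> ?B. ?g ws = R}"
    proof (cases "length R = n")
      case True
      then show ?thesis by (rule card_maximal_chains_pattern[OF assms, THEN conjunct1])
    qed (simp only: empty finite.emptyI not_False_eq_True)
    show "card {\<alpha> \<in> ?A. ?f \<alpha> = R} = card {ws \<in> ?B. ?g ws = R}"
    proof (cases "length R = n")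
      case True
      show ?thesis
        by (rule trans[OF A[OF True, THEN conjunct2]
              card_maximal_chains_pattern[OF assms True, THEN conjunct2, symmetric]])
    qed (simp only: empty card.empty not_False_eq_True)
  qed
  then obtain \<phi> where \<phi>: "bij_betw \<phi> ?A ?B" "\<And>\<alpha>. \<alpha> \<in> ?A \<Longrightarrow> ?g (\<phi> \<alpha>) = ?f \<alpha>" by blast
  show ?thesis
  proof (intro exI[of _ \<phi>] conjI ballI)
    show "bij_betw \<phi> ?A ?B" by (rule \<phi>(1))
    fix \<alpha> assume \<alpha>: "\<alpha> \<in> ?A"
    then have "reflection_chain n (\<phi> \<alpha>)"
      using bij_betwE[OF \<phi>(1)] maximal_chain_reflections[OF assms] by blast
    then show "length (\<phi> \<alpha>) = n + 1" "\<phi> \<alpha> ! 0 = id" "\<phi> \<alpha> ! n = coxeter_elt n"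
      by (simp_all only: reflection_chain_def Suc_eq_plus1)
    fix i assume i: "i \<in> {1..n}"
    have "length \<alpha> = n" using \<alpha> by (simp add: parking_functions_B_def)
    then have "?f \<alpha> ! (i - 1) = reluctant n \<alpha> i" using i by (auto simp: reluctance_def reluctant_def)
    moreover have "?g (\<phi> \<alpha>) ! (i - 1) = ((\<phi> \<alpha> ! (i - 1), \<phi> \<alpha> ! i) \<in> bad_edges n (coxeter_elt n))"
    proof -
      obtain j where "i = Suc j" using i by (cases i) auto
      then show ?thesis using i by simp
    qed
    ultimately show "reluctant n \<alpha> i \<longleftrightarrow> (\<phi> \<alpha> ! (i - 1), \<phi> \<alpha> ! i) \<in> bad_edges n (coxeter_elt n)"
      using \<phi>(2)[OF \<alpha>] by simp
  qed
qed

end
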